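(* The set $\mathrm{HCopies}([0,1]) = \{ Y \in \mathrm{TOP} : Y \cong_{\mathrm{homeo}} [0,1] \}$ is $\mathbf{\Pi}^0_4$-Wadge-complete (that is, the unit interval $[0,1]$ has topological Scott complexity $\mathbf{\Pi}^0_4$).
   Context: A sequence $(x_i)_{i\in\mathbb{N}}$ in a metric space is a fast Cauchy sequence if $d(x_i,x_{i+1})<2^{-i}$ for all $i$. A presentation of a Polish space $X$ is a countable set $M$ of points (identified with $\mathbb{N}$) together with a metric $d$ on $M$ such that $X$ is homeomorphic to the completion $\overline{M}$ of $(M,d)$; the metric is represented by giving, for every two elements $x,y\in M$, a fast Cauchy sequence of rationals $(q(x,y,k))_{k\in\mathbb{N}}$ converging to $d(x,y)$. A presentation is thus a function $q:\mathbb{N}^3\to\mathbb{Q}$, which is identified with an infinite binary string via a fixed computable coding (e.g. of its graph). $\mathrm{TOP}\subseteq 2^{\omega}$ is the space of all presentations of Polish spaces, with the subspace topology; it is a $\Pi^0_2$ subset of $2^\omega$, hence Polish, and is homeomorphic to Baire space $\omega^\omega$. For $Y\in\mathrm{TOP}$, $Y\cong_{\mathrm{homeo}} X$ means that the completion of the metric space presented by $Y$ is homeomorphic to $X$. For $B\subseteq\omega^\omega$ and $A\subseteq\mathrm{TOP}$, $B$ is Wadge reducible to $A$ if there is a continuous $f:\omega^\omega\to\mathrm{TOP}$ with $x\in B \iff f(x)\in A$ for all $x$. For a (boldface) pointclass $\Gamma$, a set $A$ is $\Gamma$-Wadge-complete if $A\in\Gamma$ and every $B\subseteq\omega^\omega$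 with $B\in\Gamma$ is Wadge reducible to $A$. *)

theory Defs
  imports "HOL-Analysis.Analysis" "HOL-Library.Nat_Bijection"
begin

context Metric_space
begin

definition cauchy_equiv :: "((nat \<Rightarrow> 'a) \<times> (nat \<Rightarrow> 'a)) set" where
  "cauchy_equiv = {(s, t). MCauchy s \<and> MCauchy t \<and> (\<lambda>n. d (s n) (t n)) \<longlonglongrightarrow> 0}"

definition mcompletion :: "(nat \<Rightarrow> 'a) set set" where
  "mcompletion = {s. MCauchy s} // cauchy_equiv"

definition mcompletion_dist :: "(nat \<Rightarrow> 'a) set \<Rightarrow> (nat \<Rightarrow> 'a) set \<Rightarrow> real" where
  "mcompletion_dist P Q = (THE r. \<forall>s\<in>P. \<forall>t\<in>Q. (\<lambda>n. d (s n) (t n)) \<longlonglongrightarrow> r)"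

text \<open>The \<open>if\<close> only makes the distance nonnegative and symmetric off the carrier, as
  \<^locale>\<open>Metric_space\<close> demands of its total distance function.\<close>

definition mcompletion_metric :: "(nat \<Rightarrow> 'a) set \<Rightarrow> (nat \<Rightarrow> 'a) set \<Rightarrow> real" where
  "mcompletion_metric P Q =
     (if P \<in> mcompletion \<and> Q \<in> mcompletion then mcompletion_dist P Q else 0)"

definition mcompletion_topology :: "(nat \<Rightarrow> 'a) set topology" where
  "mcompletion_topology = Metric_space.mtopology mcompletion mcompletion_metric"

definition mcompletion_embed :: "'a \<Rightarrow> (nat \<Rightarrow> 'a) set" where
  "mcompletion_embed x = cauchy_equiv `` {\<lambda>_. x}"

lemma quad_ineq:
  assumes "a \<in> M" "b \<in> M" "a' \<in> M" "b' \<in> M"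
  shows "\<bar>d a b - d a' b'\<bar> \<le> d a a' + d b b'"
proof -
  have "d a b \<le> d a a' + d a' b" "d a' b \<le> d a' b' + d b' b"
       "d a' b' \<le> d a' a + d a b'" "d a b' \<le> d a b + d b b'"
    using assms triangle by blast+
  then show ?thesis by (simp add: commute abs_le_iff)
qed

lemma MCauchy_in: "MCauchy s \<Longrightarrow> s n \<in> M"
  by (auto simp: MCauchy_def)

lemma MCauchy_dist_convergent:
  assumes s: "MCauchy s" and t: "MCauchy t"
  shows "\<exists>r. (\<lambda>n. d (s n) (t n)) \<longlonglongrightarrow> r"
proof -
  have "Cauchy (\<lambda>n. d (s n) (t n))"
  proof (rule metric_CauchyI)
    fix e :: real assume "e > 0"
    then have e2: "e/2 > 0" by simp
    obtain N1 where N1: "\<And>m n. N1 \<le> m \<Longrightarrow> N1 \<le> n \<Longrightarrow> d (s m) (s n) < e/2"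
      using s e2 unfolding MCauchy_def by meson
    obtain N2 where N2: "\<And>m n. N2 \<le> m \<Longrightarrow> N2 \<le> n \<Longrightarrow> d (t m) (t n) < e/2"
      using t e2 unfolding MCauchy_def by meson
    have "dist (d (s m) (t m)) (d (s n) (t n)) < e" if "max N1 N2 \<le> m" "max N1 N2 \<le> n" for m n
      using N1[of m n] N2[of m n] that
        quad_ineq[of "s m" "t m" "s n" "t n"] MCauchy_in[OF s] MCauchy_in[OF t]
      by (fastforce simp: dist_real_def)
    then show "\<exists>N. \<forall>m\<ge>N. \<forall>n\<ge>N. dist (d (s m) (t m)) (d (s n) (t n)) < e" by blast
  qed
  then show ?thesis
    using Cauchy_convergent_iff convergent_def by blast
qed

lemma equiv_cauchy_equiv: "equiv {s. MCauchy s} cauchy_equiv"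
proof (rule equivI)
  show "cauchy_equiv \<subseteq> {s. MCauchy s} \<times> {s. MCauchy s}"
    by (auto simp: cauchy_equiv_def)
  show "refl_on {s. MCauchy s} cauchy_equiv"
    by (auto simp: cauchy_equiv_def refl_on_def MCauchy_in)
  show "sym cauchy_equiv"
    by (auto simp: cauchy_equiv_def sym_def commute)
  show "trans cauchy_equiv"
  proof (rule transI)
    fix s t u assume "(s, t) \<in> cauchy_equiv" "(t, u) \<in> cauchy_equiv"
    then have *: "MCauchy s" "MCauchy t" "MCauchy u" "(\<lambda>n. d (s n) (t n)) \<longlonglongrightarrow> 0"
        "(\<lambda>n. d (t n) (u n)) \<longlonglongrightarrow> 0"
      by (auto simp: cauchy_equiv_def)
    have "(\<lambda>n. d (s n) (t n) + d (t n) (u n)) \<longlonglongrightarrow> 0"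
      using tendsto_add[OF *(4,5)] by simp
    then have "(\<lambda>n. d (s n) (u n)) \<longlonglongrightarrow> 0"
      by (rule Lim_null_comparison[rotated])
         (use * in \<open>auto intro!: always_eventually triangle MCauchy_in\<close>)
    with * show "(s, u) \<in> cauchy_equiv" by (auto simp: cauchy_equiv_def)
  qed
qed

lemma mcompletion_dist_limit:
  assumes "P \<in> mcompletion" "Q \<in> mcompletion" "s \<in> P" "t \<in> Q"
  shows "(\<lambda>n. d (s n) (t n)) \<longlonglongrightarrow> mcompletion_dist P Q"
proof -
  have mem: "MCauchy s" "MCauchy t"
    using assms equiv_cauchy_equiv in_quotient_imp_subset unfolding mcompletion_def by blast+
  obtain r where r: "(\<lambda>n. d (s n) (t n)) \<longlonglongrightarrow> r"
    using MCauchy_dist_convergent mem by blast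
  have all: "\<forall>s'\<in>P. \<forall>t'\<in>Q. (\<lambda>n. d (s' n) (t' n)) \<longlonglongrightarrow> r"
  proof (intro ballI)
    fix s' t' assume "s' \<in> P" "t' \<in> Q"
    then have e: "(s', s) \<in> cauchy_equiv" "(t', t) \<in> cauchy_equiv"
      using assms equiv_cauchy_equiv unfolding mcompletion_def
      by (meson quotient_eq_iff)+
    then have l: "(\<lambda>n. d (s' n) (s n)) \<longlonglongrightarrow> 0" "(\<lambda>n. d (t' n) (t n)) \<longlonglongrightarrow> 0"
      and c: "MCauchy s'" "MCauchy t'"
      by (auto simp: cauchy_equiv_def)
    have "(\<lambda>n. d (s' n) (s n) + d (t' n) (t n)) \<longlonglongrightarrow> 0"
      using tendsto_add[OF l] by simp
    then have "(\<lambda>n. d (s' n) (t' n) - d (s n) (t n)) \<longlonglongrightarrow> 0"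
      by (rule Lim_null_comparison[rotated])
         (use c mem in \<open>auto intro!: always_eventually quad_ineq MCauchy_in\<close>)
    from tendsto_add[OF this r] show "(\<lambda>n. d (s' n) (t' n)) \<longlonglongrightarrow> r" by simp
  qed
  have "mcompletion_dist P Q = r"
    unfolding mcompletion_dist_def
    by (rule the_equality) (use all assms r LIMSEQ_unique in blast)+
  with r show ?thesis by simp
qed

lemma mcompletion_rep:
  assumes "P \<in> mcompletion" obtains s where "s \<in> P" "MCauchy s"
  using assms equiv_cauchy_equiv in_quotient_imp_non_empty in_quotient_imp_subset
  unfolding mcompletion_def by blast

lemma Metric_space_mcompletion: "Metric_space mcompletion mcompletion_metric"
proof
  fix P Q
  show "0 \<le> mcompletion_metric P Q"
  proof (cases "P \<in> mcompletion \<and> Q \<in> mcompletion")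
    case True
    then obtain s t where "s \<in> P" "t \<in> Q" by (meson mcompletion_rep)
    then have "(\<lambda>n. d (s n) (t n)) \<longlonglongrightarrow> mcompletion_metric P Q"
      using True mcompletion_dist_limit by (simp add: mcompletion_metric_def)
    then show ?thesis by (rule LIMSEQ_le_const) auto
  qed (auto simp: mcompletion_metric_def)
  show "mcompletion_metric P Q = mcompletion_metric Q P"
  proof (cases "P \<in> mcompletion \<and> Q \<in> mcompletion")
    case True
    then obtain s t where st: "s \<in> P" "t \<in> Q" by (meson mcompletion_rep)
    have "(\<lambda>n. d (s n) (t n)) \<longlonglongrightarrow> mcompletion_dist P Q" "(\<lambda>n. d (t n) (s n)) \<longlonglongrightarrow> mcompletion_dist Q P"
      using True st mcompletion_dist_limit by blast+
    then have "mcompletion_dist P Q = mcompletion_dist Q P"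
      by (simp add: commute[of "t _"] LIMSEQ_unique)
    with True show ?thesis by (simp add: mcompletion_metric_def)
  qed (auto simp: mcompletion_metric_def)
next
  fix P Q assume PQ: "P \<in> mcompletion" "Q \<in> mcompletion"
  obtain s t where st: "s \<in> P" "t \<in> Q" "MCauchy s" "MCauchy t" by (meson PQ mcompletion_rep)
  have lim: "(\<lambda>n. d (s n) (t n)) \<longlonglongrightarrow> mcompletion_metric P Q"
    using PQ st mcompletion_dist_limit by (simp add: mcompletion_metric_def)
  have "mcompletion_metric P Q = 0 \<longleftrightarrow> (s, t) \<in> cauchy_equiv"
    using lim LIMSEQ_unique st by (auto simp: cauchy_equiv_def)
  also have "\<dots> \<longleftrightarrow> P = Q"
    using PQ st equiv_cauchy_equiv unfolding mcompletion_def by (metis quotient_eq_iff)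
  finally show "mcompletion_metric P Q = 0 \<longleftrightarrow> P = Q" .
next
  fix P Q R assume PQR: "P \<in> mcompletion" "Q \<in> mcompletion" "R \<in> mcompletion"
  obtain s t u where *: "s \<in> P" "t \<in> Q" "u \<in> R" "MCauchy s" "MCauchy t" "MCauchy u"
    by (meson PQR mcompletion_rep)
  have "mcompletion_dist P R \<le> mcompletion_dist P Q + mcompletion_dist Q R"
    by (rule LIMSEQ_le[OF mcompletion_dist_limit tendsto_add[OF mcompletion_dist_limit mcompletion_dist_limit]])
       (use PQR * in \<open>auto intro!: triangle MCauchy_in\<close>)
  then show "mcompletion_metric P R \<le> mcompletion_metric P Q + mcompletion_metric Q R"
    using PQR by (simp add: mcompletion_metric_def)
qed

interpretation Compl: Metric_space mcompletion mcompletion_metric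
  by (rule Metric_space_mcompletion)

lemma MCauchy_const: "x \<in> M \<Longrightarrow> MCauchy (\<lambda>_. x)"
  by (auto simp: MCauchy_def)

lemma mcompletion_embed_in: "x \<in> M \<Longrightarrow> mcompletion_embed x \<in> mcompletion"
  by (simp add: mcompletion_embed_def mcompletion_def quotientI MCauchy_const)

lemma mcompletion_embed_self: "x \<in> M \<Longrightarrow> (\<lambda>_. x) \<in> mcompletion_embed x"
  by (simp add: mcompletion_embed_def cauchy_equiv_def MCauchy_const)

lemma mcompletion_embed_isometry:
  assumes "x \<in> M" "y \<in> M"
  shows "mcompletion_metric (mcompletion_embed x) (mcompletion_embed y) = d x y"
  using mcompletion_dist_limit[of "mcompletion_embed x" "mcompletion_embed y" "\<lambda>_. x" "\<lambda>_. y"]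
    assms mcompletion_embed_in mcompletion_embed_self
  by (simp add: mcompletion_metric_def LIMSEQ_const_iff)

lemma mcompletion_embed_limit:
  assumes "P \<in> mcompletion" "s \<in> P" "MCauchy s" "e > 0"
  shows "\<exists>N. \<forall>n\<ge>N. mcompletion_metric (mcompletion_embed (s n)) P < e"
proof -
  obtain N where N: "\<And>m n. N \<le> m \<Longrightarrow> N \<le> n \<Longrightarrow> d (s m) (s n) < e/2"
    using assms(3) \<open>e > 0\<close> half_gt_zero unfolding MCauchy_def by meson
  have "mcompletion_metric (mcompletion_embed (s n)) P < e" if "N \<le> n" for n
  proof -
    have "(\<lambda>k. d (s n) (s k)) \<longlonglongrightarrow> mcompletion_metric (mcompletion_embed (s n)) P"
      using mcompletion_dist_limit[of "mcompletion_embed (s n)" P "\<lambda>_. s n" s]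
        assms MCauchy_in[OF assms(3)] mcompletion_embed_in mcompletion_embed_self
      by (simp add: mcompletion_metric_def)
    then have "mcompletion_metric (mcompletion_embed (s n)) P \<le> e/2"
      by (rule LIMSEQ_le_const2) (use N that in \<open>force intro: less_imp_le\<close>)
    with \<open>e > 0\<close> show ?thesis by simp
  qed
  then show ?thesis by blast
qed

lemma mcompletion_embed_dense:
  "mcompletion_topology closure_of (mcompletion_embed ` M) = mcompletion"
proof -
  have "\<exists>x\<in>M. mcompletion_metric P (mcompletion_embed x) < e" if "P \<in> mcompletion" "e > 0" for P e
    using that mcompletion_rep mcompletion_embed_limit MCauchy_in Compl.commute
    by (metis order_refl)
  then show ?thesis
    using mcompletion_embed_in
    by (fastforce simp: mcompletion_topology_def Compl.metric_closure_of Compl.mball_def)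
qed

lemma mcompletion_complete: "Metric_space.mcomplete mcompletion mcompletion_metric"
  unfolding Compl.mcomplete_def
proof (intro allI impI)
  fix \<sigma> assume \<sigma>: "Compl.MCauchy \<sigma>"
  then have \<sigma>in: "\<sigma> n \<in> mcompletion" for n by (auto simp: Compl.MCauchy_def)
  have "\<exists>x\<in>M. mcompletion_metric (mcompletion_embed x) (\<sigma> n) < inverse (Suc n)" for n
  proof -
    obtain s where "s \<in> \<sigma> n" "MCauchy s" using \<sigma>in mcompletion_rep by blast
    then show ?thesis
      using mcompletion_embed_limit[OF \<sigma>in, of s n "inverse (Suc n)"] MCauchy_in by force
  qed
  then obtain x where x: "\<And>n. x n \<in> M"
      "\<And>n. mcompletion_metric (mcompletion_embed (x n)) (\<sigma> n) < inverse (Suc n)" by metis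
  have x0: "(\<lambda>n. mcompletion_metric (mcompletion_embed (x n)) (\<sigma> n)) \<longlonglongrightarrow> 0"
    by (rule Lim_null_comparison[OF _ LIMSEQ_inverse_real_of_nat])
       (use x in \<open>auto intro!: always_eventually less_imp_le\<close>)
  have X: "MCauchy x"
    unfolding MCauchy_def
  proof (intro conjI allI impI)
    show "range x \<subseteq> M" using x by auto
    fix e :: real assume "e > 0"
    obtain N1 where N1: "\<And>m n. N1 \<le> m \<Longrightarrow> N1 \<le> n \<Longrightarrow> mcompletion_metric (\<sigma> m) (\<sigma> n) < e/3"
      using \<sigma> \<open>e > 0\<close> unfolding Compl.MCauchy_def by (meson zero_less_divide_iff zero_less_numeral)
    obtain N2 where N2: "\<And>n. N2 \<le> n \<Longrightarrow> mcompletion_metric (mcompletion_embed (x n)) (\<sigma> n) < e/3"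
      using LIMSEQ_D[OF x0, of "e/3"] \<open>e > 0\<close> by auto
    have "d (x m) (x n) < e" if "max N1 N2 \<le> m" "max N1 N2 \<le> n" for m n
    proof -
      let ?e = mcompletion_embed
      have i: "?e (x k) \<in> mcompletion" for k using x mcompletion_embed_in by blast
      have "d (x m) (x n) = mcompletion_metric (?e (x m)) (?e (x n))"
        using x mcompletion_embed_isometry by simp
      also have "\<dots> \<le> mcompletion_metric (?e (x m)) (\<sigma> m) + mcompletion_metric (\<sigma> m) (?e (x n))"
        using i \<sigma>in Compl.triangle by blast
      also have "mcompletion_metric (\<sigma> m) (?e (x n))
          \<le> mcompletion_metric (\<sigma> m) (\<sigma> n) + mcompletion_metric (\<sigma> n) (?e (x n))"
        using i \<sigma>in Compl.triangle by blast
      finally show ?thesis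
        using N1[of m n] N2[of m] N2[of n] that Compl.commute[of "\<sigma> n"] by simp
    qed
    then show "\<exists>N. \<forall>n n'. N \<le> n \<longrightarrow> N \<le> n' \<longrightarrow> d (x n) (x n') < e" by blast
  qed
  define P where "P = cauchy_equiv `` {x}"
  have P: "P \<in> mcompletion" "x \<in> P"
    using X by (simp_all add: P_def mcompletion_def quotientI) (simp add: cauchy_equiv_def MCauchy_in)
  have xP: "(\<lambda>n. mcompletion_metric (mcompletion_embed (x n)) P) \<longlonglongrightarrow> 0"
    by (rule LIMSEQ_I) (use mcompletion_embed_limit[OF P X] in auto)
  have "(\<lambda>n. mcompletion_metric (mcompletion_embed (x n)) (\<sigma> n) + mcompletion_metric (mcompletion_embed (x n)) P) \<longlonglongrightarrow> 0"
    using tendsto_add[OF x0 xP] by simp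
  then have "(\<lambda>n. mcompletion_metric (\<sigma> n) P) \<longlonglongrightarrow> 0"
    by (rule Lim_null_comparison[rotated])
       (use x \<sigma>in P mcompletion_embed_in Compl.triangle' in
         \<open>auto intro!: always_eventually Compl.triangle''\<close>)
  then have "limitin Compl.mtopology \<sigma> P sequentially"
    using P \<sigma>in by (simp add: Compl.limitin_metric_dist_null)
  then show "\<exists>P. limitin Compl.mtopology \<sigma> P sequentially" by blast
qed

end

definition fast_cauchy :: "(nat \<Rightarrow> 'a::metric_space) \<Rightarrow> bool" where
  "fast_cauchy s \<longleftrightarrow> (\<forall>i. dist (s i) (s (Suc i)) < 1 / 2 ^ i)"

definition presents :: "(nat \<Rightarrow> nat \<Rightarrow> nat \<Rightarrow> rat) \<Rightarrow> (nat \<Rightarrow> nat \<Rightarrow> real) \<Rightarrow> bool" where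
  "presents q d \<longleftrightarrow> Metric_space UNIV d \<and>
     (\<forall>x y. fast_cauchy (\<lambda>k. real_of_rat (q x y k)) \<and> (\<lambda>k. real_of_rat (q x y k)) \<longlonglongrightarrow> d x y)"

definition rat_code :: "rat \<Rightarrow> nat" where
  "rat_code r = (let (a, b) = quotient_of r in prod_encode (int_encode a, int_encode b))"

definition tuple_code :: "nat \<Rightarrow> nat \<Rightarrow> nat \<Rightarrow> rat \<Rightarrow> nat" where
  "tuple_code x y k r = prod_encode (x, prod_encode (y, prod_encode (k, rat_code r)))"

text \<open>The characteristic function of the set of codes of elements of the graph of \<open>q\<close>.\<close>

definition graph_string :: "(nat \<Rightarrow> nat \<Rightarrow> nat \<Rightarrow> rat) \<Rightarrow> (nat \<Rightarrow> bool)" where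
  "graph_string q = (\<lambda>n. \<exists>x y k. n = tuple_code x y k (q x y k))"

definition cantor_space :: "(nat \<Rightarrow> bool) topology" where
  "cantor_space = product_topology (\<lambda>_. discrete_topology UNIV) UNIV"

definition baire_space :: "(nat \<Rightarrow> nat) topology" where
  "baire_space = product_topology (\<lambda>_. discrete_topology UNIV) UNIV"

definition TOP :: "(nat \<Rightarrow> bool) set" where
  "TOP = {graph_string q |q d. presents q d}"

definition TOP_space :: "(nat \<Rightarrow> bool) topology" where
  "TOP_space = subtopology cantor_space TOP"

text \<open>The witnesses \<open>q\<close> and \<open>d\<close> are determined by \<open>Y\<close>; see \<open>graph_string_inject\<close> and
  \<open>presents_unique\<close> below.\<close>

definition presents_copy :: "(nat \<Rightarrow> bool) \<Rightarrow> 'x topology \<Rightarrow> bool" where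
  "presents_copy Y X \<longleftrightarrow> (\<exists>q d. Y = graph_string q \<and> presents q d \<and>
     Metric_space.mcompletion_topology UNIV d homeomorphic_space X)"

definition HCopies :: "'x topology \<Rightarrow> (nat \<Rightarrow> bool) set" where
  "HCopies X = {Y \<in> TOP. presents_copy Y X}"

lemma rat_code_inject [simp]: "rat_code r = rat_code r' \<longleftrightarrow> r = r'"
  by (auto simp: rat_code_def quotient_of_inject inj_eq[OF inj_int_encode] split: prod.splits)

lemma tuple_code_inject [simp]:
  "tuple_code x y k r = tuple_code x' y' k' r' \<longleftrightarrow> x = x' \<and> y = y' \<and> k = k' \<and> r = r'"
  by (simp add: tuple_code_def)

lemma graph_string_inject [simp]: "graph_string q = graph_string q' \<longleftrightarrow> q = q'"
proof
  assume eq: "graph_string q = graph_string q'"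
  show "q = q'"
  proof (intro ext)
    fix x y k
    have "graph_string q' (tuple_code x y k (q x y k))"
      unfolding eq[symmetric] by (auto simp: graph_string_def)
    then show "q x y k = q' x y k" by (simp add: graph_string_def)
  qed
qed simp

lemma presents_unique: "presents q d \<Longrightarrow> presents q d' \<Longrightarrow> d = d'"
  unfolding presents_def by (intro ext) (meson LIMSEQ_unique)

text \<open>Both classes are empty at level \<open>0\<close>, so that \<open>m i < n\<close> amounts to \<open>1 \<le> m i < n\<close>.\<close>

inductive Sigma0 :: "'a topology \<Rightarrow> nat \<Rightarrow> 'a set \<Rightarrow> bool"
      and Pi0 :: "'a topology \<Rightarrow> nat \<Rightarrow> 'a set \<Rightarrow> bool" for T where
  base: "openin T U \<Longrightarrow> Sigma0 T 1 U"
| union: "(\<And>i::nat. m i < n \<and> Pi0 T (m i) (A i)) \<Longrightarrow> Sigma0 T n (\<Union>i. A i)"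
| compl: "Sigma0 T n A \<Longrightarrow> Pi0 T n (topspace T - A)"

definition wadge_reducible :: "(nat \<Rightarrow> nat) set \<Rightarrow> (nat \<Rightarrow> bool) set \<Rightarrow> bool" where
  "wadge_reducible B A \<longleftrightarrow>
     (\<exists>f. continuous_map baire_space TOP_space f \<and> (\<forall>x. x \<in> B \<longleftrightarrow> f x \<in> A))"

definition Pi0_Wadge_complete :: "nat \<Rightarrow> (nat \<Rightarrow> bool) set \<Rightarrow> bool" where
  "Pi0_Wadge_complete n A \<longleftrightarrow>
     Pi0 TOP_space n A \<and> (\<forall>B. Pi0 baire_space n B \<longrightarrow> wadge_reducible B A)"

end

theory Submission
  imports Defs "HOL-Probability.Discrete_Topology"
begin

text \<open>
  Upper bound. A nondegenerate compact connected metric space is an arc iff it is chainable and locally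
  connected: for a suitable end \<open>a\<close>, let \<open>x\<close> precede \<open>y\<close> if every subcontinuum containing \<open>a\<close> and \<open>y\<close>
  contains \<open>x\<close>; chainability makes this order total, local connectedness makes it antisymmetric and
  makes the initial segments depend continuously on their end. On a dense sequence, chainability and
  uniform local connectedness take the form \<open>\<forall>\<exists>\<forall>\<close> over open conditions, which is \<open>\<Pi>\<^sup>0\<^sub>4\<close>.

  Hardness. A \<open>\<Pi>\<^sup>0\<^sub>4\<close> condition on \<open>b\<close> says that each of countably many sequences of naturals, computed
  continuously from \<open>b\<close>, takes some value infinitely often. Each sequence drives a gadget which draws
  the strands of a topologist's sine curve by denser and denser points; a value \<open>j\<close> merges all
  strands after strand \<open>2 * j\<close> into that strand, through all points drawn so far. If \<open>j\<close> is the
  least value taken infinitely often, then an arc with finitely many zigzags remains. Otherwise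
  infinitely many parallel strands accumulate, and the space is not locally connected. Smaller and
  smaller gadgets are joined end to end.
\<close>

section \<open>Completions as closures\<close>

text \<open>What shapes the hardness part is that a drawn point can never be moved or erased: a
  continuous map has to fix the distances between finitely many points from a finite part of
  \<open>b\<close>. A strand that absorbs others must therefore pass through all their points, which
  is why every strand carries a second curve \<open>through\<close> along. As long as no earlier
  strand is visited, a strand only moves to the right, and after a visit at stage \<open>s\<close>
  nothing ever gets further than \<open>(1/2) ^ s\<close> to the right of the visited strand. Hence
  a strand that is redrawn infinitely often still has a continuous limit. Values are doubled because
  only strands with an even number end at height 0, where the tail to the next gadget starts. The
  quantifier count in the upper bound rests on compactness: the inner existential ranges over a
  finite labelled net and one modulus, hence over a countable set, and what remains is a universal
  statement in which all distances are compared strictly.\<close>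

lemma (in Metric_space) homeomorphic_mcompletion_closure:
  fixes e :: "'a \<Rightarrow> 'b::complete_space"
  assumes e: "\<And>x y. x \<in> M \<Longrightarrow> y \<in> M \<Longrightarrow> dist (e x) (e y) = d x y"
  shows "mcompletion_topology homeomorphic_space top_of_set (closure (e ` M))"
proof -
  interpret Compl: Metric_space mcompletion mcompletion_metric
    by (rule Metric_space_mcompletion)
  have Cau: "Cauchy (\<lambda>n. e (s n))" if "MCauchy s" for s
    unfolding Cauchy_def using that e MCauchy_in[OF that] unfolding MCauchy_def by (metis less_imp_le_nat order_refl)
  \<comment> \<open>A class is sent to the limit of the images of its members, which exists since
    the ambient type is complete. This replaces the abstract completion by a closure inside a
    type.\<close>
  define \<Phi> where "\<Phi> P = lim (\<lambda>n. e ((SOME s. s \<in> P) n))" for P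
  have lim: "(\<lambda>n. e (s n)) \<longlonglongrightarrow> \<Phi> P" if P: "P \<in> mcompletion" and s: "s \<in> P" for P s
  proof -
    define t where "t = (SOME s. s \<in> P)"
    have t: "t \<in> P" unfolding t_def using s by (rule someI[where P = "\<lambda>s. s \<in> P"])
    have "(s, t) \<in> cauchy_equiv"
      using P s t equiv_cauchy_equiv unfolding mcompletion_def by (meson quotient_eq_iff)
    then have st: "MCauchy s" "MCauchy t" "(\<lambda>n. d (s n) (t n)) \<longlonglongrightarrow> 0"
      by (auto simp: cauchy_equiv_def)
    have l: "(\<lambda>n. e (t n)) \<longlonglongrightarrow> \<Phi> P"
      unfolding \<Phi>_def t_def[symmetric] using Cau[OF st(2)] by (simp add: Cauchy_convergent_iff convergent_LIMSEQ_iff)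
    have z: "(\<lambda>n. dist (e (s n)) (e (t n))) \<longlonglongrightarrow> 0"
      using st e MCauchy_in by simp
    have "(\<lambda>n. dist (e (s n)) (e (t n)) + dist (e (t n)) (\<Phi> P)) \<longlonglongrightarrow> 0"
      using tendsto_add[OF z l[unfolded tendsto_dist_iff[of _ "\<Phi> P"]]] by simp
    then have "(\<lambda>n. dist (e (s n)) (\<Phi> P)) \<longlonglongrightarrow> 0"
      by (rule Lim_null_comparison[rotated]) (auto intro!: always_eventually dist_triangle)
    then show ?thesis by (simp add: tendsto_dist_iff[of _ "\<Phi> P"])
  qed
  have iso: "dist (\<Phi> P) (\<Phi> Q) = mcompletion_metric P Q" if PQ: "P \<in> mcompletion" "Q \<in> mcompletion" for P Q
  proof -
    obtain s t where st: "s \<in> P" "t \<in> Q" "MCauchy s" "MCauchy t" by (meson PQ mcompletion_rep)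
    have "(\<lambda>n. dist (e (s n)) (e (t n))) \<longlonglongrightarrow> dist (\<Phi> P) (\<Phi> Q)"
      using lim PQ st by (intro tendsto_dist) auto
    moreover have "(\<lambda>n. dist (e (s n)) (e (t n))) \<longlonglongrightarrow> mcompletion_metric P Q"
      using mcompletion_dist_limit[OF PQ st(1,2)] PQ e MCauchy_in st by (simp add: mcompletion_metric_def)
    ultimately show ?thesis by (rule LIMSEQ_unique)
  qed
  have img: "\<Phi> ` mcompletion = closure (e ` M)"
  proof (intro equalityI subsetI)
    fix x assume "x \<in> \<Phi> ` mcompletion"
    then obtain P where P: "P \<in> mcompletion" "x = \<Phi> P" by blast
    then obtain s where s: "s \<in> P" "MCauchy s" by (meson mcompletion_rep)
    show "x \<in> closure (e ` M)"
      unfolding closure_sequential using lim[OF P(1) s(1)] MCauchy_in[OF s(2)] P(2)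
      by (intro exI[of _ "\<lambda>n. e (s n)"]) auto
  next
    fix x assume "x \<in> closure (e ` M)"
    then obtain u where u: "\<And>n. u n \<in> e ` M" "u \<longlonglongrightarrow> x" unfolding closure_sequential by blast
    then have "\<forall>n. \<exists>y. y \<in> M \<and> u n = e y" by blast
    then obtain s where s: "\<And>n. s n \<in> M" "\<And>n. u n = e (s n)" by metis
    have "Cauchy u" using u(2) by (rule LIMSEQ_imp_Cauchy)
    then have c: "MCauchy s"
      unfolding MCauchy_def Cauchy_def using s e by (simp add: image_subset_iff)
    define P where "P = cauchy_equiv `` {s}"
    have P: "P \<in> mcompletion" "s \<in> P"
      using c by (simp_all add: P_def mcompletion_def quotientI) (simp add: cauchy_equiv_def MCauchy_in)
    have "u \<longlonglongrightarrow> \<Phi> P" using lim[OF P] s by presburger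
    then have "x = \<Phi> P" using u(2) LIMSEQ_unique by blast
    then show "x \<in> \<Phi> ` mcompletion" using P by blast
  qed
  interpret C: Submetric "UNIV :: 'b set" dist "closure (e ` M)"
    by unfold_locales auto
  interpret M12: Metric_space12 mcompletion mcompletion_metric "closure (e ` M)" dist
    by unfold_locales
  have "homeomorphic_map Compl.mtopology C.sub.mtopology \<Phi>"
    by (rule M12.isometry_imp_homeomorphic_map) (use img iso in auto)
  then show ?thesis
    unfolding mcompletion_topology_def C.mtopology_submetric
    by (simp add: mtopology_is_euclidean homeomorphic_map_imp_homeomorphic_space)
qed

section \<open>Boldface classes on Baire space\<close>

text \<open>Subtracting a countable union from the whole space climbs one level; three such steps
  start from the closed complements of the sets \<open>U i j k\<close>.\<close>

lemma Pi0_4I: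
  assumes "\<And>i j k. openin T (U i j k)"
  shows "Pi0 T 4 {x \<in> topspace T. \<forall>i::nat. \<exists>j::nat. \<forall>k::nat. x \<in> U i j k}"
proof -
  have step: "Pi0 T (Suc n) (topspace T - (\<Union>k::nat. A k))" if "\<And>k. Pi0 T n (A k)" for n A
    by (rule compl, rule union[where m = "\<lambda>_. n"]) (simp add: that)
  have p1: "Pi0 T 1 (topspace T - U i j k)" for i j k
    using compl[OF base[OF assms]] .
  note p2 = step[where A = "\<lambda>k. topspace T - U i j k" for i j, OF p1]
  note p3 = step[where A = "\<lambda>j. topspace T - (\<Union>k. topspace T - U i j k)" for i, OF p2]
  note p4 = step[where A = "\<lambda>i. topspace T - (\<Union>j. topspace T - (\<Union>k. topspace T - U i j k))", OF p3]
  have "Suc (Suc (Suc 1)) = 4"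
    by simp
  moreover have "topspace T - (\<Union>i. topspace T - (\<Union>j. topspace T - (\<Union>k. topspace T - U i j k))) =
      {x \<in> topspace T. \<forall>i. \<exists>j. \<forall>k. x \<in> U i j k}"
    by auto
  ultimately show ?thesis
    using p4 by argo
qed

text \<open>Continuity for the discrete topology on the values. It is used for points of the plane
  too, where it is stronger than ordinary continuity: finitely many values of \<open>b\<close> fix
  the point exactly.\<close>

definition determined :: "((nat \<Rightarrow> nat) \<Rightarrow> 'a) \<Rightarrow> bool" where
  "determined F \<longleftrightarrow> (\<forall>b. \<exists>N. \<forall>b'. (\<forall>i<N. b' i = b i) \<longrightarrow> F b' = F b)"

lemma determinedI:
  "(\<And>b. \<exists>N. \<forall>b'. (\<forall>i<N. b' i = b i) \<longrightarrow> F b' = F b) \<Longrightarrow> determined F"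
  unfolding determined_def by (rule allI)

lemma determinedD:
  "determined F \<Longrightarrow> \<exists>N. \<forall>b'. (\<forall>i<N. b' i = b i) \<longrightarrow> F b' = F b"
  unfolding determined_def by (erule allE, assumption)

lemma determined_const: "determined (\<lambda>b. c)"
  by (simp add: determined_def)

lemma determined_comp2:
  assumes "determined F" "determined G" shows "determined (\<lambda>b. g (F b) (G b))"
proof (rule determinedI)
  fix b
  from determinedD[OF assms(1), of b]
  obtain N1 where N1: "\<forall>b'. (\<forall>i<N1. b' i = b i) \<longrightarrow> F b' = F b" ..
  from determinedD[OF assms(2), of b]
  obtain N2 where N2: "\<forall>b'. (\<forall>i<N2. b' i = b i) \<longrightarrow> G b' = G b" ..
  have "g (F b') (G b') = g (F b) (G b)" if "\<forall>i<max N1 N2. b' i = b i" for b'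
    using N1[rule_format, of b'] N2[rule_format, of b'] that by simp
  then show "\<exists>N. \<forall>b'. (\<forall>i<N. b' i = b i) \<longrightarrow> g (F b') (G b') = g (F b) (G b)" by blast
qed

lemma determined_comp1: "determined F \<Longrightarrow> determined (\<lambda>b. g (F b))"
  using determined_comp2[OF _ determined_const, of F "\<lambda>x y. g x"] .

lemma determined_upto:
  fixes n :: nat
  assumes "\<And>s. s < n \<Longrightarrow> determined (\<lambda>b. F b s)"
  shows "determined (\<lambda>b. map (F b) [0..<n])"
  using assms
proof (induction n)
  case 0
  then show ?case by (simp add: determined_const)
next
  case (Suc n)
  then show ?case using determined_comp2[of "\<lambda>b. map (F b) [0..<n]" "\<lambda>b. F b n" "\<lambda>x y. x @ [y]"] by simp
qed

lemma determined_finite_dependence: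
  fixes n :: nat
  assumes F: "\<And>s. s < n \<Longrightarrow> determined (\<lambda>b. F b s)"
    and G: "\<And>f f'. (\<And>s. s < n \<Longrightarrow> f s = f' s) \<Longrightarrow> G f = G f'"
  shows "determined (\<lambda>b. G (F b))"
proof -
  have "G (F b) = G (\<lambda>s. map (F b) [0..<n] ! s)" for b by (rule G) simp
  then show ?thesis using determined_comp1[OF determined_upto[of n F], of "\<lambda>l. G (\<lambda>s. l ! s)"] F by presburger
qed

lemma openin_baire_space_cylinder:
  assumes "openin baire_space U" "b \<in> U"
  shows "\<exists>N. \<forall>b'. (\<forall>i<N. b' i = b i) \<longrightarrow> b' \<in> U"
proof -
  have "\<exists>X. finite {i. X i \<noteq> UNIV} \<and> b \<in> Pi\<^sub>E UNIV X \<and> Pi\<^sub>E UNIV X \<subseteq> U"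
    using assms unfolding baire_space_def openin_product_topology_alt by auto
  then obtain X where X: "finite {i. X i \<noteq> UNIV}" "b \<in> Pi\<^sub>E UNIV X" "Pi\<^sub>E UNIV X \<subseteq> U" by blast
  from X(1) obtain N where N: "\<And>i. X i \<noteq> UNIV \<Longrightarrow> i < N"
    using finite_nat_set_iff_bounded by auto
  show ?thesis
  proof (intro exI allI impI)
    fix b' assume "\<forall>i<N. b' i = b i"
    then have "b' i \<in> X i" for i using N[of i] X(2) by (cases "X i = UNIV") (auto simp: PiE_iff)
    then show "b' \<in> U" using X(3) by auto
  qed
qed

lemma topspace_baire_space [simp]: "topspace baire_space = UNIV"
  by (simp add: baire_space_def)

lemma openin_baire_space_determined:
  assumes "openin baire_space U"
  obtains D where "\<And>s::nat. determined (D s)" "\<And>b. b \<in> U \<longleftrightarrow> (\<exists>s. D s b)"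
proof
  \<comment> \<open>An open set is the union of the cylinders inside it; whether the cylinder of
    length \<open>s\<close> around \<open>b\<close> lies in \<open>U\<close> depends on the first
    \<open>s\<close> values of \<open>b\<close> only.\<close>
  define D where "D s b \<longleftrightarrow> (\<forall>b'. (\<forall>i<s. b' i = b i) \<longrightarrow> b' \<in> U)" for s b
  show "determined (D s)" for s
    unfolding determined_def D_def by (intro allI exI[of _ s] impI) auto
  show "b \<in> U \<longleftrightarrow> (\<exists>s. D s b)" for b
    using openin_baire_space_cylinder[OF assms] unfolding D_def by blast
qed

lemma not_Sigma0_0: "\<not> Sigma0 T 0 A"
proof
  assume "Sigma0 T 0 A"
  then show False by (cases rule: Sigma0.cases) auto
qed

lemma Pi0_baireE:
  assumes "Pi0 baire_space n A" obtains B where "A = - B" "Sigma0 baire_space n B"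
  using assms by (cases rule: Pi0.cases) (auto simp: Compl_eq_Diff_UNIV)

text \<open>The level is bounded rather than fixed, because the pieces of a union may come from
  different lower levels. At level 1 a union could only be made of pieces of level 0, and there are
  none.\<close>

lemma Sigma0_1_baire:
  assumes "Sigma0 baire_space n A" "n \<le> 1"
  shows "\<exists>D. (\<forall>s::nat. determined (D s)) \<and> (\<forall>b. b \<in> A \<longleftrightarrow> (\<exists>s. D s b))"
  using assms(1)
proof (cases rule: Sigma0.cases)
  case base
  then show ?thesis using openin_baire_space_determined by metis
next
  case (union m A')
  have "m 0 = 0" using union(2)[of 0] assms(2) by simp
  then have "Pi0 baire_space 0 (A' 0)" using union(2)[of 0] by simp
  then show ?thesis by (rule Pi0_baireE) (simp add: not_Sigma0_0)
qed

lemma Sigma0_2_baire: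
  assumes "Sigma0 baire_space n A" "n \<le> 2"
  shows "\<exists>D. (\<forall>(k::nat) (s::nat). determined (D k s)) \<and> (\<forall>b. b \<in> A \<longleftrightarrow> (\<exists>k::nat. \<forall>s. D k s b))"
  using assms(1)
proof (cases rule: Sigma0.cases)
  case base
  then obtain D where "\<forall>s::nat. determined (D s)" "\<forall>b. b \<in> A \<longleftrightarrow> (\<exists>s. D s b)"
    using Sigma0_1_baire[OF assms(1)] by auto
  then show ?thesis by (intro exI[of _ "\<lambda>k s. D k"]) simp
next
  case (union m A')
  have "\<exists>D. (\<forall>s::nat. determined (D s)) \<and> (\<forall>b. b \<in> A' k \<longleftrightarrow> (\<forall>s. D s b))" for k
  proof -
    have "Pi0 baire_space (m k) (A' k)" "m k \<le> 1"
      using union(2)[of k] assms(2) by auto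
    then obtain B where "A' k = - B" "Sigma0 baire_space (m k) B"
      using Pi0_baireE by blast
    then obtain D where "\<forall>s::nat. determined (D s)" "\<forall>b. b \<in> B \<longleftrightarrow> (\<exists>s. D s b)"
      using Sigma0_1_baire \<open>m k \<le> 1\<close> by metis
    then show ?thesis using \<open>A' k = - B\<close>
      by (intro exI[of _ "\<lambda>s b. \<not> D s b"]) (auto intro: determined_comp1)
  qed
  then obtain D where "\<And>k. (\<forall>s::nat. determined (D k s)) \<and> (\<forall>b. b \<in> A' k \<longleftrightarrow> (\<forall>s. D k s b))" by metis
  then show ?thesis using union by (intro exI[of _ D]) auto
qed

lemma Sigma0_3_baire:
  assumes "Sigma0 baire_space n A" "n \<le> 3"
  shows "\<exists>D. (\<forall>(j::nat) (k::nat) (s::nat). determined (D j k s)) \<and> (\<forall>b. b \<in> A \<longleftrightarrow> (\<exists>j::nat. \<forall>k::nat. \<exists>s. D j k s b))"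
  using assms(1)
proof (cases rule: Sigma0.cases)
  case base
  then obtain D where "\<forall>s::nat. determined (D s)" "\<forall>b. b \<in> A \<longleftrightarrow> (\<exists>s. D s b)"
    using Sigma0_1_baire[OF assms(1)] by auto
  then show ?thesis by (intro exI[of _ "\<lambda>j k s. D j"]) simp
next
  case (union m A')
  have "\<exists>D. (\<forall>(k::nat) (s::nat). determined (D k s)) \<and> (\<forall>b. b \<in> A' j \<longleftrightarrow> (\<forall>k. \<exists>s. D k s b))" for j
  proof -
    have "Pi0 baire_space (m j) (A' j)" "m j \<le> 2"
      using union(2)[of j] assms(2) by auto
    then obtain B where "A' j = - B" "Sigma0 baire_space (m j) B"
      using Pi0_baireE by blast
    then obtain D where "\<forall>(k::nat) (s::nat). determined (D k s)" "\<forall>b. b \<in> B \<longleftrightarrow> (\<exists>k::nat. \<forall>s. D k s b)"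
      using Sigma0_2_baire \<open>m j \<le> 2\<close> by metis
    then show ?thesis using \<open>A' j = - B\<close>
      by (intro exI[of _ "\<lambda>k s b. \<not> D k s b"]) (auto intro: determined_comp1)
  qed
  then obtain D where "\<And>j. (\<forall>(k::nat) (s::nat). determined (D j k s)) \<and> (\<forall>b. b \<in> A' j \<longleftrightarrow> (\<forall>k::nat. \<exists>s. D j k s b))" by metis
  then show ?thesis using union by (intro exI[of _ D]) auto
qed

lemma Pi0_4_baire:
  assumes "Pi0 baire_space 4 A"
  shows "\<exists>D. (\<forall>(i::nat) (j::nat) (k::nat) (s::nat). determined (D i j k s)) \<and>
    (\<forall>b. b \<in> A \<longleftrightarrow> (\<forall>i::nat. \<exists>j::nat. \<forall>k::nat. \<exists>s. D i j k s b))"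
proof -
  obtain C where C: "A = - C" "Sigma0 baire_space 4 C"
    using assms Pi0_baireE by blast
  have "\<exists>A'. (\<forall>i. \<exists>n\<le>3. Sigma0 baire_space n (A' i)) \<and> A = (\<Inter>i::nat. A' i)"
    using C(2)
  proof (cases rule: Sigma0.cases)
    case (union m A')
    have "\<exists>B. (\<exists>n\<le>3. Sigma0 baire_space n B) \<and> A' i = - B" for i
    proof -
      have "Pi0 baire_space (m i) (A' i)" "m i \<le> 3"
        using union(2)[of i] by auto
      then show ?thesis using Pi0_baireE by metis
    qed
    then obtain B where "\<And>i. (\<exists>n\<le>3. Sigma0 baire_space n (B i)) \<and> A' i = - B i" by metis
    then show ?thesis using C(1) union(1) by (intro exI[of _ B]) auto
  qed auto
  then obtain A' where A': "\<forall>i. \<exists>n\<le>3. Sigma0 baire_space n (A' i)" "A = (\<Inter>i::nat. A' i)" by blast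
  then have "\<forall>i. \<exists>D. (\<forall>(j::nat) (k::nat) (s::nat). determined (D j k s)) \<and> (\<forall>b. b \<in> A' i \<longleftrightarrow> (\<exists>j::nat. \<forall>k::nat. \<exists>s. D j k s b))"
    using Sigma0_3_baire by metis
  then obtain D where "\<And>i. (\<forall>(j::nat) (k::nat) (s::nat). determined (D i j k s)) \<and> (\<forall>b. b \<in> A' i \<longleftrightarrow> (\<exists>j::nat. \<forall>k::nat. \<exists>s. D i j k s b))" by metis
  then show ?thesis using A'(2) by (intro exI[of _ D]) auto
qed

section \<open>From an exists-forall-exists condition to a value taken infinitely often\<close>

definition firing :: "(nat \<Rightarrow> nat \<Rightarrow> nat \<Rightarrow> bool) \<Rightarrow> nat \<Rightarrow> nat \<Rightarrow> nat \<Rightarrow> bool" where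
  "firing D j m w \<longleftrightarrow> (\<forall>k<m. \<exists>s<w. D j k s) \<and> (\<forall>w'<w. \<not> (\<forall>k<m. \<exists>s<w'. D j k s))"

text \<open>The value \<open>j\<close> is taken at one stage for every \<open>m\<close> such that
  \<open>\<forall>k<m. \<exists>s. D j k s\<close>; the default value \<open>t\<close> keeps the other stages harmless.\<close>

definition schedule :: "(nat \<Rightarrow> nat \<Rightarrow> nat \<Rightarrow> bool) \<Rightarrow> nat \<Rightarrow> nat" where
  "schedule D t = (case prod_decode t of (j, p) \<Rightarrow>
     case prod_decode p of (m, w) \<Rightarrow> if firing D j m w then j else t)"

lemma infinite_schedule_iff:
  "(\<exists>j. infinite {t. schedule D t = j}) \<longleftrightarrow> (\<exists>j. \<forall>k. \<exists>s. D j k s)"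
proof (intro arg_cong[where f = Ex] ext)
  fix j
  have fire_uniq: "w = w'" if "firing D j m w" "firing D j m w'" for m w w'
    using that unfolding firing_def by (metis nat_neq_iff)
  show "infinite {t. schedule D t = j} \<longleftrightarrow> (\<forall>k. \<exists>s. D j k s)"
  proof
    assume inf: "infinite {t. schedule D t = j}"
    show "\<forall>k. \<exists>s. D j k s"
    proof (rule ccontr)
      assume "\<not> ?thesis"
      then obtain k where k: "\<forall>s. \<not> D j k s" by blast
      \<comment> \<open>If condition \<open>k\<close> has no witness, only numbers
        \<open>m \<le> k\<close> can fire, each at one stage by minimality of \<open>w\<close>; the
        default contributes at most the stage \<open>j\<close> itself.\<close>
      have "{t. schedule D t = j} \<subseteq>
        insert j ((\<lambda>m. prod_encode (j, prod_encode (m, THE w. firing D j m w))) ` {..k})"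
      proof
        fix t assume "t \<in> {t. schedule D t = j}"
        then have t: "schedule D t = j" by simp
        obtain j' p m w where d: "prod_decode t = (j', p)" "prod_decode p = (m, w)"
          by (metis surj_pair)
        show "t \<in> insert j ((\<lambda>m. prod_encode (j, prod_encode (m, THE w. firing D j m w))) ` {..k})"
        proof (cases "firing D j' m w")
          case True
          then have [simp]: "j' = j" using t d by (simp add: schedule_def)
          have "m \<le> k" using True k unfolding firing_def by (auto simp: not_less[symmetric])
          moreover have "(THE w. firing D j m w) = w" using True fire_uniq by (intro the_equality) auto
          moreover have "t = prod_encode (j, prod_encode (m, w))"
            using d by (metis \<open>j' = j\<close> prod_decode_inverse)
          ultimately show ?thesis by auto
        next
          case False
          then show ?thesis using t d by (simp add: schedule_def)
        qed
      qed
      then show False using inf finite_subset by blast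
    qed
  next
    assume D: "\<forall>k. \<exists>s. D j k s"
    have "\<exists>w. firing D j m w" for m
    proof -
      obtain s where s: "\<And>k. D j k (s k)" using D by metis
      have "\<forall>k<m. s k < Suc (\<Sum>k<m. s k)"
        by (auto simp: less_Suc_eq_le intro: member_le_sum)
      then have "\<forall>k<m. \<exists>s'<Suc (\<Sum>k<m. s k). D j k s'" using s by blast
      then show ?thesis unfolding firing_def
        using exists_least_iff[of "\<lambda>w. \<forall>k<m. \<exists>s<w. D j k s"] by blast
    qed
    then obtain w where w: "\<And>m. firing D j m (w m)" by metis
    define \<tau> where "\<tau> m = prod_encode (j, prod_encode (m, w m))" for m
    have "inj \<tau>" by (auto simp: \<tau>_def inj_on_def)
    moreover have "range \<tau> \<subseteq> {t. schedule D t = j}" using w by (auto simp: \<tau>_def schedule_def)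
    ultimately show "infinite {t. schedule D t = j}" by (meson finite_subset range_inj_infinite)
  qed
qed

lemma determined_schedule:
  assumes "\<And>j k s. determined (D j k s)"
  shows "determined (\<lambda>b. schedule (\<lambda>j k s. D j k s b) t)"
proof -
  obtain j p m w where d: "prod_decode t = (j, p)" "prod_decode p = (m, w)" by (metis surj_pair)
  have fin_ex: "determined (\<lambda>b. \<exists>s<n::nat. F s b)" if "\<And>s. determined (F s)" for F n
    by (rule determined_finite_dependence[where F = "\<lambda>b s. F s b" and G = "\<lambda>f. \<exists>s<n. f s"]) (use that in auto)
  have fin_all: "determined (\<lambda>b. \<forall>s<n::nat. F s b)" if "\<And>s. determined (F s)" for F n
    by (rule determined_finite_dependence[where F = "\<lambda>b s. F s b" and G = "\<lambda>f. \<forall>s<n. f s"]) (use that in auto)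
  have "determined (\<lambda>b. firing (\<lambda>j k s. D j k s b) j m w)"
    unfolding firing_def
    by (intro determined_comp2[where g = "(\<and>)"] fin_all fin_ex determined_comp1[where g = Not] assms)
  from determined_comp1[OF this, of "\<lambda>x. if x then j else t"] show ?thesis by (simp add: schedule_def d)
qed

section \<open>A characterization of the arc\<close>

text \<open>In a compact Hausdorff space quasi-components are components, so it is enough that no
  clopen set separates \<open>x\<close> from \<open>y\<close>. A chain whose steps are below the
  Lebesgue number of a clopen partition cannot cross it.\<close>

lemma connected_subset_of_chains:
  fixes K :: "'a::metric_space set"
  assumes K: "compact K" and xK: "x \<in> K"
    and chain: "\<And>e. e > 0 \<Longrightarrow> (x, y) \<in> {(u, v). u \<in> K \<and> v \<in> K \<and> dist u v < e}\<^sup>*"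
  obtains C where "compact C" "connected C" "C \<subseteq> K" "x \<in> C" "y \<in> C"
proof -
  have inT: "y \<in> T" if T: "closedin (top_of_set K) T" "openin (top_of_set K) T" and u: "x \<in> T" for T
  proof -
    obtain A where A: "open A" "T = K \<inter> A" using T(2) by (auto simp: openin_open)
    obtain B where B: "open B" "K - T = K \<inter> B"
      using openin_diff[OF openin_subtopology_self T(1)] by (auto simp: openin_open)
    have "K \<subseteq> \<Union>{A, B}" using A B by blast
    then obtain e where e: "e > 0" "\<And>u. u \<in> K \<Longrightarrow> ball u e \<subseteq> A \<or> ball u e \<subseteq> B"
      using Heine_Borel_lemma[OF K, of "{A, B}"] A B by auto
    have e2: "v \<in> T" if "u \<in> T" "v \<in> K" "dist u v < e" for u v
    proof -
      have "u \<in> ball u e" "v \<in> ball u e" using that e(1) by auto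
      then show ?thesis using e(2)[of u] A B that by blast
    qed
    have "(x, y) \<in> {(u, v). u \<in> K \<and> v \<in> K \<and> dist u v < e}\<^sup>*" using chain e(1) .
    then show "y \<in> T"
    proof (induction rule: rtrancl_induct)
      case (step v w)
      then show ?case using e2[of v w] by blast
    qed (use u in simp)
  qed
  have yK: "y \<in> K"
    by (rule inT) (use xK in auto)
  have "quasi_component_of (top_of_set K) x y"
    unfolding quasi_component_of_def
  proof (intro conjI allI impI)
    fix T assume T: "closedin (top_of_set K) T \<and> openin (top_of_set K) T"
    then have T': "closedin (top_of_set K) (K - T) \<and> openin (top_of_set K) (K - T)"
      using closedin_diff[of "top_of_set K" K T] openin_diff[of "top_of_set K" K T] by auto
    show "x \<in> T \<longleftrightarrow> y \<in> T"
      using inT[of T] inT[of "K - T"] T T' xK yK by blast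
  qed (use xK yK in auto)
  define C where "C = quasi_component_of_set (top_of_set K) x"
  have C: "C \<in> quasi_components_of (top_of_set K)"
    unfolding C_def by (simp add: quasi_component_in_quasi_components_of xK)
  have cs: "compact_space (top_of_set K)" using K by (simp add: compact_space_subtopology compactin_euclidean_iff)
  have "closedin (top_of_set K) C" unfolding C_def by (rule closedin_quasi_component_of)
  then have cC: "compactin (top_of_set K) C" using cs closedin_compact_space by blast
  have "Hausdorff_space (top_of_set K)" by (simp add: Hausdorff_space_subtopology)
  then have "C \<in> connected_components_of (top_of_set K)"
    using compact_quasi_eq_connected_components_of[OF compact_imp_locally_compact_space[OF cs] _ cC] C by blast
  then have "connectedin (top_of_set K) C" by (rule connectedin_connected_components_of)
  then have "connected C" "C \<subseteq> K" by (auto simp: connectedin_subtopology)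
  moreover have "compact C" using cC by (auto simp: compactin_subtopology)
  moreover have "x \<in> C" "y \<in> C" unfolding C_def using \<open>quasi_component_of (top_of_set K) x y\<close> xK by auto
  ultimately show ?thesis using that by blast
qed

text \<open>If \<open>m\<close> were skipped, then \<open>c u < m\<close> would be a locally
  constant property of the points of \<open>C\<close>.\<close>

lemma discrete_intermediate_value:
  fixes c :: "'a::metric_space \<Rightarrow> nat"
  assumes C: "connected C" "x \<in> C" "z \<in> C" and m: "c x \<le> m" "m \<le> c z"
    and d: "\<delta> > 0" "\<And>u v. u \<in> C \<Longrightarrow> v \<in> C \<Longrightarrow> dist u v < \<delta> \<Longrightarrow> c u \<le> c v + 1"
  shows "\<exists>w\<in>C. c w = m"
proof (rule ccontr)
  assume no: "\<not> ?thesis"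
  have "c x < m \<longleftrightarrow> c z < m"
  proof (rule connected_equivalence_relation[OF C, where R = "\<lambda>u v. c u < m \<longleftrightarrow> c v < m"])
    fix u assume u: "u \<in> C"
    show "\<exists>T. openin (top_of_set C) T \<and> u \<in> T \<and> (\<forall>v\<in>T. (c u < m) = (c v < m))"
    proof (intro exI conjI ballI)
      show "openin (top_of_set C) (C \<inter> ball u \<delta>)" by (simp add: openin_open_Int)
      show "u \<in> C \<inter> ball u \<delta>" using u d by simp
      fix v assume v: "v \<in> C \<inter> ball u \<delta>"
      have "c u \<noteq> m" "c v \<noteq> m" using no u v by auto
      moreover have "c u \<le> c v + 1" "c v \<le> c u + 1" using d(2)[of u v] d(2)[of v u] u v by (auto simp: dist_commute)
      ultimately show "(c u < m) = (c v < m)" by linarith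
    qed
  qed auto
  moreover have "c x \<noteq> m" "c z \<noteq> m" using no C by auto
  ultimately show False using m by linarith
qed

text \<open>Chainability appears as a labelling instead of a chain of open sets: a label is the
  position of a link, nearby points have neighbouring labels, and points with one label are close
  together. This form restricts to subcontinua and can be read off from a finite net.\<close>

locale arc_like =
  fixes S :: "'a::metric_space set"
  assumes compact: "compact S" and connected: "connected S"
    and small_continua: "\<And>r. r > 0 \<Longrightarrow> \<exists>\<delta>>0. \<forall>x\<in>S. \<forall>y\<in>S. dist x y < \<delta> \<longrightarrow>
      (\<exists>C. closed C \<and> connected C \<and> C \<subseteq> S \<and> C \<subseteq> cball x r \<and> x \<in> C \<and> y \<in> C)"
    and labels: "\<And>r. r > 0 \<Longrightarrow> \<exists>\<delta>>0. \<exists>c::'a \<Rightarrow> nat. \<forall>x\<in>S. \<forall>y\<in>S.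
      (dist x y < \<delta> \<longrightarrow> c x \<le> c y + 1) \<and> (c x = c y \<longrightarrow> dist x y < r)"
begin

definition continuum :: "'a set \<Rightarrow> bool" where
  "continuum C \<longleftrightarrow> closed C \<and> connected C \<and> C \<subseteq> S"

definition before :: "'a \<Rightarrow> 'a \<Rightarrow> 'a \<Rightarrow> bool" where
  "before a x y \<longleftrightarrow> (\<forall>C. continuum C \<longrightarrow> a \<in> C \<longrightarrow> y \<in> C \<longrightarrow> x \<in> C)"

definition initial :: "'a \<Rightarrow> 'a \<Rightarrow> 'a set" where
  "initial a x = {z \<in> S. before a z x}"

lemma continuum_Un: "continuum C \<Longrightarrow> continuum D \<Longrightarrow> z \<in> C \<Longrightarrow> z \<in> D \<Longrightarrow> continuum (C \<union> D)"
  unfolding continuum_def using connected_Un[of C D] by blast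

lemma continuum_singleton: "z \<in> S \<Longrightarrow> continuum {z}"
  by (simp add: continuum_def)

lemma small_continuumE:
  assumes "r > 0"
  obtains \<delta> where "\<delta> > 0" "\<And>x y. x \<in> S \<Longrightarrow> y \<in> S \<Longrightarrow> dist x y < \<delta> \<Longrightarrow>
      \<exists>C. continuum C \<and> C \<subseteq> cball x r \<and> x \<in> C \<and> y \<in> C"
  using small_continua[OF assms] unfolding continuum_def by metis

text \<open>An accumulation point of points with minimal labels, for finer and finer labellings, is an
  end of the arc.\<close>

lemma endpoint_exists:
  assumes "S \<noteq> {}"
  shows "\<exists>a\<in>S. \<forall>x\<in>S. \<forall>y\<in>S. before a x y \<or> before a y x"
proof -
  have "\<exists>\<delta>>0. \<exists>c::'a \<Rightarrow> nat. \<forall>x\<in>S. \<forall>y\<in>S.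
      (dist x y < \<delta> \<longrightarrow> c x \<le> c y + 1) \<and> (c x = c y \<longrightarrow> dist x y < inverse (real (Suc n)))" for n
    by (rule labels) simp
  then obtain \<delta> c where c: "\<And>n. \<delta> n > 0"
      "\<And>n x y. x \<in> S \<Longrightarrow> y \<in> S \<Longrightarrow> dist x y < \<delta> n \<Longrightarrow> (c n x :: nat) \<le> c n y + 1"
      "\<And>n x y. x \<in> S \<Longrightarrow> y \<in> S \<Longrightarrow> c n x = c n y \<Longrightarrow> dist x y < inverse (real (Suc n))"
    by metis
  have "\<exists>b. b \<in> S \<and> (\<forall>x. x \<in> S \<longrightarrow> c n b \<le> c n x)" for n
    using assms ex_has_least_nat[of "\<lambda>x. x \<in> S" _ "c n"] by blast
  then obtain b where b: "\<And>n. b n \<in> S" "\<And>n x. x \<in> S \<Longrightarrow> c n (b n) \<le> c n x" by metis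
  obtain a r where a: "a \<in> S" "strict_mono (r :: nat \<Rightarrow> nat)" "(b \<circ> r) \<longlonglongrightarrow> a"
    using compact b(1) unfolding compact_def by metis
  have key: "before a x y" if x: "x \<in> S" and y: "y \<in> S"
    and freq: "\<exists>\<^sub>F n in sequentially. c (r n) x \<le> c (r n) y" for x y
    unfolding before_def
  proof (intro allI impI, rule ccontr)
    fix C assume C: "continuum C" "a \<in> C" "y \<in> C" "x \<notin> C"
    then have "open (- C)" "x \<in> - C" by (auto simp: continuum_def)
    then obtain e where e0: "e > 0" "ball x e \<subseteq> - C" using open_contains_ball by blast
    then have e: "e > 0" "\<And>w. w \<in> C \<Longrightarrow> e \<le> dist x w"
      by (auto simp: subset_iff not_less[symmetric])
    obtain d where d: "d > 0" "\<And>x y. x \<in> S \<Longrightarrow> y \<in> S \<Longrightarrow> dist x y < d \<Longrightarrow>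
      \<exists>C. continuum C \<and> C \<subseteq> cball x (e/2) \<and> x \<in> C \<and> y \<in> C"
      using small_continuumE[of "e/2"] e(1) by (metis half_gt_zero)
    have "\<forall>\<^sub>F n in sequentially. dist (b (r n)) a < d"
      using a(3) d(1) unfolding tendsto_iff by (simp add: o_def)
    moreover have "\<forall>\<^sub>F n in sequentially. inverse (real (Suc n)) < e/2"
      using LIMSEQ_inverse_real_of_nat e(1) by (intro order_tendstoD) auto
    ultimately have "\<forall>\<^sub>F n in sequentially. dist (b (r n)) a < d \<and> inverse (real (Suc n)) < e/2"
      by (rule eventually_conj)
    from frequently_eventually_conj[OF freq this]
    obtain n where n: "c (r n) x \<le> c (r n) y" "dist (b (r n)) a < d" "inverse (real (Suc n)) < e/2"
      using frequently_ex[of _ sequentially] by blast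
    \<comment> \<open>The label of \<open>a\<close> itself may fail to be minimal. Attaching a small
      continuum from \<open>a\<close> to \<open>b (r n)\<close> lets the labels on the union range
      from the least one up to that of \<open>y\<close>; so the label of \<open>x\<close> occurs on
      it, and \<open>x\<close> is close to it.\<close>
    obtain C' where C': "continuum C'" "C' \<subseteq> cball a (e/2)" "a \<in> C'" "b (r n) \<in> C'"
      using d(2)[of a "b (r n)"] a(1) b(1) n(2) by (auto simp: dist_commute)
    have D: "continuum (C \<union> C')" using continuum_Un[OF C(1) C'(1) C(2) C'(3)] .
    have "\<exists>w\<in>C \<union> C'. c (r n) w = c (r n) x"
    proof (rule discrete_intermediate_value)
      show "connected (C \<union> C')" using D by (simp add: continuum_def)
      show "b (r n) \<in> C \<union> C'" "y \<in> C \<union> C'" using C C' by auto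
      show "c (r n) (b (r n)) \<le> c (r n) x" using b x by blast
      show "\<delta> (r n) > 0" by (rule c)
      show "c (r n) u \<le> c (r n) v + 1" if "u \<in> C \<union> C'" "v \<in> C \<union> C'" "dist u v < \<delta> (r n)" for u v
        using D c(2)[of u v "r n"] that unfolding continuum_def by blast
    qed (rule n)
    then obtain w where w: "w \<in> C \<union> C'" "c (r n) w = c (r n) x" by blast
    have "w \<in> S" using w D by (auto simp: continuum_def)
    then have "dist w x < inverse (real (Suc (r n)))" using c(3) x w(2) by blast
    also have "\<dots> \<le> inverse (real (Suc n))"
      using seq_suble[OF a(2), of n] by (simp add: field_simps)
    also have "\<dots> < e/2" by (rule n)
    finally have wx: "dist w x < e/2" .
    show False
    proof (cases "w \<in> C")
      case True
      then show False using e(2)[of w] e(1) wx by (simp add: dist_commute)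
    next
      case False
      then have "dist a w \<le> e/2" using w C' by auto
      then have "dist x a < e" using wx dist_triangle[of x a w] by (simp add: dist_commute)
      then show False using e(2)[OF C(2)] by simp
    qed
  qed
  \<comment> \<open>One of the two comparisons of labels holds for infinitely many \<open>n\<close>,
    which is what \<open>key\<close> asks for.\<close>
  have "before a x y \<or> before a y x" if "x \<in> S" "y \<in> S" for x y
  proof -
    have "\<exists>\<^sub>F n in sequentially. c (r n) x \<le> c (r n) y \<or> c (r n) y \<le> c (r n) x"
      by (rule eventually_frequently) (auto simp: nat_le_linear)
    then show ?thesis using key that by (auto simp: frequently_disj_iff)
  qed
  then show ?thesis using a(1) by blast
qed

text \<open>Let \<open>U\<close> consist of the points that a continuum from \<open>a\<close>
  reaches without meeting \<open>y\<close>. Local connectedness makes \<open>U\<close> relatively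
  clopen away from \<open>y\<close>; since it contains \<open>a\<close> but not \<open>x\<close>,
  connectedness of \<open>S\<close> forces it to come arbitrarily close to \<open>y\<close>. A small
  continuum from \<open>y\<close> into \<open>U\<close> then extends to one from \<open>a\<close> to
  \<open>y\<close> that misses \<open>x\<close>.\<close>

lemma before_antisym:
  assumes S: "a \<in> S" "x \<in> S" "y \<in> S" and xy: "before a x y" "before a y x"
  shows "x = y"
proof (rule ccontr)
  assume ne: "x \<noteq> y"
  have "y \<noteq> a" using xy(1) continuum_singleton[OF S(1)] ne unfolding before_def by blast
  define U where "U = {u. \<exists>C. continuum C \<and> y \<notin> C \<and> a \<in> C \<and> u \<in> C}"
  have US: "U \<subseteq> S" "y \<notin> U" by (auto simp: U_def continuum_def)
  have aU: "a \<in> U" using continuum_singleton[OF S(1)] \<open>y \<noteq> a\<close> unfolding U_def by blast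
  have xU: "x \<notin> U" using xy(2) unfolding U_def before_def by blast
  have Uext: "v \<in> U" if "u \<in> U" "continuum C" "u \<in> C" "v \<in> C" "y \<notin> C" for u v C
    using that continuum_Un[of _ C u] unfolding U_def by blast
  have near: "\<exists>u\<in>U. dist y u < e" if e: "e > 0" for e
  proof (rule ccontr)
    assume far: "\<not> ?thesis"
    have "a \<in> U \<longleftrightarrow> x \<in> U"
    proof (rule connected_equivalence_relation[OF connected S(1,2), where R = "\<lambda>u v. u \<in> U \<longleftrightarrow> v \<in> U"])
      fix u assume u: "u \<in> S"
      show "\<exists>T. openin (top_of_set S) T \<and> u \<in> T \<and> (\<forall>v\<in>T. (u \<in> U) = (v \<in> U))"
      proof (cases "u = y")
        case True
        show ?thesis
          by (rule exI[of _ "S \<inter> ball u e"]) (use far u e True US in \<open>auto simp: openin_open_Int\<close>)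
      next
        case False
        then have "dist u y / 2 > 0" by simp
        then obtain d where d: "d > 0" "\<And>x y'. x \<in> S \<Longrightarrow> y' \<in> S \<Longrightarrow> dist x y' < d \<Longrightarrow>
            \<exists>C. continuum C \<and> C \<subseteq> cball x (dist u y / 2) \<and> x \<in> C \<and> y' \<in> C"
          using small_continuumE by metis
        have "(u \<in> U) = (v \<in> U)" if v: "v \<in> S" "dist u v < d" for v
        proof -
          obtain C where C: "continuum C" "C \<subseteq> cball u (dist u y / 2)" "u \<in> C" "v \<in> C"
            using d(2)[OF u v] by blast
          have "y \<notin> C" using C(2) False by (auto simp: subset_iff)
          then show ?thesis using Uext C by blast
        qed
        then have "\<forall>v\<in>S \<inter> ball u d. (u \<in> U) = (v \<in> U)" by simp
        moreover have "u \<in> S \<inter> ball u d" using u d by simp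
        ultimately show ?thesis using openin_open_Int[OF open_ball] by blast
      qed
    qed auto
    then show False using aU xU by simp
  qed
  have "dist y x / 2 > 0" using ne by simp
  then obtain d where d: "d > 0" "\<And>x' y'. x' \<in> S \<Longrightarrow> y' \<in> S \<Longrightarrow> dist x' y' < d \<Longrightarrow>
      \<exists>C. continuum C \<and> C \<subseteq> cball x' (dist y x / 2) \<and> x' \<in> C \<and> y' \<in> C"
    using small_continuumE by metis
  obtain u where u: "u \<in> U" "dist y u < d" using near[OF d(1)] by blast
  obtain C' where C': "continuum C'" "C' \<subseteq> cball y (dist y x / 2)" "y \<in> C'" "u \<in> C'"
    using d(2)[of y u] u US S by blast
  have x': "x \<notin> C'" using C'(2) ne by (auto simp: subset_iff)
  obtain C where C: "continuum C" "y \<notin> C" "a \<in> C" "u \<in> C" using u(1) unfolding U_def by blast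
  have "x \<notin> C" using C xU unfolding U_def by blast
  moreover have "continuum (C \<union> C')" using continuum_Un C C' by blast
  ultimately show False using xy(1) C C' x' unfolding before_def by blast
qed

lemma closed_initial: "closed (initial a x)"
proof -
  have "initial a x = S \<inter> \<Inter>{C. continuum C \<and> a \<in> C \<and> x \<in> C}"
    unfolding initial_def before_def by blast
  moreover have "closed \<dots>"
    using compact by (intro closed_Int compact_imp_closed closed_Inter) (auto simp: continuum_def)
  ultimately show ?thesis by simp
qed

lemma initial_self: "x \<in> S \<Longrightarrow> x \<in> initial a x"
  by (simp add: initial_def before_def)

text \<open>Outside \<open>D\<close>, every point of \<open>initial a x'\<close> lies in
  \<open>initial a x\<close>: a continuum from \<open>a\<close> to \<open>x\<close>, enlarged by
  \<open>D\<close>, also reaches \<open>x'\<close>. A point inside \<open>D\<close> can be replaced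
  by \<open>x\<close> at cost \<open>b\<close>.\<close>

lemma infdist_initial_le:
  assumes D: "continuum D" "x \<in> D" "x' \<in> D" and e: "\<And>z. z \<in> D \<Longrightarrow> dist z x \<le> b"
  shows "infdist p (initial a x) \<le> infdist p (initial a x') + b"
proof -
  have S: "x \<in> S" "x' \<in> S" using D by (auto simp: continuum_def)
  have eta: "b \<ge> 0" using e[OF D(2)] by simp
  have "infdist p (initial a x) - b \<le> dist p z" if z: "z \<in> initial a x'" for z
  proof (cases "z \<in> D")
    case True
    have "infdist p (initial a x) \<le> dist p x" using initial_self[OF S(1)] by (rule infdist_le)
    also have "\<dots> \<le> dist p z + b" using dist_triangle[of p x z] e[OF True] by simp
    finally show ?thesis by simp
  next
    case False
    have "z \<in> initial a x"
      using z False D continuum_Un[OF _ D(1)] unfolding initial_def before_def by blast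
    then show ?thesis using infdist_le[of z "initial a x" p] eta by simp
  qed
  then have "infdist p (initial a x) - b \<le> (INF z\<in>initial a x'. dist p z)"
    using initial_self[OF S(2)] by (intro cINF_greatest) auto
  moreover have "initial a x' \<noteq> {}" using initial_self[OF S(2)] by blast
  ultimately show ?thesis by (simp add: infdist_notempty)
qed

lemma continuous_on_infdist_initial: "continuous_on S (\<lambda>x. infdist p (initial a x))"
  unfolding continuous_on_iff
proof (intro ballI allI impI)
  fix x and r :: real assume x: "x \<in> S" and e: "r > 0"
  then have "r / 4 > 0" by simp
  then obtain d where d: "d > 0" "\<And>x' y'. x' \<in> S \<Longrightarrow> y' \<in> S \<Longrightarrow> dist x' y' < d \<Longrightarrow>
      \<exists>C. continuum C \<and> C \<subseteq> cball x' (r / 4) \<and> x' \<in> C \<and> y' \<in> C"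
    using small_continuumE by metis
  have "dist (infdist p (initial a x')) (infdist p (initial a x)) < r" if x': "x' \<in> S" "dist x' x < d" for x'
  proof -
    obtain C where C: "continuum C" "C \<subseteq> cball x (r / 4)" "x \<in> C" "x' \<in> C"
      using d(2)[of x x'] x x' by (auto simp: dist_commute)
    have "dist z x \<le> r / 2" "dist z x' \<le> r / 2" if "z \<in> C" for z
    proof -
      have "dist x z \<le> r / 4" "dist x x' \<le> r / 4" using C that by auto
      then show "dist z x \<le> r / 2" "dist z x' \<le> r / 2"
        using dist_triangle[of z x' x] e by (auto simp: dist_commute)
    qed
    then have "infdist p (initial a x) \<le> infdist p (initial a x') + r / 2"
       "infdist p (initial a x') \<le> infdist p (initial a x) + r / 2"
      using infdist_initial_le[OF C(1)] C by blast+
    then show ?thesis using e by (simp add: dist_real_def)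
  qed
  then show "\<exists>d>0. \<forall>x'\<in>S. dist x' x < d \<longrightarrow> dist (infdist p (initial a x')) (infdist p (initial a x)) < r"
    using d(1) by blast
qed

text \<open>The homeomorphism is a weighted sum of the distances from the points of a dense sequence
  to the initial segments; each summand is continuous and monotone along the arc.\<close>

theorem homeomorphic_unit_interval:
  assumes p: "\<And>k. p k \<in> S" "S \<subseteq> closure (range (p :: nat \<Rightarrow> 'a))" and ne: "p 0 \<noteq> p 1"
  shows "S homeomorphic {0..1::real}"
proof -
  have "S \<noteq> {}" using p by blast
  then obtain a where a: "a \<in> S" "\<And>x y. x \<in> S \<Longrightarrow> y \<in> S \<Longrightarrow> before a x y \<or> before a y x"
    using endpoint_exists by blast
  define f where "f k x = (1/2) ^ k * infdist (p k) (initial a x)" for k x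
  define F where "F x = (\<Sum>k. f k x)" for x
  obtain B where B: "\<And>x y. x \<in> S \<Longrightarrow> y \<in> S \<Longrightarrow> dist x y \<le> B"
    using compact_imp_bounded[OF compact] by (meson bounded_two_points)
  have f0: "0 \<le> f k x" for k x by (simp add: f_def infdist_nonneg)
  have fB: "norm (f k x) \<le> (1/2) ^ k * B" if "x \<in> S" for k x
  proof -
    have "infdist (p k) (initial a x) \<le> B"
      using infdist_le[OF initial_self[OF that], of "p k" a] B[OF p(1) that, of k] by linarith
    then show ?thesis using f0[of k x] by (simp add: f_def divide_right_mono)
  qed
  have sB: "summable (\<lambda>k. (1/2) ^ k * B :: real)" by (intro summable_mult2 summable_geometric) simp
  have sf: "summable (\<lambda>k. f k x)" if "x \<in> S" for x
    by (rule summable_comparison_test'[OF sB, of 0]) (use fB[OF that] in auto)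
  have "continuous_on S F"
    unfolding F_def
  proof (rule uniform_limit_theorem[OF _ Weierstrass_m_test[OF fB sB]])
    show "\<forall>\<^sub>F n in sequentially. continuous_on S (\<lambda>x. \<Sum>k<n. f k x)"
      unfolding f_def by (intro always_eventually allI continuous_intros continuous_on_infdist_initial)
  qed auto
  \<comment> \<open>Longer initial segments have smaller distances, so \<open>F\<close> reverses the
    order. The inequality is strict because \<open>y\<close> is off the closed set
    \<open>initial a x\<close>, and a member of the dense sequence close to \<open>y\<close> detects
    this.\<close>
  have less: "F y < F x" if xy: "x \<in> S" "y \<in> S" "before a x y" "x \<noteq> y" for x y
  proof -
    have sub: "initial a x \<subseteq> initial a y"
      using xy(3) unfolding initial_def before_def by blast
    have nonempty: "initial a x \<noteq> {}" using initial_self[OF xy(1)] by blast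
    have mono: "f k y \<le> f k x" for k
      unfolding f_def using infdist_mono[OF sub nonempty] by (simp add: divide_right_mono)
    have "y \<notin> initial a x"
      using before_antisym[OF a(1) xy(1,2,3)] xy(4) by (auto simp: initial_def)
    then have pos: "infdist y (initial a x) > 0"
      using in_closed_iff_infdist_zero[OF closed_initial nonempty] infdist_nonneg by (metis less_eq_real_def)
    then have "infdist y (initial a x) / 2 > 0" by simp
    moreover have "y \<in> closure (range p)" using p(2) xy(2) by blast
    ultimately obtain k where k: "dist (p k) y < infdist y (initial a x) / 2"
      unfolding closure_approachable by blast
    have "infdist (p k) (initial a y) \<le> dist (p k) y" using initial_self[OF xy(2)] by (rule infdist_le)
    also have "\<dots> < infdist y (initial a x) / 2" by (rule k)
    also have "\<dots> \<le> infdist (p k) (initial a x)"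
      using infdist_triangle[of y "initial a x" "p k"] k by (simp add: dist_commute)
    finally have "f k y < f k x" by (simp add: f_def divide_strict_right_mono)
    then have "0 < (\<Sum>k. f k x - f k y)"
      by (intro suminf_pos2[of _ k] summable_diff sf xy) (use mono in auto)
    also have "\<dots> = F x - F y" unfolding F_def by (rule suminf_diff[symmetric]) (intro sf xy)+
    finally show ?thesis by simp
  qed
  have inj: "inj_on F S"
  proof (rule inj_onI, rule ccontr)
    fix x y assume "x \<in> S" "y \<in> S" "F x = F y" "x \<noteq> y"
    then show False using less[of x y] less[of y x] a(2)[of x y] by auto
  qed
  have "S homeomorphic F ` S"
    using homeomorphic_compact[OF compact \<open>continuous_on S F\<close> refl inj] .
  moreover have "connected (F ` S)" "compact (F ` S)"
    using connected_continuous_image compact_continuous_image \<open>continuous_on S F\<close> connected compact by blast+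
  then obtain l u where lu: "F ` S = {l..u}"
    using connected_compact_interval_1[of "F ` S"] by (auto simp: cbox_interval)
  moreover have "l < u"
  proof -
    have "F (p 0) \<in> {l..u}" "F (p 1) \<in> {l..u}" using lu p(1) by blast+
    moreover have "F (p 0) \<noteq> F (p 1)" using inj ne p(1) by (auto simp: inj_on_def)
    ultimately show ?thesis by auto
  qed
  then have "{l..u} homeomorphic {0..1::real}"
    by (intro homeomorphic_closed_intervals_real) auto
  ultimately show ?thesis using homeomorphic_trans by metis
qed

end

section \<open>Merging strands\<close>

text \<open>A wave which is 1 on the points of level \<open>s\<close> and 0 on those of lower levels: it moves a curve
  onto the new points without moving it at the old ones.\<close>

definition wave :: "nat \<Rightarrow> real \<Rightarrow> real" where
  "wave s y = (sin (pi * (2 ^ s * y)))\<^sup>2"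

text \<open>Neighbouring strands touch alternately at height 0 and at height 1, which makes a zigzag.\<close>

definition slant :: "nat \<Rightarrow> real \<Rightarrow> real" where
  "slant i y = (if even i then y else 1 - y)"

text \<open>The offset of strand \<open>j\<close> from strand \<open>k\<close> in a fresh bundle.
  The halving weights keep all offsets at most 1, and each summand vanishes exactly at the height
  where two neighbouring strands are to touch.\<close>

definition spread :: "nat \<Rightarrow> nat \<Rightarrow> real \<Rightarrow> real" where
  "spread k j y = (\<Sum>i=k..<j. (1/2) ^ Suc i * slant i y)"

definition level :: "nat \<Rightarrow> real \<Rightarrow> bool" where
  "level s y \<longleftrightarrow> (\<exists>m<2 ^ s. y = (2 * real m + 1) / 2 ^ Suc s)"

text \<open>Decoding a pair makes every strand the target of arbitrarily late stages, hence of
  arbitrarily fine levels.\<close>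

definition target :: "nat \<Rightarrow> nat" where
  "target s = fst (prod_decode s)"

lemma wave_bounds: "0 \<le> wave s y" "wave s y \<le> 1"
  by (auto simp: wave_def power_le_one_iff abs_square_le_1)

lemma wave_0 [simp]: "wave s 0 = 0"
  by (simp add: wave_def)

lemma wave_1 [simp]: "wave s 1 = 0"
proof -
  have "sin (real (2 ^ s) * pi) = 0" by (rule sin_npi)
  then show ?thesis by (simp add: wave_def mult.commute)
qed

lemma level_bounds: "level s y \<Longrightarrow> 0 < y" "level s y \<Longrightarrow> y < 1"
proof -
  assume "level s y"
  then obtain m where m: "m < 2 ^ s" "y = (2 * real m + 1) / 2 ^ Suc s" by (auto simp: level_def)
  show "0 < y" using m by simp
  have "2 * m + 1 < 2 ^ Suc s" using m(1) by simp
  then have "real (2 * m + 1) < real (2 ^ Suc s)" by (rule of_nat_less_iff[THEN iffD2])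
  then show "y < 1" using m(2) by simp
qed

lemma wave_level: "level s y \<Longrightarrow> wave s y = 1"
proof -
  assume "level s y"
  then obtain m where m: "y = (2 * real m + 1) / 2 ^ Suc s" by (auto simp: level_def)
  have "pi * (2 ^ s * y) = pi * real m + pi / 2" using m by (simp add: field_simps)
  then have "(sin (pi * (2 ^ s * y)))\<^sup>2 = (cos (pi * real m))\<^sup>2" by (simp add: sin_add)
  also have "\<dots> = ((-1) ^ m)\<^sup>2" by simp
  also have "\<dots> = 1" by (simp flip: power_mult)
  finally show ?thesis by (simp add: wave_def)
qed

lemma wave_above_level: "level s y \<Longrightarrow> s < t \<Longrightarrow> wave t y = 0"
proof -
  assume "level s y" "s < t"
  then obtain m where m: "y = (2 * real m + 1) / 2 ^ Suc s" by (auto simp: level_def)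
  obtain d where t: "t = Suc s + d" using \<open>s < t\<close> by (metis Suc_leI le_iff_add)
  have "2 ^ t * y = 2 ^ d * (2 ^ Suc s * y)" by (simp add: t power_add)
  also have "2 ^ Suc s * y = 2 * real m + 1" using m by simp
  finally have "pi * (2 ^ t * y) = real (2 ^ d * (2 * m + 1)) * pi" by (simp add: algebra_simps)
  moreover have "sin (real (2 ^ d * (2 * m + 1)) * pi) = 0" by (rule sin_npi)
  ultimately show ?thesis by (simp only: wave_def) simp
qed

lemma slant_nonneg: "0 \<le> y \<Longrightarrow> y \<le> 1 \<Longrightarrow> 0 \<le> slant i y"
  by (simp add: slant_def)

lemma slant_le_1: "0 \<le> y \<Longrightarrow> y \<le> 1 \<Longrightarrow> slant i y \<le> 1"
  by (simp add: slant_def)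

lemma spread_self [simp]: "spread k k y = 0"
  by (simp add: spread_def)

lemma spread_Suc: "k \<le> j \<Longrightarrow> spread k (Suc j) y = spread k j y + (1/2) ^ Suc j * slant j y"
  by (simp add: spread_def)

lemma spread_le_1:
  assumes "0 \<le> y" "y \<le> 1" shows "spread k j y \<le> 1"
proof -
  have "spread k j y \<le> (\<Sum>i\<in>{k..<j}. (1/2) ^ Suc i)"
    unfolding spread_def by (intro sum_mono) (use slant_le_1[OF assms] in simp)
  also have "\<dots> \<le> (\<Sum>i<j. (1/2) ^ Suc i)" by (intro sum_mono2) auto
  also have "\<dots> \<le> (\<Sum>i. (1/2::real) ^ Suc i)"
    using power_half_series by (intro sum_le_suminf) (auto simp: sums_iff)
  also have "\<dots> = 1" using power_half_series by (simp add: sums_iff)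
  finally show ?thesis .
qed

section \<open>The merging process\<close>

context
  fixes v :: "nat \<Rightarrow> nat"
begin

text \<open>Stage \<open>s\<close> adds points on strand \<open>target s\<close> and then merges all strands from \<open>v s\<close> on.
  The first component holds the strands, as graphs over the unit interval; the second
  holds, for each \<open>j\<close>, a curve through all points which currently lie on strands from \<open>j\<close> on.\<close>

primrec strands :: "nat \<Rightarrow> (nat \<Rightarrow> real \<Rightarrow> real) \<times> (nat \<Rightarrow> real \<Rightarrow> real)" where
  "strands 0 = (spread 0, spread 0)"
| "strands (Suc s) =
    (let h = (\<lambda>j y. if j \<le> target s
               then (1 - wave s y) * snd (strands s) j y + wave s y * fst (strands s) (target s) y
               else snd (strands s) j y);
         g = (\<lambda>j y. if j < v s then fst (strands s) j y
               else h (v s) y + (1/2) ^ Suc s * spread (v s) j y)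
     in (g, \<lambda>j y. if j < v s then h j y else g j y))"

definition strand :: "nat \<Rightarrow> nat \<Rightarrow> real \<Rightarrow> real" where "strand s = fst (strands s)"
definition through :: "nat \<Rightarrow> nat \<Rightarrow> real \<Rightarrow> real" where "through s = snd (strands s)"
text \<open>The curve \<open>through s j\<close> after stage \<open>s\<close> has drawn its points
  but before it merges anything. The new points lie on a strand from \<open>j\<close> on only if
  \<open>j \<le> target s\<close>; otherwise the curve keeps its shape.\<close>

definition refined :: "nat \<Rightarrow> nat \<Rightarrow> real \<Rightarrow> real" where
  "refined s j y = (if j \<le> target s
     then (1 - wave s y) * through s j y + wave s y * strand s (target s) y else through s j y)"

lemma strand_0: "strand 0 = spread 0" and through_0: "through 0 = spread 0"
  by (simp_all add: strand_def through_def)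

lemma strand_Suc: "strand (Suc s) j y =
    (if j < v s then strand s j y else refined s (v s) y + (1/2) ^ Suc s * spread (v s) j y)"
  and through_Suc: "through (Suc s) j y = (if j < v s then refined s j y else strand (Suc s) j y)"
  by (simp_all add: strand_def through_def refined_def Let_def)

lemma strand_Suc_visited: "strand (Suc s) (v s) y = refined s (v s) y"
  by (simp add: strand_Suc)

lemma continuous_strand_through: "continuous_on UNIV (strand s j) \<and> continuous_on UNIV (through s j)"
proof (induction s arbitrary: j)
  have "continuous_on UNIV (slant i)" for i
    by (cases "even i") (auto simp: slant_def[abs_def] intro!: continuous_intros)
  then have sp: "continuous_on UNIV (spread k j)" for k j
    unfolding spread_def[abs_def] by (intro continuous_intros)
  {
    case 0
    then show ?case by (simp add: strand_0 through_0 sp)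
  next
    case (Suc s)
    have w: "continuous_on UNIV (wave s)" unfolding wave_def by (intro continuous_intros)
    have r: "continuous_on UNIV (refined s j)" for j
      unfolding refined_def by (cases "j \<le> target s") (use Suc in \<open>auto intro!: continuous_intros w\<close>)
    have g: "continuous_on UNIV (strand (Suc s) j)" for j
      unfolding strand_Suc by (cases "j < v s") (use Suc r sp in \<open>auto intro!: continuous_intros simp: sp\<close>)
    have "continuous_on UNIV (through (Suc s) j)" for j
      unfolding through_Suc by (cases "j < v s") (use r g in auto)
    with g show ?case by simp
  }
qed

text \<open>The five facts support each other in one induction over the stages. The critical pair is
  \<open>Suc j = v s\<close>: strand \<open>v s\<close> jumps to its refined \<open>through\<close>
  curve while strand \<open>j\<close> stays, and the jump keeps them in order because it goes to the
  right, and keeps them touching because waves vanish at heights 0 and 1.\<close>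

lemma strand_invariants:
  assumes y: "0 \<le> y" "y \<le> 1"
  shows "strand s j y \<le> through s j y" "through s j y \<le> through s (Suc j) y"
    "slant j y > 0 \<Longrightarrow> strand s j y < strand s (Suc j) y"
    "slant j y = 0 \<Longrightarrow> strand s j y = strand s (Suc j) y"
    "y = 0 \<or> y = 1 \<Longrightarrow> through s j y = strand s j y"
proof -
  have "(\<forall>j. strand s j y \<le> through s j y) \<and> (\<forall>j. through s j y \<le> through s (Suc j) y) \<and>
    (\<forall>j. slant j y > 0 \<longrightarrow> strand s j y < strand s (Suc j) y) \<and>
    (\<forall>j. slant j y = 0 \<longrightarrow> strand s j y = strand s (Suc j) y) \<and>
    (y = 0 \<or> y = 1 \<longrightarrow> (\<forall>j. through s j y = strand s j y))"
  proof (induction s)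
    case 0
    show ?case
      using slant_nonneg[OF y] by (auto simp: strand_0 through_0 spread_Suc)
  next
    case (Suc s)
    define w where "w = wave s y"
    have w: "0 \<le> w" "w \<le> 1" unfolding w_def by (rule wave_bounds)+
    have gh: "strand s j y \<le> through s j y" and hm: "through s j y \<le> through s (Suc j) y"
      and gless: "slant j y > 0 \<Longrightarrow> strand s j y < strand s (Suc j) y"
      and geq: "slant j y = 0 \<Longrightarrow> strand s j y = strand s (Suc j) y"
      and ends: "y = 0 \<or> y = 1 \<Longrightarrow> through s j y = strand s j y" for j
      using Suc by blast+
    have gm: "strand s j y \<le> strand s (Suc j) y" for j
      using gless[of j] geq[of j] slant_nonneg[OF y, of j] by (cases "slant j y = 0") auto
    have gmono: "i \<le> j \<Longrightarrow> strand s i y \<le> strand s j y" for i j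
      by (rule lift_Suc_mono_le[of "\<lambda>j. strand s j y"]) (rule gm)
    have hmono: "i \<le> j \<Longrightarrow> through s i y \<le> through s j y" for i j
      by (rule lift_Suc_mono_le[of "\<lambda>j. through s j y"]) (rule hm)
    have ref: "refined s j y = (if j \<le> target s then (1 - w) * through s j y + w * strand s (target s) y
        else through s j y)" for j by (simp add: refined_def w_def)
    have rg: "strand s j y \<le> refined s j y" for j
    proof (cases "j \<le> target s")
      case True
      have "(1 - w) * strand s j y + w * strand s j y \<le> (1 - w) * through s j y + w * strand s (target s) y"
        using w gh gmono[OF True] by (intro add_mono mult_left_mono) auto
      then show ?thesis using True by (simp add: ref algebra_simps)
    qed (simp add: ref gh)
    have rm: "refined s j y \<le> refined s (Suc j) y" for j
    proof -
      consider "Suc j \<le> target s" | "j = target s" | "target s < j" by linarith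
      then show ?thesis
      proof cases
        case 1
        then show ?thesis using w hm[of j] by (simp add: ref mult_left_mono)
      next
        case 2
        have "(1 - w) * through s j y + w * strand s j y \<le> (1 - w) * through s j y + w * through s j y"
          using w gh by (intro add_mono mult_left_mono) auto
        also have "\<dots> = through s j y" by (simp add: algebra_simps)
        finally show ?thesis using 2 hm[of j] by (simp add: ref)
      next
        case 3
        then show ?thesis using hm by (simp add: ref)
      qed
    qed
    have rends: "refined s j y = strand s j y" if "y = 0 \<or> y = 1" for j
    proof -
      have "w = 0" using that by (auto simp: w_def)
      then show ?thesis using ends[OF that] by (simp add: ref)
    qed
    have new: "strand (Suc s) j y = refined s (v s) y + (1/2) ^ Suc s * spread (v s) j y" if "v s \<le> j" for j
      using that by (simp add: strand_Suc)
    have old: "strand (Suc s) j y = strand s j y" if "j < v s" for j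
      using that by (simp add: strand_Suc)
    have step: "strand (Suc s) (Suc j) y = strand (Suc s) j y + (1/2) ^ Suc s * ((1/2) ^ Suc j * slant j y)"
      if "v s \<le> j" for j
      using that by (simp add: new spread_Suc algebra_simps)
    have ngh: "strand (Suc s) j y \<le> through (Suc s) j y" for j
      using rg by (simp add: through_Suc old)
    have nless: "strand (Suc s) j y < strand (Suc s) (Suc j) y" if "slant j y > 0" for j
    proof -
      consider "Suc j < v s" | "Suc j = v s" | "v s \<le> j" by linarith
      then show ?thesis
      proof cases
        case 1 then show ?thesis using gless that by (simp add: old)
      next
        case 2
        then show ?thesis using gless[OF that] rg[of "v s"] by (simp add: old new)
      next
        case 3 then show ?thesis using that by (simp add: step)
      qed
    qed
    have neq: "strand (Suc s) j y = strand (Suc s) (Suc j) y" if "slant j y = 0" for j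
    proof -
      have yy: "y = 0 \<or> y = 1" using that by (auto simp: slant_def split: if_splits)
      consider "Suc j < v s" | "Suc j = v s" | "v s \<le> j" by linarith
      then show ?thesis
      proof cases
        case 1 then show ?thesis using geq that by (simp add: old)
      next
        case 2
        then show ?thesis using geq[OF that] rends[OF yy, of "v s"] by (simp add: old new)
      next
        case 3 then show ?thesis using that by (simp add: step)
      qed
    qed
    have nhm: "through (Suc s) j y \<le> through (Suc s) (Suc j) y" for j
    proof -
      consider "Suc j < v s" | "Suc j = v s" | "v s \<le> j" by linarith
      then show ?thesis
      proof cases
        case 1 then show ?thesis using rm by (simp add: through_Suc)
      next
        case 2
        then show ?thesis using rm[of j] by (simp add: through_Suc new)
      next
        case 3
        then have "through (Suc s) i y = strand (Suc s) i y" if "j \<le> i" for i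
          using that by (simp add: through_Suc)
        then show ?thesis using nless[of j] neq[of j] slant_nonneg[OF y, of j] by (cases "slant j y = 0") auto
      qed
    qed
    have nends: "through (Suc s) j y = strand (Suc s) j y" if "y = 0 \<or> y = 1" for j
      using rends[OF that, of j] by (simp add: through_Suc old)
    show ?case using ngh nhm nless neq nends by blast
  qed
  then show "strand s j y \<le> through s j y" "through s j y \<le> through s (Suc j) y"
    "slant j y > 0 \<Longrightarrow> strand s j y < strand s (Suc j) y"
    "slant j y = 0 \<Longrightarrow> strand s j y = strand s (Suc j) y"
    "y = 0 \<or> y = 1 \<Longrightarrow> through s j y = strand s j y" by blast+
qed

lemma strand_le_through: "0 \<le> y \<Longrightarrow> y \<le> 1 \<Longrightarrow> strand s j y \<le> through s j y"
  by (rule strand_invariants)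

lemma strand_mono:
  assumes "0 \<le> y" "y \<le> 1" "i \<le> j" shows "strand s i y \<le> strand s j y"
proof (rule lift_Suc_mono_le[of "\<lambda>j. strand s j y", OF _ assms(3)])
  show "strand s j y \<le> strand s (Suc j) y" for j
    using strand_invariants(3,4)[OF assms(1,2), where s = s and j = j] slant_nonneg[OF assms(1,2), of j]
    by (cases "slant j y = 0") auto
qed

lemma through_mono:
  assumes "0 \<le> y" "y \<le> 1" "i \<le> j" shows "through s i y \<le> through s j y"
  by (rule lift_Suc_mono_le[of "\<lambda>j. through s j y", OF _ assms(3)]) (rule strand_invariants(2)[OF assms(1,2)])

lemma strand_le_refined:
  assumes y: "0 \<le> y" "y \<le> 1" shows "strand s j y \<le> refined s j y"
proof (cases "j \<le> target s")
  case True
  have "(1 - wave s y) * strand s j y + wave s y * strand s j y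
      \<le> (1 - wave s y) * through s j y + wave s y * strand s (target s) y"
    using wave_bounds[of s y] strand_le_through[OF y] strand_mono[OF y True]
    by (intro add_mono mult_left_mono) auto
  then show ?thesis using True by (simp add: refined_def algebra_simps)
qed (simp add: refined_def strand_le_through[OF y])

text \<open>Drawing takes convex combinations and respects the bound \<open>c\<close>; only the new
  spread behind the visited strand exceeds it, by at most \<open>(1/2) ^ Suc s\<close>.\<close>

lemma through_bound_Suc:
  assumes y: "0 \<le> y" "y \<le> 1" and c: "\<And>i. through s i y \<le> c"
  shows "through (Suc s) i y \<le> c + (1/2) ^ Suc s"
proof -
  have g: "strand s i y \<le> c" for i using strand_le_through[OF y, of s i] c[of i] by linarith
  have r: "refined s i y \<le> c" for i
  proof (cases "i \<le> target s")
    case True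
    have "(1 - wave s y) * through s i y + wave s y * strand s (target s) y \<le> (1 - wave s y) * c + wave s y * c"
      using wave_bounds[of s y] c g by (intro add_mono mult_left_mono) auto
    then show ?thesis using True by (simp add: refined_def algebra_simps)
  qed (simp add: refined_def c)
  have "(1/2) ^ Suc s * spread (v s) i y \<le> (1/2) ^ Suc s * 1"
    by (intro mult_left_mono spread_le_1 y) simp
  moreover have "0 \<le> (1/2::real) ^ Suc s" by simp
  ultimately have "refined s i y \<le> c + (1/2) ^ Suc s"
    "refined s (v s) y + (1/2) ^ Suc s * spread (v s) i y \<le> c + (1/2) ^ Suc s"
    using r[of i] r[of "v s"] by linarith+
  then show ?thesis unfolding through_Suc strand_Suc by simp
qed

text \<open>The excesses of the single stages form a geometric series; the induction carries the
  sharper bound reduced by \<open>(1/2) ^ t\<close> to make it telescope.\<close>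

lemma through_bound_later:
  assumes y: "0 \<le> y" "y \<le> 1" and c: "\<And>i. through s i y \<le> c" and t: "s \<le> t"
  shows "through t i y \<le> c + (1/2) ^ s"
proof -
  have "\<forall>i. through t i y \<le> c + (1/2) ^ s - (1/2) ^ t"
    using t
  proof (induction t rule: dec_induct)
    case base
    then show ?case using c by simp
  next
    case (step t)
    then have "through (Suc t) i y \<le> c + (1/2) ^ s - (1/2) ^ t + (1/2) ^ Suc t" for i
      by (intro through_bound_Suc[OF y]) blast
    then show ?case by (simp add: algebra_simps)
  qed
  then have "through t i y \<le> c + (1/2) ^ s - (1/2) ^ t" ..
  also have "\<dots> \<le> c + (1/2) ^ s" by simp
  finally show ?thesis .
qed

lemma through_after_visit:
  assumes y: "0 \<le> y" "y \<le> 1"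
  shows "through (Suc s) i y \<le> strand (Suc s) (v s) y + (1/2) ^ Suc s"
proof -
  have "through (Suc s) i y \<le> through (Suc s) (max i (v s)) y" by (rule through_mono[OF y]) simp
  also have "\<dots> = strand (Suc s) (v s) y + (1/2) ^ Suc s * spread (v s) (max i (v s)) y"
    by (simp add: through_Suc strand_Suc)
  also have "\<dots> \<le> strand (Suc s) (v s) y + (1/2) ^ Suc s * 1"
    by (intro add_left_mono mult_left_mono spread_le_1 y) simp
  finally show ?thesis by simp
qed

text \<open>The bundle left by the visit has width at most \<open>(1/2) ^ Suc s\<close>, and all
  later stages together add at most as much again. This holds for every strand, whatever is visited
  later.\<close>

lemma strand_after_visit:
  assumes y: "0 \<le> y" "y \<le> 1" and "s < t"
  shows "strand t i y \<le> strand (Suc s) (v s) y + (1/2) ^ s"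
proof -
  have "strand t i y \<le> through t i y" by (rule strand_le_through[OF y])
  also have "\<dots> \<le> strand (Suc s) (v s) y + (1/2) ^ Suc s + (1/2) ^ Suc s"
    by (rule through_bound_later[OF y through_after_visit[OF y]]) (use assms in simp)
  finally show ?thesis by simp
qed

lemma strand_le_2: "0 \<le> y \<Longrightarrow> y \<le> 1 \<Longrightarrow> strand s i y \<le> 2"
  using through_bound_later[of y 0 1 s i] strand_le_through[of y s i] spread_le_1[of y 0]
  by (simp add: through_0)

lemma strand_nonneg:
  assumes y: "0 \<le> y" "y \<le> 1" shows "0 \<le> strand s i y"
proof -
  have "0 \<le> strand s 0 y"
  proof (induction s)
    case 0
    then show ?case by (simp add: strand_0)
  next
    case (Suc s)
    then show ?case using strand_le_refined[OF y, of s 0] by (cases "v s = 0") (simp_all add: strand_Suc)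
  qed
  then show ?thesis using strand_mono[OF y, of 0 i s] by simp
qed

section \<open>Limits of the strands\<close>

text \<open>From stage \<open>t0\<close> on, strand \<open>j\<close> is never absorbed by an earlier
  one. Visits to \<open>j\<close> itself remain possible; they move it to the right.\<close>

definition settled :: "nat \<Rightarrow> nat \<Rightarrow> bool" where
  "settled t0 j \<longleftrightarrow> (\<forall>t\<ge>t0. j \<le> v t)"

lemma strand_mono_stage:
  assumes y: "0 \<le> y" "y \<le> 1" and "settled t0 j" "t0 \<le> t" "t \<le> t'"
  shows "strand t j y \<le> strand t' j y"
  using assms(5)
proof (induction t' rule: dec_induct)
  case (step n)
  have "j \<le> v n" using assms step by (simp add: settled_def)
  then have "strand n j y \<le> strand (Suc n) j y"
    using strand_le_refined[OF y, of n j] by (cases "j = v n") (simp_all add: strand_Suc)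
  then show ?case using step by linarith
qed simp

definition final_strand :: "nat \<Rightarrow> real \<Rightarrow> real" where
  "final_strand j y = lim (\<lambda>t. strand t j y)"

lemma final_strand:
  assumes y: "0 \<le> y" "y \<le> 1" and s: "settled t0 j"
  shows "(\<lambda>t. strand t j y) \<longlonglongrightarrow> final_strand j y" "t0 \<le> t \<Longrightarrow> strand t j y \<le> final_strand j y"
proof -
  have inc: "incseq (\<lambda>t. strand (t + t0) j y)"
    by (intro incseq_SucI strand_mono_stage[OF y s]) auto
  then have "convergent (\<lambda>t. strand (t + t0) j y)"
    using strand_le_2[OF y] strand_nonneg[OF y]
    by (intro Bseq_monoseq_convergent incseq_imp_monoseq BseqI'[of _ 2]) auto
  then have "convergent (\<lambda>t. strand t j y)" using convergent_ignore_initial_segment[of "\<lambda>t. strand t j y" t0] by blast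
  then show l: "(\<lambda>t. strand t j y) \<longlonglongrightarrow> final_strand j y"
    unfolding final_strand_def by (simp add: convergent_LIMSEQ_iff)
  show "strand t j y \<le> final_strand j y" if "t0 \<le> t"
    by (rule LIMSEQ_le_const[OF l], rule exI[of _ t]) (simp add: strand_mono_stage[OF y s that])
qed

lemma final_strand_constant:
  assumes "settled t0 (Suc j)" "t0 \<le> t"
  shows "final_strand j y = strand t j y"
proof -
  have "strand n j y = strand t j y" if "t \<le> n" for n
    using that
  proof (induction n rule: dec_induct)
    case (step n)
    have "j < v n" using assms step by (simp add: settled_def less_eq_Suc_le)
    then show ?case using step by (simp add: strand_Suc)
  qed simp
  then have "(\<lambda>n. strand n j y) \<longlonglongrightarrow> strand t j y"
    by (intro tendsto_eventually eventually_sequentiallyI)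
  then show ?thesis unfolding final_strand_def by (rule limI)
qed

lemma settled_mono: "settled t0 j \<Longrightarrow> i \<le> j \<Longrightarrow> t0 \<le> t \<Longrightarrow> settled t i"
  unfolding settled_def by (auto intro: order_trans)

lemma final_strand_less:
  assumes y: "0 \<le> y" "y \<le> 1" and s: "settled t0 (Suc j)" and "slant j y > 0"
  shows "final_strand j y < final_strand (Suc j) y"
  using final_strand_constant[OF s order_refl, of y] final_strand(2)[OF y s order_refl]
    strand_invariants(3)[OF y assms(4), of t0] by linarith

lemma final_strand_eq:
  assumes y: "0 \<le> y" "y \<le> 1" and "slant j y = 0"
  shows "final_strand j y = final_strand (Suc j) y"
  unfolding final_strand_def using strand_invariants(4)[OF y assms(3)] by simp

lemma final_strand_mono:
  assumes y: "0 \<le> y" "y \<le> 1" and s: "settled t0 j" and "i \<le> j"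
  shows "final_strand i y \<le> final_strand j y"
proof (rule LIMSEQ_le)
  show "(\<lambda>t. strand t i y) \<longlonglongrightarrow> final_strand i y"
    using final_strand(1)[OF y settled_mono[OF s \<open>i \<le> j\<close> order_refl]] .
  show "(\<lambda>t. strand t j y) \<longlonglongrightarrow> final_strand j y" using final_strand(1)[OF y s] .
qed (auto intro: strand_mono[OF y \<open>i \<le> j\<close>])

lemma final_strand_bounds:
  assumes y: "0 \<le> y" "y \<le> 1" and s: "settled t0 j"
  shows "0 \<le> final_strand j y" "final_strand j y \<le> 2"
proof -
  show "0 \<le> final_strand j y"
    by (rule LIMSEQ_le_const[OF final_strand(1)[OF y s]]) (auto intro: strand_nonneg[OF y])
  show "final_strand j y \<le> 2"
    by (rule LIMSEQ_le_const2[OF final_strand(1)[OF y s]]) (auto intro: strand_le_2[OF y])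
qed

lemma final_strand_upper:
  assumes y: "0 \<le> y" "y \<le> 1" and s: "settled t0 j"
  shows "final_strand j y \<le> strand (Suc s) (v s) y + (1/2) ^ s"
  by (rule LIMSEQ_le_const2[OF final_strand(1)[OF y s]], rule exI[of _ "Suc s"])
    (simp add: strand_after_visit[OF y])

text \<open>If \<open>j\<close> is visited finitely often, the strand stops changing. Otherwise a
  late visit \<open>s'\<close> confines all later positions between the strand at that time and the
  same curve shifted by \<open>(1/2) ^ s'\<close>, so the convergence is uniform.\<close>

lemma continuous_on_final_strand:
  assumes s: "settled t0 j"
  shows "continuous_on {0..1} (final_strand j)"
proof (cases "finite {t. v t = j}")
  case True
  then obtain N where N: "\<And>t. v t = j \<Longrightarrow> t < N" using finite_nat_set_iff_bounded by auto
  have "settled (max t0 N) (Suc j)"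
  proof (unfold settled_def, intro allI impI)
    fix t assume "max t0 N \<le> t"
    then have "j \<le> v t" "v t \<noteq> j" using s N[of t] by (auto simp: settled_def)
    then show "Suc j \<le> v t" by simp
  qed
  from final_strand_constant[OF this order_refl]
  have "final_strand j = strand (max t0 N) j" by auto
  then show ?thesis
    using continuous_on_subset[OF conjunct1[OF continuous_strand_through]] by simp
next
  case False
  have "uniform_limit {0..1} (\<lambda>t. strand t j) (final_strand j) sequentially"
  proof (rule uniform_limitI)
    fix e :: real assume "e > 0"
    obtain M where M: "(1/2::real) ^ M < e" using \<open>e > 0\<close> real_arch_pow_inv[of e "1/2"] by auto
    have "\<exists>s'>max t0 M. s' \<in> {t. v t = j}"
      using False infinite_nat_iff_unbounded by blast
    then obtain s' where s': "s' > max t0 M" "v s' = j" by blast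
    have "(1/2::real) ^ s' \<le> (1/2) ^ M" using s' by (intro power_decreasing) auto
    with M have lt: "(1/2::real) ^ s' < e" by linarith
    have "\<forall>t\<ge>Suc s'. \<forall>y\<in>{0..1}. dist (strand t j y) (final_strand j y) < e"
    proof (intro allI impI ballI)
      fix t y assume t: "Suc s' \<le> t" and "y \<in> {0..1::real}"
      then have y: "0 \<le> y" "y \<le> 1" by auto
      have "strand (Suc s') j y \<le> strand t j y" by (rule strand_mono_stage[OF y s]) (use s' t in auto)
      moreover have "strand t j y \<le> final_strand j y" by (rule final_strand(2)[OF y s]) (use s' t in auto)
      moreover have "final_strand j y \<le> strand (Suc s') j y + (1/2) ^ s'"
        using final_strand_upper[OF y s, of s'] s' by simp
      ultimately show "dist (strand t j y) (final_strand j y) < e" using lt by (simp add: dist_real_def)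
    qed
    then show "\<forall>\<^sub>F t in sequentially. \<forall>y\<in>{0..1}. dist (strand t j y) (final_strand j y) < e"
      unfolding eventually_sequentially by blast
  qed
  then show ?thesis
    by (rule uniform_limit_theorem[rotated])
      (auto intro!: always_eventually continuous_on_subset[OF conjunct1[OF continuous_strand_through]])
qed

text \<open>The number \<open>l\<close> is the minimum of \<open>target s\<close> and of the visits
  since stage \<open>s\<close>. A visit at or below \<open>l\<close> takes the point over, because
  all curves \<open>through t j\<close> with \<open>j \<le> l\<close> already pass through it; later
  waves vanish at heights of level \<open>s\<close> and leave it alone.\<close>

lemma point_on_strands:
  assumes l: "level s y" and "s < t"
  shows "\<exists>l\<le>target s. (\<forall>j\<le>l. through t j y = strand s (target s) y) \<and> strand t l y = strand s (target s) y \<and>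
     (\<forall>i\<in>{s..<t}. l \<le> v i) \<and> (l = target s \<or> (\<exists>i\<in>{s..<t}. l = v i))"
  using Suc_leI[OF \<open>s < t\<close>]
proof (induction t rule: dec_induct)
  case base
  have r: "refined s j y = strand s (target s) y" if "j \<le> target s" for j
    using that wave_level[OF l] by (simp add: refined_def)
  show ?case
  proof (cases "v s \<le> target s")
    case True
    then have "(\<forall>j\<le>v s. through (Suc s) j y = strand s (target s) y) \<and> strand (Suc s) (v s) y = strand s (target s) y"
      using r by (auto simp: through_Suc strand_Suc_visited)
    then show ?thesis using True by (intro exI[of _ "v s"]) auto
  next
    case False
    then have "(\<forall>j\<le>target s. through (Suc s) j y = strand s (target s) y) \<and> strand (Suc s) (target s) y = strand s (target s) y"
      using r by (simp add: through_Suc strand_Suc)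
    then show ?thesis using False by (intro exI[of _ "target s"]) auto
  qed
next
  case (step t)
  then obtain l' where l': "l' \<le> target s" "\<And>j. j \<le> l' \<Longrightarrow> through t j y = strand s (target s) y"
     "strand t l' y = strand s (target s) y"
     "\<forall>i\<in>{s..<t}. l' \<le> v i" "l' = target s \<or> (\<exists>i\<in>{s..<t}. l' = v i)" by blast
  have "wave t y = 0" by (rule wave_above_level[OF l]) (use step in simp)
  then have r: "refined t j y = through t j y" for j by (simp add: refined_def)
  have st: "{s..<Suc t} = insert t {s..<t}" using step by auto
  show ?case
  proof (cases "v t \<le> l'")
    case True
    then have "(\<forall>j\<le>v t. through (Suc t) j y = strand s (target s) y) \<and> strand (Suc t) (v t) y = strand s (target s) y"
      using r l' by (auto simp: through_Suc strand_Suc_visited)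
    then show ?thesis using True l' unfolding st by (intro exI[of _ "v t"]) auto
  next
    case False
    then have "(\<forall>j\<le>l'. through (Suc t) j y = strand s (target s) y) \<and> strand (Suc t) l' y = strand s (target s) y"
      using r l' by (simp add: through_Suc strand_Suc)
    then show ?thesis using False l' unfolding st by (intro exI[of _ l']) auto
  qed
qed

lemma point_on_final_strand:
  assumes l: "level s y"
  obtains j where "j \<le> target s" "settled s j" "final_strand j y = strand s (target s) y"
    "j = target s \<or> (\<exists>i\<ge>s. j = v i)"
proof -
  define j where "j = (LEAST j. j = target s \<or> (\<exists>i\<ge>s. j = v i))"
  have j: "j = target s \<or> (\<exists>i\<ge>s. j = v i)"
    unfolding j_def by (rule LeastI[of _ "target s"]) simp
  have le: "j \<le> target s" "\<And>i. i \<ge> s \<Longrightarrow> j \<le> v i"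
    unfolding j_def by (auto intro: Least_le)
  \<comment> \<open>By stage \<open>t0\<close> the minimum \<open>j\<close> has been attained, so
    from then on the strand given by \<open>point_on_strands\<close> is \<open>j\<close>
    itself.\<close>
  obtain t0 where t0: "t0 > s" "j = target s \<or> (\<exists>i\<in>{s..<t0}. j = v i)"
  proof (cases "j = target s")
    case True
    then show ?thesis using that[of "Suc s"] by simp
  next
    case False
    then obtain i where "i \<ge> s" "j = v i" using j by blast
    then have "j = target s \<or> (\<exists>i\<in>{s..<Suc i}. j = v i)" by (intro disjI2 bexI[of _ i]) auto
    then show ?thesis using that[of "Suc i"] \<open>i \<ge> s\<close> by simp
  qed
  have "strand t j y = strand s (target s) y" if t: "t0 \<le> t" for t
  proof -
    obtain l' where l': "l' \<le> target s" "strand t l' y = strand s (target s) y"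
       "\<forall>i\<in>{s..<t}. l' \<le> v i" "l' = target s \<or> (\<exists>i\<in>{s..<t}. l' = v i)"
      using point_on_strands[OF l, of t] t t0(1) by auto
    have "j \<le> l'" using l'(4) le by auto
    moreover have "l' \<le> j" using t0(2) l'(1,3) t by auto
    ultimately show ?thesis using l'(2) by simp
  qed
  then have "(\<lambda>t. strand t j y) \<longlonglongrightarrow> strand s (target s) y"
    by (intro tendsto_eventually eventually_sequentiallyI)
  then have "final_strand j y = strand s (target s) y" unfolding final_strand_def by (rule limI)
  then show ?thesis using that[of j] j le by (auto simp: settled_def)
qed

lemma dense_on_final_strand:
  assumes s: "settled t0 j" and y: "0 \<le> y" "y \<le> 1" and e: "e > 0"
  obtains s y' where "level s y'" "\<bar>y' - y\<bar> < e" "final_strand j y' = strand s (target s) y'"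
proof -
  obtain M where M: "(1/2::real) ^ M < e" using e real_arch_pow_inv[of e "1/2"] by auto
  \<comment> \<open>A stage that draws on strand \<open>j\<close>, late enough for the strand to be
    settled and for the grid of its level to be finer than \<open>e\<close>. Its points stay on
    strand \<open>j\<close>, since no later visit goes below \<open>j\<close>.\<close>
  define s' where "s' = prod_encode (j, max t0 M)"
  have s': "t0 \<le> s'" "M \<le> s'" "target s' = j"
    using le_prod_encode_2[of "max t0 M" j] by (auto simp: s'_def target_def)
  \<comment> \<open>The cap serves \<open>y = 1\<close>, where rounding down would give an index one
    too large.\<close>
  define m where "m = min (nat \<lfloor>2 ^ s' * y\<rfloor>) (2 ^ s' - 1)"
  define y' where "y' = (2 * real m + 1) / 2 ^ Suc s'"
  have lev: "level s' y'" unfolding level_def y'_def by (intro exI[of _ m]) (simp add: m_def min_less_iff_disj)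
  have m1: "real m \<le> 2 ^ s' * y"
  proof -
    have "real m \<le> real (nat \<lfloor>2 ^ s' * y\<rfloor>)" by (simp add: m_def)
    also have "\<dots> \<le> 2 ^ s' * y" using y by (simp add: of_nat_nat)
    finally show ?thesis .
  qed
  have m2: "2 ^ s' * y \<le> real m + 1"
  proof (cases "nat \<lfloor>2 ^ s' * y\<rfloor> \<le> 2 ^ s' - 1")
    case True
    then have "real m = of_int \<lfloor>2 ^ s' * y\<rfloor>" using y by (simp add: m_def of_nat_nat)
    then show ?thesis by linarith
  next
    case False
    then have "m = 2 ^ s' - 1" by (simp add: m_def)
    then have "real m + 1 = 2 ^ s'" by (simp add: of_nat_diff)
    then show ?thesis using y by simp
  qed
  have "2 ^ s' * y' = real m + 1/2" by (simp add: y'_def field_simps)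
  then have "\<bar>2 ^ s' * (y' - y)\<bar> < 1"
    using m1 m2 by (simp only: right_diff_distrib)
  then have "2 ^ s' * \<bar>y' - y\<bar> < 1" by (simp add: abs_mult)
  then have "\<bar>y' - y\<bar> < (1/2) ^ s'" by (simp add: field_simps power_divide)
  also have "\<dots> \<le> (1/2) ^ M" using s'(2) by (intro power_decreasing) auto
  also have "\<dots> < e" by (rule M)
  finally have near: "\<bar>y' - y\<bar> < e" .
  obtain i where i: "i \<le> target s'" "final_strand i y' = strand s' (target s') y'"
    "i = target s' \<or> (\<exists>n\<ge>s'. i = v n)"
    by (rule point_on_final_strand[OF lev])
  have "j \<le> i" using i(3) s' s by (auto simp: settled_def)
  then have "i = j" using i(1) s'(3) by simp
  then show ?thesis using that[OF lev near] i s' by simp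
qed

end

section \<open>Gadgets\<close>

definition dyadic :: "nat \<Rightarrow> nat \<Rightarrow> real" where
  "dyadic s m = (2 * real m + 1) / 2 ^ Suc s"

lemma level_dyadic: "m < 2 ^ s \<Longrightarrow> level s (dyadic s m)"
  by (auto simp: level_def dyadic_def)

text \<open>\<open>ramp s\<close> rises from 0 at \<open>-(1/2)^s\<close> to 1 at \<open>-(1/2)^(s+1)\<close>.\<close>

definition ramp :: "nat \<Rightarrow> real \<Rightarrow> real" where
  "ramp s y = max 0 (min 1 (2 + 2 ^ Suc s * y))"

lemma ramp_bounds: "0 \<le> ramp s y" "ramp s y \<le> 1"
  by (auto simp: ramp_def)

lemma ramp_0 [simp]: "ramp s 0 = 1"
  by (simp add: ramp_def)

lemma ramp_eq_0:
  assumes "y \<le> - ((1/2) ^ n)" "n \<le> s" shows "ramp s y = 0"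
proof -
  have "(2::real) = 2 ^ Suc n * (1/2) ^ n" by (simp add: power_one_over)
  also have "\<dots> \<le> 2 ^ Suc s * (1/2) ^ n" using assms(2) by (intro mult_right_mono power_increasing) auto
  also have "\<dots> \<le> 2 ^ Suc s * (- y)" using assms(1) by (intro mult_left_mono) auto
  finally show ?thesis by (simp add: ramp_def)
qed

definition graph :: "(real \<Rightarrow> real) \<Rightarrow> real set \<Rightarrow> (real \<times> real) set" where
  "graph c I = (\<lambda>y. (c y, y)) ` I"

lemma mem_graph [simp]: "(u, y) \<in> graph c I \<longleftrightarrow> y \<in> I \<and> u = c y"
  by (auto simp: graph_def)

lemma arc_graph:
  assumes "continuous_on (closed_segment a b) c" "a \<noteq> b"
  obtains g where "arc g" "path_image g = graph c (closed_segment a b)"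
    "pathstart g = (c a, a)" "pathfinish g = (c b, b)"
proof
  define g where "g t = (c ((b - a) * t + a), (b - a) * t + a)" for t
  have seg: "(\<lambda>t. (b - a) * t + a) ` {0..1} = closed_segment a b"
    by (simp add: closed_segment_real_eq)
  have "continuous_on {0..1} (\<lambda>t. c ((b - a) * t + a))"
    using assms(1) seg by (intro continuous_on_compose2[OF assms(1)] continuous_intros) auto
  then have "path g" unfolding path_def g_def by (intro continuous_intros)
  moreover have "inj_on g {0..1}" using assms(2) by (auto simp: inj_on_def g_def)
  ultimately show "arc g" by (simp add: arc_def)
  show "path_image g = graph c (closed_segment a b)"
    unfolding path_image_def graph_def g_def seg[symmetric] image_image ..
  show "pathstart g = (c a, a)" "pathfinish g = (c b, b)" by (auto simp: pathstart_def pathfinish_def g_def)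
qed

context
  fixes v :: "nat \<Rightarrow> nat"
begin

text \<open>The free end of the zigzag at the visit number \<open>s\<close> is at \<open>(anchor s, 0)\<close>. The tail runs through
  these positions at the heights \<open>-(1/2)^s\<close>, hence it needs no merging.\<close>

primrec anchor :: "nat \<Rightarrow> real" where
  "anchor 0 = 0"
| "anchor (Suc s) = strand v (Suc s) (v s) 0"

lemma anchor_nonneg: "0 \<le> anchor s"
  by (cases s) (simp_all add: strand_nonneg)

text \<open>Waves vanish at height 0, so the visited strand ends where its \<open>through\<close>
  curve ended before, and the preceding visit keeps that within \<open>(1/2) ^ s\<close> to the
  right of the old anchor. Steps to the left may be long, when an early strand is visited.\<close>

lemma anchor_step: "anchor (Suc s) - anchor s \<le> 2 * (1/2) ^ s"
proof (cases s)
  case 0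
  then show ?thesis using strand_le_2[of 0 v 1 "v 0"] by simp
next
  case (Suc n)
  have "anchor (Suc s) = through v s (v s) 0"
    by (simp only: anchor.simps strand_Suc_visited) (simp add: refined_def)
  also have "\<dots> \<le> anchor s + (1/2) ^ s"
    unfolding Suc anchor.simps by (rule through_after_visit) auto
  finally have "anchor (Suc s) - anchor s \<le> (1/2) ^ s" by simp
  also have "\<dots> \<le> 2 * (1/2) ^ s" by simp
  finally show ?thesis .
qed

text \<open>Only steps to the right are controlled by \<open>anchor_step\<close>, but steps to the
  left cannot exceed them in total, as anchors never become negative. Formally, a step
  \<open>x\<close> with \<open>x \<le> 2 * (1/2) ^ s\<close> satisfies
  \<open>\<bar>x\<bar> \<le> 4 * (1/2) ^ s - x\<close>, and the subtracted steps telescope.\<close>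

lemma anchor_variation: "(\<Sum>s<n. \<bar>anchor (Suc s) - anchor s\<bar>) \<le> 8"
proof -
  have "(\<Sum>s<n. \<bar>anchor (Suc s) - anchor s\<bar>) \<le> (\<Sum>s<n. 4 * (1/2) ^ s - (anchor (Suc s) - anchor s))"
  proof (rule sum_mono)
    fix s
    have "0 \<le> (1/2::real) ^ s" by simp
    then show "\<bar>anchor (Suc s) - anchor s\<bar> \<le> 4 * (1/2) ^ s - (anchor (Suc s) - anchor s)"
      using anchor_step[of s] by (simp only: abs_if split: if_split) linarith
  qed
  also have "\<dots> = 4 * (\<Sum>s<n. (1/2) ^ s) - anchor n"
    using sum_lessThan_telescope[of anchor n]
    by (simp only: sum_subtractf sum_distrib_left) simp
  also have "\<dots> \<le> 4 * (\<Sum>s<n. (1/2) ^ s)" using anchor_nonneg by simp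
  also have "(\<Sum>s<n. (1/2::real) ^ s) \<le> (\<Sum>s. (1/2) ^ s)"
    by (intro sum_le_suminf summable_geometric) auto
  also have "(\<Sum>s. (1/2::real) ^ s) = 2" by (subst suminf_geometric) auto
  finally show ?thesis by simp
qed

definition tail :: "real \<Rightarrow> real" where
  "tail y = (\<Sum>s. (anchor (Suc s) - anchor s) * ramp s y)"

lemma summable_anchor: "summable (\<lambda>s. \<bar>anchor (Suc s) - anchor s\<bar>)"
  by (rule summableI_nonneg_bounded[OF _ anchor_variation]) simp

lemma tail_term_le: "norm ((anchor (Suc s) - anchor s) * ramp s y) \<le> \<bar>anchor (Suc s) - anchor s\<bar>"
  using ramp_bounds[of s y] by (simp add: abs_mult mult_left_le)

lemma continuous_on_tail: "continuous_on UNIV tail"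
proof -
  have "continuous_on UNIV (\<lambda>y. \<Sum>s. (anchor (Suc s) - anchor s) * ramp s y)"
  proof (rule uniform_limit_theorem[OF _ Weierstrass_m_test[OF tail_term_le summable_anchor]])
    show "\<forall>\<^sub>F n in sequentially. continuous_on UNIV (\<lambda>y. \<Sum>s<n. (anchor (Suc s) - anchor s) * ramp s y)"
      unfolding ramp_def by (intro always_eventually allI continuous_intros)
  qed auto
  then show ?thesis by (simp add: tail_def[abs_def])
qed

lemma tail_bound: "\<bar>tail y\<bar> \<le> 8"
proof -
  have s: "summable (\<lambda>s. norm ((anchor (Suc s) - anchor s) * ramp s y))"
    by (rule summable_comparison_test'[OF summable_anchor, of 0]) (use tail_term_le in simp)
  have "\<bar>tail y\<bar> \<le> (\<Sum>s. norm ((anchor (Suc s) - anchor s) * ramp s y))"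
    unfolding tail_def using summable_norm[OF s] by simp
  also have "\<dots> \<le> (\<Sum>s. \<bar>anchor (Suc s) - anchor s\<bar>)"
    by (rule suminf_le[OF tail_term_le s summable_anchor])
  also have "\<dots> \<le> 8" by (rule suminf_le_const[OF summable_anchor anchor_variation])
  finally show ?thesis .
qed

text \<open>Ramp \<open>s\<close> starts at height \<open>- ((1/2) ^ s)\<close>, so at this height
  only the first \<open>n\<close> steps count. Thus every tail point below height 0 is fixed by
  finitely many visits.\<close>

lemma tail_eq_sum: "y \<le> - ((1/2) ^ n) \<Longrightarrow> tail y = (\<Sum>s<n. (anchor (Suc s) - anchor s) * ramp s y)"
  unfolding tail_def by (rule suminf_finite) (auto simp: ramp_eq_0)

lemma tail_minus_1: "tail (-1) = 0"
  using tail_eq_sum[of "-1" 0] by simp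

lemma anchor_tendsto: "anchor \<longlonglongrightarrow> tail 0"
proof -
  have "summable (\<lambda>s. anchor (Suc s) - anchor s)"
    using summable_anchor by (rule summable_rabs_cancel)
  from summable_LIMSEQ[OF this] show ?thesis
    by (simp add: tail_def sum_lessThan_telescope del: anchor.simps(2))
qed

text \<open>The anchors converge in any case; along the visits to \<open>k\<close> they are the ends
  of strand \<open>k\<close> at height 0.\<close>

lemma tail_0:
  assumes s: "settled v t0 k" and inf: "infinite {t. v t = k}"
  shows "tail 0 = final_strand v k 0"
proof -
  obtain r :: "nat \<Rightarrow> nat" where r0: "strict_mono r" "\<forall>n. r n \<in> {t. v t = k}"
    using infinite_enumerate[OF inf] by blast
  then have r: "strict_mono r" "\<And>n. v (r n) = k" by auto
  have r': "strict_mono (\<lambda>n. Suc (r n))" using r(1) by (simp add: strict_mono_def)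
  have "(\<lambda>n. anchor (Suc (r n))) \<longlonglongrightarrow> tail 0"
    using LIMSEQ_subseq_LIMSEQ[OF anchor_tendsto r'] by (simp add: o_def del: anchor.simps)
  moreover have "(\<lambda>n. anchor (Suc (r n))) \<longlonglongrightarrow> final_strand v k 0"
    using LIMSEQ_subseq_LIMSEQ[OF final_strand(1)[OF _ _ s, of 0] r'] r(2) by (simp add: o_def)
  ultimately show ?thesis by (rule LIMSEQ_unique)
qed

lemma final_strand_0_1: "final_strand v 0 1 = 0"
proof -
  have "strand v s 0 1 = 0" for s
  proof (induction s)
    case 0
    then show ?case by (simp add: strand_0)
  next
    case (Suc s)
    have "refined v s 0 1 = 0" using Suc strand_invariants(5)[of 1 v s 0] by (simp add: refined_def)
    then show ?case using Suc by (simp add: strand_Suc)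
  qed
  then show ?thesis by (simp add: final_strand_def)
qed

definition gadget_point :: "bool \<Rightarrow> nat \<Rightarrow> nat \<Rightarrow> real \<times> real" where
  "gadget_point b s m = (if b then (strand v s (target s) (dyadic s m), dyadic s m)
     else (tail (- dyadic s m), - dyadic s m))"

definition gadget_points :: "(real \<times> real) set" where
  "gadget_points = {gadget_point b s m |b s m. m < 2 ^ s}"

definition gadget_arc :: "nat \<Rightarrow> (real \<times> real) set" where
  "gadget_arc k = (\<Union>j\<le>k. graph (final_strand v j) {0..1}) \<union> graph tail {-1..0}"

text \<open>The zero of \<open>slant j\<close>: the height at which the zigzag passes from strand
  \<open>j\<close> to strand \<open>Suc j\<close>.\<close>

definition strand_end :: "nat \<Rightarrow> real" where
  "strand_end j = (if even j then 0 else 1)"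

text \<open>The strands are traversed downwards and upwards in turn. A point common to strand
  \<open>Suc n\<close> and an earlier one forces strands \<open>n\<close> and \<open>Suc n\<close>
  to agree at its height, which happens only where \<open>slant n\<close> vanishes, at the turning
  point.\<close>

lemma arc_strands:
  assumes s: "settled v t0 n"
  shows "\<exists>g. arc g \<and> path_image g = (\<Union>j\<le>n. graph (final_strand v j) {0..1}) \<and>
    pathstart g = (0, 1) \<and> pathfinish g = (final_strand v n (strand_end n), strand_end n)"
  using s
proof (induction n)
  case 0
  have "continuous_on (closed_segment 1 0) (final_strand v 0)"
    using continuous_on_final_strand[OF 0] by (simp add: closed_segment_eq_real_ivl)
  then obtain g where "arc g" "path_image g = graph (final_strand v 0) (closed_segment 1 0)"
    "pathstart g = (final_strand v 0 1, 1)" "pathfinish g = (final_strand v 0 0, 0)"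
    by (rule arc_graph) auto
  then show ?case by (intro exI[of _ g]) (simp add: strand_end_def final_strand_0_1 closed_segment_eq_real_ivl)
next
  case (Suc n)
  have sn: "settled v t0 n" using Suc.prems settled_mono by (meson le_SucI order_refl)
  obtain g where g: "arc g" "path_image g = (\<Union>j\<le>n. graph (final_strand v j) {0..1})"
     "pathstart g = (0, 1)" "pathfinish g = (final_strand v n (strand_end n), strand_end n)"
    using Suc.IH[OF sn] by blast
  have seg: "closed_segment (strand_end n) (strand_end (Suc n)) = {0..1}"
    by (auto simp: strand_end_def closed_segment_eq_real_ivl)
  have "strand_end n \<noteq> strand_end (Suc n)" by (simp add: strand_end_def)
  then obtain p where p: "arc p" "path_image p = graph (final_strand v (Suc n)) {0..1}"
     "pathstart p = (final_strand v (Suc n) (strand_end n), strand_end n)"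
     "pathfinish p = (final_strand v (Suc n) (strand_end (Suc n)), strand_end (Suc n))"
    using arc_graph[of "strand_end n" "strand_end (Suc n)" "final_strand v (Suc n)"]
      continuous_on_final_strand[OF Suc.prems] unfolding seg by blast
  have slant_end: "slant n y = 0 \<longleftrightarrow> y = strand_end n" for y
    by (auto simp: slant_def strand_end_def)
  have join: "pathfinish g = pathstart p"
    unfolding g p using final_strand_eq[of "strand_end n" n v] slant_end[of "strand_end n"]
    by (simp add: strand_end_def)
  have "path_image g \<inter> path_image p \<subseteq> {pathstart p}"
  proof
    fix z assume "z \<in> path_image g \<inter> path_image p"
    then have z: "z \<in> (\<Union>j\<le>n. graph (final_strand v j) {0..1})" "z \<in> graph (final_strand v (Suc n)) {0..1}"
      unfolding g p by blast+
    obtain u y where uy: "z = (u, y)" by (cases z)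
    from z(1) obtain j where "j \<le> n" "(u, y) \<in> graph (final_strand v j) {0..1}" unfolding uy by blast
    with z(2) have y: "j \<le> n" "0 \<le> y" "y \<le> 1" "final_strand v j y = final_strand v (Suc n) y"
       "z = (final_strand v (Suc n) y, y)" by (auto simp: uy)
    have "final_strand v (Suc n) y \<le> final_strand v n y"
      using final_strand_mono[OF y(2,3) sn y(1)] y(4) by simp
    then have "slant n y = 0"
      using final_strand_less[OF y(2,3) Suc.prems] slant_nonneg[OF y(2,3), of n] by linarith
    then show "z \<in> {pathstart p}" using y(5) slant_end p by simp
  qed
  then have "arc (g +++ p)" using arc_join[OF g(1) p(1) join] by blast
  moreover have "path_image (g +++ p) = (\<Union>j\<le>Suc n. graph (final_strand v j) {0..1})"
    unfolding path_image_join[OF join] g p by (auto simp: atMost_Suc)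
  ultimately show ?case using g p by (intro exI[of _ "g +++ p"]) simp
qed

lemma arc_gadget:
  assumes s: "settled v t0 k" and inf: "infinite {t. v t = k}" and "even k"
  obtains g where "arc g" "path_image g = gadget_arc k" "pathstart g = (0, 1)" "pathfinish g = (0, -1)"
proof -
  obtain g where g: "arc g" "path_image g = (\<Union>j\<le>k. graph (final_strand v j) {0..1})"
     "pathstart g = (0, 1)" "pathfinish g = (final_strand v k 0, 0)"
    using arc_strands[OF s] \<open>even k\<close> by (auto simp: strand_end_def)
  have "continuous_on (closed_segment 0 (-1)) tail"
    using continuous_on_tail continuous_on_subset by blast
  then obtain p where p: "arc p" "path_image p = graph tail (closed_segment 0 (-1))"
     "pathstart p = (tail 0, 0)" "pathfinish p = (tail (-1), -1)"
    by (rule arc_graph) auto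
  have pi: "path_image p = graph tail {-1..0}" unfolding p by (simp add: closed_segment_eq_real_ivl)
  have join: "pathfinish g = pathstart p" using tail_0[OF s inf] g p by simp
  have "path_image g \<inter> path_image p \<subseteq> {pathstart p}" unfolding g pi p by (auto simp: graph_def)
  then have "arc (g +++ p)" using arc_join[OF g(1) p(1) join] by blast
  moreover have "path_image (g +++ p) = gadget_arc k"
    unfolding path_image_join[OF join] g pi gadget_arc_def ..
  ultimately show ?thesis using that[of "g +++ p"] g p by (simp add: tail_minus_1)
qed

text \<open>A drawn point ends on a strand that no later visit goes below, and \<open>k\<close> is
  visited again and again; hence that strand has number at most \<open>k\<close>.\<close>

lemma gadget_points_subset:
  assumes inf: "infinite {t. v t = k}"
  shows "gadget_points \<subseteq> gadget_arc k"
proof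
  fix z assume "z \<in> gadget_points"
  then obtain b s m where m: "m < 2 ^ s" and z: "z = gadget_point b s m" by (auto simp: gadget_points_def)
  have lev: "level s (dyadic s m)" using m by (rule level_dyadic)
  note y = level_bounds[OF lev]
  show "z \<in> gadget_arc k"
  proof (cases b)
    case True
    obtain j where j: "settled v s j" "final_strand v j (dyadic s m) = strand v s (target s) (dyadic s m)"
      by (rule point_on_final_strand[OF lev])
    obtain t where "t \<ge> s" "v t = k" using inf unfolding infinite_nat_iff_unbounded_le by blast
    then have "j \<le> k" using j(1) by (auto simp: settled_def)
    moreover have "z \<in> graph (final_strand v j) {0..1}"
      using True j(2) y z by (simp add: gadget_point_def)
    ultimately show ?thesis unfolding gadget_arc_def by blast
  next
    case False
    then show ?thesis using y z by (simp add: gadget_point_def gadget_arc_def)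
  qed
qed

lemma graph_subset_closure:
  assumes "continuous_on I c"
    and dense: "\<And>y e. y \<in> I \<Longrightarrow> e > 0 \<Longrightarrow> \<exists>y'\<in>I. \<bar>y' - y\<bar> < e \<and> (c y', y') \<in> Q"
  shows "graph c I \<subseteq> closure Q"
proof
  fix z assume "z \<in> graph c I"
  then obtain y where y: "y \<in> I" "z = (c y, y)" by (auto simp: graph_def)
  have "\<exists>q\<in>Q. dist q z < e" if "e > 0" for e
  proof -
    have c2: "continuous_on I (\<lambda>y. (c y, y))" by (intro continuous_intros assms(1))
    then obtain d where d: "d > 0" "\<And>y'. y' \<in> I \<Longrightarrow> dist y' y < d \<Longrightarrow> dist (c y', y') (c y, y) < e"
      using y(1) \<open>e > 0\<close> unfolding continuous_on_iff by metis
    obtain y' where "y' \<in> I" "\<bar>y' - y\<bar> < d" "(c y', y') \<in> Q" using dense[OF y(1) d(1)] by blast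
    then show ?thesis using d(2)[of y'] y(2) by (auto simp: dist_real_def)
  qed
  then show "z \<in> closure Q" unfolding closure_approachable by blast
qed

lemma final_strand_subset_closure:
  assumes s: "settled v t0 j"
  shows "graph (final_strand v j) {0..1} \<subseteq> closure gadget_points"
proof (rule graph_subset_closure[OF continuous_on_final_strand[OF s]])
  fix y e :: real assume "y \<in> {0..1}" "e > 0"
  then obtain s' y' where y': "level s' y'" "\<bar>y' - y\<bar> < e" "final_strand v j y' = strand v s' (target s') y'"
    using dense_on_final_strand[OF s, of y e] by auto
  obtain m where m: "m < 2 ^ s'" "y' = dyadic s' m" using y'(1) by (auto simp: level_def dyadic_def)
  have "(final_strand v j y', y') = gadget_point True s' m" using y' m by (simp add: gadget_point_def)
  then have "(final_strand v j y', y') \<in> gadget_points" using m(1) unfolding gadget_points_def by blast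
  moreover have "y' \<in> {0..1}" using level_bounds[OF y'(1)] by simp
  ultimately show "\<exists>y'\<in>{0..1}. \<bar>y' - y\<bar> < e \<and> (final_strand v j y', y') \<in> gadget_points"
    using y'(2) by blast
qed

lemma tail_subset_closure: "graph tail {-1..0} \<subseteq> closure gadget_points"
proof (rule graph_subset_closure)
  show "continuous_on {-1..0} tail" using continuous_on_tail continuous_on_subset by blast
  fix y e :: real assume y: "y \<in> {-1..0}" and "e > 0"
  have s: "settled v 0 0" by (simp add: settled_def)
  have "0 \<le> - y" "- y \<le> 1" using y by auto
  from dense_on_final_strand[OF s this \<open>e > 0\<close>]
  obtain s' y' where y': "level s' y'" "\<bar>y' - (- y)\<bar> < e" by blast
  obtain m where m: "m < 2 ^ s'" "y' = dyadic s' m" using y'(1) by (auto simp: level_def dyadic_def)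
  have "(tail (- y'), - y') = gadget_point False s' m" using m by (simp add: gadget_point_def)
  then have "(tail (- y'), - y') \<in> gadget_points" using m(1) unfolding gadget_points_def by blast
  moreover have "- y' \<in> {-1..0}" using level_bounds[OF y'(1)] by simp
  moreover have "\<bar>- y' - y\<bar> < e" using y'(2) by linarith
  ultimately show "\<exists>y'\<in>{-1..0}. \<bar>y' - y\<bar> < e \<and> (tail y', y') \<in> gadget_points"
    by blast
qed

lemma gadget_arc_subset_closure:
  assumes s: "settled v t0 k"
  shows "gadget_arc k \<subseteq> closure gadget_points"
proof -
  have "graph (final_strand v j) {0..1} \<subseteq> closure gadget_points" if "j \<le> k" for j
    by (rule final_strand_subset_closure[OF settled_mono[OF s that order_refl]])
  then show ?thesis using tail_subset_closure unfolding gadget_arc_def by blast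
qed

lemma gadget_point_bounds:
  assumes "m < 2 ^ s"
  shows "\<bar>fst (gadget_point b s m)\<bar> \<le> 8" "\<bar>snd (gadget_point b s m)\<bar> < 1"
proof -
  note y = level_bounds[OF level_dyadic[OF assms]]
  show "\<bar>fst (gadget_point b s m)\<bar> \<le> 8"
    using strand_le_2[of "dyadic s m" v s "target s"] strand_nonneg[of "dyadic s m" v s "target s"]
      tail_bound y by (auto simp: gadget_point_def)
  show "\<bar>snd (gadget_point b s m)\<bar> < 1" using y by (simp add: gadget_point_def)
qed

lemma gadget_arc_bounds:
  assumes s: "settled v t0 k" and z: "z \<in> gadget_arc k"
  shows "\<bar>fst z\<bar> \<le> 8" "\<bar>snd z\<bar> \<le> 1" "snd z = -1 \<longrightarrow> z = (0, -1)"
proof -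
  have "\<bar>fst z\<bar> \<le> 8 \<and> \<bar>snd z\<bar> \<le> 1 \<and> (snd z = -1 \<longrightarrow> z = (0, -1))"
  proof (cases "z \<in> graph tail {-1..0}")
    case True
    then show ?thesis using tail_bound by (auto simp: graph_def tail_minus_1)
  next
    case False
    then obtain j y where j: "j \<le> k" "0 \<le> y" "y \<le> 1" "z = (final_strand v j y, y)"
      using z by (auto simp: gadget_arc_def graph_def)
    then show ?thesis
      using final_strand_bounds[OF j(2,3) settled_mono[OF s j(1) order_refl]] by auto
  qed
  then show "\<bar>fst z\<bar> \<le> 8" "\<bar>snd z\<bar> \<le> 1" "snd z = -1 \<longrightarrow> z = (0, -1)" by auto
qed

text \<open>Every drawn point of positive height lies on a final strand, hence left of strand
  \<open>j\<close> or right of the next one. Both regions are closed, and so is the half plane that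
  contains the tail, so limits of drawn points stay in the union.\<close>

lemma gap_between_strands:
  assumes s: "settled v t0 (Suc j)" and z: "z \<in> closure gadget_points" and y: "0 < snd z" "snd z < 1"
  shows "fst z \<le> final_strand v j (snd z) \<or> final_strand v (Suc j) (snd z) \<le> fst z"
proof -
  have sj: "settled v t0 j" using settled_mono[OF s] by simp
  define A where "A = {z. snd z \<in> {0..1} \<and> fst z \<le> final_strand v j (snd z)}"
  define B where "B = {z. snd z \<in> {0..1} \<and> final_strand v (Suc j) (snd z) \<le> fst z}"
  have closed: "closed {z \<in> UNIV \<times> {0..1}. f z \<le> g z}"
    if "continuous_on (UNIV \<times> {0..1}) f" "continuous_on (UNIV \<times> {0..1}) g" for f g :: "real \<times> real \<Rightarrow> real"
    using that by (intro continuous_on_closed_Collect_le closed_Times) auto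
  have cont: "continuous_on (UNIV \<times> {0..1}) (\<lambda>z::real \<times> real. final_strand v i (snd z))"
    if "settled v t0 i" for i
    by (rule continuous_on_compose2[OF continuous_on_final_strand[OF that]]) (auto intro!: continuous_intros)
  have "A = {z \<in> UNIV \<times> {0..1}. fst z \<le> final_strand v j (snd z)}" by (auto simp: A_def)
  then have A: "closed A" using closed[OF _ cont[OF sj]] by (simp add: continuous_intros)
  have "B = {z \<in> UNIV \<times> {0..1}. final_strand v (Suc j) (snd z) \<le> fst z}" by (auto simp: B_def)
  then have B: "closed B" using closed[OF cont[OF s]] by (simp add: continuous_intros)
  have C: "closed {z::real \<times> real. snd z \<le> 0}" by (intro closed_Collect_le continuous_intros)
  have "gadget_points \<subseteq> A \<union> B \<union> {z. snd z \<le> 0}"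
  proof
    fix z assume "z \<in> gadget_points"
    then obtain b s m where m: "m < 2 ^ s" and z: "z = gadget_point b s m" by (auto simp: gadget_points_def)
    have lev: "level s (dyadic s m)" using m by (rule level_dyadic)
    have y: "0 \<le> dyadic s m" "dyadic s m \<le> 1" using level_bounds[OF lev] by auto
    show "z \<in> A \<union> B \<union> {z. snd z \<le> 0}"
    proof (cases b)
      case True
      obtain i where i: "settled v s i" "final_strand v i (dyadic s m) = strand v s (target s) (dyadic s m)"
        by (rule point_on_final_strand[OF lev])
      have z': "z = (final_strand v i (dyadic s m), dyadic s m)" using True i(2) z by (simp add: gadget_point_def)
      show ?thesis
      proof (cases "i \<le> j")
        case True
        then have "z \<in> A" using final_strand_mono[OF y sj True] y z' by (simp add: A_def)
        then show ?thesis by simp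
      next
        case False
        then have "z \<in> B" using final_strand_mono[OF y i(1), of "Suc j"] y z' by (simp add: B_def)
        then show ?thesis by simp
      qed
    next
      case False
      then show ?thesis using y z by (simp add: gadget_point_def)
    qed
  qed
  then have "closure gadget_points \<subseteq> A \<union> B \<union> {z. snd z \<le> 0}"
    by (rule closure_minimal) (use A B C in auto)
  then show ?thesis using z y by (auto simp: A_def B_def)
qed

end

lemma strands_cong:
  "(\<And>i. i < s \<Longrightarrow> v i = v' i) \<Longrightarrow> strands v s = strands v' s"
proof (induction s)
  case (Suc s)
  then have "strands v s = strands v' s" "v s = v' s" by auto
  then show ?case by (simp only: strands.simps)
qed simp

text \<open>A strand point of level \<open>s\<close> is drawn before the visit of stage
  \<open>s\<close>. A tail point of this level has height at most \<open>- ((1/2) ^ Suc s)\<close>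
  and depends on the anchors up to \<open>Suc s\<close>, hence on the visits up to stage
  \<open>s\<close>.\<close>

lemma gadget_point_cong:
  assumes m: "m < 2 ^ s" and eq: "\<And>i. i < Suc s \<Longrightarrow> v i = v' i"
  shows "gadget_point v b s m = gadget_point v' b s m"
proof -
  have a: "anchor v n = anchor v' n" if "n \<le> Suc s" for n
  proof (cases n)
    case (Suc l)
    have "strands v n = strands v' n" by (rule strands_cong) (use that eq in simp)
    moreover have "v l = v' l" using that eq Suc by simp
    ultimately show ?thesis using Suc by (simp add: strand_def del: strands.simps)
  qed simp
  have "(1/2) ^ Suc s \<le> dyadic s m" by (simp add: dyadic_def power_divide divide_right_mono)
  then have t: "tail w (- dyadic s m) = (\<Sum>i<Suc s. (anchor w (Suc i) - anchor w i) * ramp i (- dyadic s m))" for w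
    by (intro tail_eq_sum) simp
  have "tail v (- dyadic s m) = tail v' (- dyadic s m)"
    unfolding t by (intro sum.cong refl) (use a in \<open>simp del: anchor.simps\<close>)
  moreover have "strands v s = strands v' s" by (rule strands_cong) (use eq in simp)
  ultimately show ?thesis by (simp add: gadget_point_def strand_def)
qed

section \<open>Concatenation of arcs\<close>

lemma homeomorphic_interval_small_connected:
  fixes S :: "'a::metric_space set"
  assumes S: "S homeomorphic {0..1::real}" and e: "r > 0"
  obtains \<delta> where "\<delta> > 0" "\<And>x y. x \<in> S \<Longrightarrow> y \<in> S \<Longrightarrow> dist x y < \<delta> \<Longrightarrow>
    \<exists>C. connected C \<and> C \<subseteq> S \<and> C \<subseteq> ball x r \<and> x \<in> C \<and> y \<in> C"
proof -
  obtain g h where gh: "homeomorphism S {0..1::real} g h"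
    using S unfolding homeomorphic_def by blast
  have cS: "compact S" using S homeomorphic_compactness compact_Icc by blast
  have "uniformly_continuous_on {0..1} h" "uniformly_continuous_on S g"
    using gh cS by (auto intro!: compact_uniformly_continuous simp: homeomorphism_def)
  then obtain d1 d where d1: "d1 > 0" "\<And>s t. s \<in> {0..1} \<Longrightarrow> t \<in> {0..1} \<Longrightarrow> dist s t < d1 \<Longrightarrow> dist (h s) (h t) < r"
    and d: "d > 0" "\<And>x y. x \<in> S \<Longrightarrow> y \<in> S \<Longrightarrow> dist x y < d \<Longrightarrow> dist (g x) (g y) < d1"
    unfolding uniformly_continuous_on_def using e by metis
  show ?thesis
  proof (rule that[OF d(1)])
    fix x y assume xy: "x \<in> S" "y \<in> S" "dist x y < d"
    define C where "C = h ` closed_segment (g x) (g y)"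
    have g: "g x \<in> {0..1}" "g y \<in> {0..1}" using gh xy unfolding homeomorphism_def by blast+
    then have sub: "closed_segment (g x) (g y) \<subseteq> {0..1}"
      by (auto simp: closed_segment_eq_real_ivl split: if_splits)
    have "continuous_on (closed_segment (g x) (g y)) h"
      using gh sub unfolding homeomorphism_def by (metis continuous_on_subset)
    then have "connected C" unfolding C_def by (intro connected_continuous_image) auto
    moreover have "C \<subseteq> S" using gh sub unfolding C_def homeomorphism_def by blast
    moreover have "C \<subseteq> ball x r"
    proof
      fix w assume "w \<in> C"
      then obtain t where t: "t \<in> closed_segment (g x) (g y)" "w = h t" by (auto simp: C_def)
      have "dist (g x) t < d1" using d(2)[OF xy] t(1)
        by (auto simp: closed_segment_eq_real_ivl dist_real_def split: if_splits)
      then have "dist (h (g x)) (h t) < r" using d1(2) g(1) sub t(1) by blast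
      then show "w \<in> ball x r" using gh xy t(2) by (simp add: homeomorphism_def)
    qed
    moreover have "x \<in> C" "y \<in> C" unfolding C_def using gh xy
      by (metis ends_in_segment homeomorphism_apply1 image_eqI)+
    ultimately show "\<exists>C. connected C \<and> C \<subseteq> S \<and> C \<subseteq> ball x r \<and> x \<in> C \<and> y \<in> C" by blast
  qed
qed

lemma half_power_gap: "i < j \<Longrightarrow> 2 * (1/2::real) ^ j \<le> (1/2) ^ i"
proof -
  assume "i < j"
  then have "(1/2::real) ^ j \<le> (1/2) ^ Suc i" by (intro power_decreasing) auto
  then show ?thesis by simp
qed

text \<open>The closure adds the single point \<open>(0, 0)\<close>. Uniqueness is demanded at the
  lower end of an arc because a gadget may have several corners at its top height, whereas two
  consecutive arcs can only meet at the bottom of the upper one.\<close>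

lemma concatenated_arcs_homeomorphic:
  fixes c :: "nat \<Rightarrow> real \<Rightarrow> real \<times> real"
  assumes arc: "\<And>i. arc (c i)"
    and start: "\<And>i. pathstart (c i) = (0, 4 * (1/2) ^ i)"
    and finish: "\<And>i. pathfinish (c i) = (0, 2 * (1/2) ^ i)"
    and bound: "\<And>i z. z \<in> path_image (c i) \<Longrightarrow> \<bar>fst z\<bar> \<le> 8 * (1/2) ^ i \<and> 2 * (1/2) ^ i \<le> snd z \<and> snd z \<le> 4 * (1/2) ^ i"
    and lower: "\<And>i z. z \<in> path_image (c i) \<Longrightarrow> snd z = 2 * (1/2) ^ i \<Longrightarrow> z = (0, 2 * (1/2) ^ i)"
    and Q: "Q \<subseteq> (\<Union>i. path_image (c i))" "(\<Union>i. path_image (c i)) \<subseteq> closure Q"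
  shows "closure Q homeomorphic {0..1::real}"
proof -
  have small: "\<exists>N. 4 * (1/2::real) ^ N < x" if x: "x > 0" for x
  proof -
    obtain n where "(1/2) ^ n < x / 4" using real_arch_pow_inv[of "x / 4" "1/2"] x by auto
    then show ?thesis by (intro exI[of _ n]) simp
  qed
  have closure_eq: "closure Q = insert (0, 0) (\<Union>i. path_image (c i))" (is "_ = ?S")
  proof
    have "(\<lambda>i. (0, 2 * (1/2) ^ i) :: real \<times> real) \<longlonglongrightarrow> (0, 2 * 0)"
      by (intro tendsto_intros LIMSEQ_power_zero) auto
    moreover have "(0, 2 * (1/2) ^ i) \<in> closure Q" for i
      using Q(2) finish[of i] pathfinish_in_path_image[of "c i"] by auto
    ultimately have "(0, 2 * 0) \<in> closure Q"
      using closed_sequentially[OF closed_closure, of "\<lambda>i. (0, 2 * (1/2) ^ i) :: real \<times> real"] by simp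
    then show "?S \<subseteq> closure Q" using Q(2) by simp
    show "closure Q \<subseteq> ?S"
    proof
      fix z assume z: "z \<in> closure Q"
      \<comment> \<open>The bounds on width and height confine all arcs to a cone with apex
        \<open>(0, 0)\<close>. Above any positive height only finitely many arcs matter, and their
        union is closed.\<close>
      have "Q \<subseteq> {z. \<bar>fst z\<bar> \<le> 4 * snd z}" using Q(1) bound by fastforce
      then have "closure Q \<subseteq> {z. \<bar>fst z\<bar> \<le> 4 * snd z}"
        by (rule closure_minimal) (intro closed_Collect_le continuous_intros)
      then have zb: "\<bar>fst z\<bar> \<le> 4 * snd z" using z by blast
      show "z \<in> ?S"
      proof (cases "snd z \<le> 0")
        case True
        then have "z = (0, 0)" using zb by (cases z) auto
        then show ?thesis by simp
      next
        case False
        then obtain N where N: "4 * (1/2) ^ N < snd z" using small[of "snd z"] by auto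
        have "Q \<subseteq> (\<Union>i<N. path_image (c i)) \<union> {z. snd z \<le> 4 * (1/2) ^ N}"
        proof
          fix q assume "q \<in> Q"
          then obtain i where i: "q \<in> path_image (c i)" using Q(1) by blast
          show "q \<in> (\<Union>i<N. path_image (c i)) \<union> {z. snd z \<le> 4 * (1/2) ^ N}"
          proof (cases "i < N")
            case False
            then have "(1/2::real) ^ i \<le> (1/2) ^ N" by (intro power_decreasing) auto
            then have "snd q \<le> 4 * (1/2) ^ N" using bound[OF i] by linarith
            then show ?thesis by simp
          qed (use i in blast)
        qed
        then have "closure Q \<subseteq> (\<Union>i<N. path_image (c i)) \<union> {z. snd z \<le> 4 * (1/2) ^ N}"
          by (rule closure_minimal)
            (intro closed_Un closed_UN finite_lessThan ballI closed_arc_image arc closed_Collect_le continuous_intros)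
        then show ?thesis using z N by auto
      qed
    qed
  qed
  have "\<exists>h. homeomorphism {0..1} (path_image (c i)) (c i) h" for i
    using homeomorphism_arc[OF arc] by metis
  then obtain h where h: "\<And>i. homeomorphism {0..1} (path_image (c i)) (c i) (h i)" by metis
  have h01: "0 \<le> h i z" "h i z \<le> 1" "c i (h i z) = z" if "z \<in> path_image (c i)" for i z
    using h[of i] that unfolding homeomorphism_def by auto
  have h_start: "h i (0, 4 * (1/2) ^ i) = 0" for i
    using h[of i] start[of i] unfolding homeomorphism_def pathstart_def by (metis atLeastAtMost_iff order_refl zero_le_one)
  have h_finish: "h i (0, 2 * (1/2) ^ i) = 1" for i
    using h[of i] finish[of i] unfolding homeomorphism_def pathfinish_def by (metis atLeastAtMost_iff order_refl zero_le_one)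
  \<comment> \<open>Arc \<open>i\<close> is stretched over the interval from
    \<open>(1/2) ^ i\<close> to \<open>2 * (1/2) ^ i\<close>, its start going to the upper end. The
    choice of \<open>i\<close> is immaterial, because a point common to two arcs is the end of one
    and the start of the next.\<close>
  define F where "F z = (if z = (0, 0) then 0 else
    let i = (SOME i. z \<in> path_image (c i)) in (1/2) ^ i * (2 - h i z))" for z
  have nz: "z \<noteq> (0, 0)" if "z \<in> path_image (c i)" for z i
  proof -
    have "0 < 2 * (1/2::real) ^ i" by simp
    then have "0 < snd z" using bound[OF that] by linarith
    then show ?thesis by auto
  qed
  have overlap: "j = Suc i \<and> z = (0, 2 * (1/2) ^ i)"
    if "z \<in> path_image (c i)" "z \<in> path_image (c j)" "i < j" for i j z
  proof -
    have le: "4 * (1/2::real) ^ j \<le> 2 * (1/2) ^ i" using half_power_gap[OF that(3)] by simp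
    then have s: "snd z = 2 * (1/2) ^ i" "4 * (1/2::real) ^ j = 2 * (1/2) ^ i"
      using bound[OF that(1)] bound[OF that(2)] by linarith+
    have "j = Suc i"
    proof (rule ccontr)
      assume "j \<noteq> Suc i"
      then have "Suc i < j" using that(3) by simp
      from half_power_gap[OF this] have "4 * (1/2::real) ^ j \<le> (1/2) ^ i" by simp
      moreover have "0 < (1/2::real) ^ i" by simp
      ultimately show False using s(2) by linarith
    qed
    then show ?thesis using lower[OF that(1) s(1)] by simp
  qed
  have F: "F z = (1/2) ^ i * (2 - h i z)" if z: "z \<in> path_image (c i)" for z i
  proof -
    have agree: "(1/2) ^ i * (2 - h i z) = (1/2) ^ j * (2 - h j z)"
      if "z \<in> path_image (c i)" "z \<in> path_image (c j)" "i < j" for i j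
    proof -
      have o: "j = Suc i" "z = (0, 2 * (1/2) ^ i)" using overlap[OF that] by auto
      have "h i z = 1" using o h_finish by simp
      moreover have "z = (0, 4 * (1/2) ^ j)" using o by simp
      then have "h j z = 0" using h_start by simp
      ultimately show ?thesis using o(1) by simp
    qed
    define j where "j = (SOME i. z \<in> path_image (c i))"
    have j: "z \<in> path_image (c j)" unfolding j_def using z by (rule someI)
    have "F z = (1/2) ^ j * (2 - h j z)" using nz[OF z] by (simp add: F_def j_def Let_def)
    also have "\<dots> = (1/2) ^ i * (2 - h i z)"
    proof (cases i j rule: linorder_cases)
      case less
      then show ?thesis using agree[OF z j] by metis
    next
      case greater
      then show ?thesis using agree[OF j z] by metis
    qed simp
    finally show ?thesis .
  qed
  have F_bounds: "(1/2) ^ i \<le> F z" "F z \<le> 2 * (1/2) ^ i" if z: "z \<in> path_image (c i)" for z i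
  proof -
    have "(1/2) ^ i * 1 \<le> (1/2) ^ i * (2 - h i z)" "(1/2) ^ i * (2 - h i z) \<le> (1/2) ^ i * 2"
      using h01[OF z] by (intro mult_left_mono; simp)+
    then show "(1/2) ^ i \<le> F z" "F z \<le> 2 * (1/2) ^ i" using F[OF z] by simp_all
  qed
  have F0: "F (0, 0) = 0" by (simp add: F_def)
  have contF: "continuous_on (path_image (c i)) F" for i
  proof -
    have "continuous_on (path_image (c i)) (\<lambda>z. (1/2) ^ i * (2 - h i z))"
      using h[of i] unfolding homeomorphism_def by (intro continuous_intros) blast
    then show ?thesis using F continuous_on_cong by (metis (no_types, lifting))
  qed
  have contF_fin: "continuous_on (\<Union>i\<in>{..<N}. path_image (c i)) F" for N
    by (intro continuous_on_closed_Union finite_lessThan closed_arc_image arc contF)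
  have cont: "continuous_on ?S F"
    unfolding continuous_on_iff
  proof (intro ballI allI impI)
    fix z0 and e :: real assume z0: "z0 \<in> ?S" and e: "e > 0"
    show "\<exists>d>0. \<forall>z\<in>?S. dist z z0 < d \<longrightarrow> dist (F z) (F z0) < e"
    proof (cases "z0 = (0, 0)")
      case True
      have "dist (F z) (F z0) < e" if z: "z \<in> ?S" "dist z z0 < e" for z
      proof (cases "z = (0, 0)")
        case False
        then obtain i where i: "z \<in> path_image (c i)" using z(1) by blast
        have "0 < (1/2::real) ^ i" by simp
        then have "0 < F z" "F z \<le> snd z" using F_bounds[OF i] bound[OF i] by linarith+
        moreover have "\<bar>snd z\<bar> \<le> dist z z0"
          using dist_snd_le[of z z0] True by (simp add: dist_real_def)
        ultimately show ?thesis using z(2) True F0 by (simp add: dist_real_def)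
      qed (use True e in simp)
      then show ?thesis using e by blast
    next
      case False
      then obtain i where i: "z0 \<in> path_image (c i)" using z0 by blast
      have "0 < 2 * (1/2::real) ^ i" by simp
      then have "0 < snd z0" using bound[OF i] by linarith
      then obtain N where N: "4 * (1/2) ^ N < snd z0" using small by blast
      have inT: "z \<in> (\<Union>i\<in>{..<N}. path_image (c i))" if z: "z \<in> ?S" "4 * (1/2) ^ N < snd z" for z
      proof -
        have "0 < 4 * (1/2::real) ^ N" by simp
        then obtain j where j: "z \<in> path_image (c j)" using z by auto
        have "j < N"
        proof (rule ccontr)
          assume "\<not> j < N"
          then have "(1/2::real) ^ j \<le> (1/2) ^ N" by (intro power_decreasing) auto
          then show False using bound[OF j] z(2) by linarith
        qed
        then show ?thesis using j by blast
      qed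
      obtain d where d: "d > 0" "\<And>z. z \<in> (\<Union>i\<in>{..<N}. path_image (c i)) \<Longrightarrow> dist z z0 < d \<Longrightarrow> dist (F z) (F z0) < e"
        using contF_fin[of N] inT[OF z0 N] e unfolding continuous_on_iff by metis
      have "dist (F z) (F z0) < e" if z: "z \<in> ?S" "dist z z0 < min d (snd z0 - 4 * (1/2) ^ N)" for z
      proof -
        have "\<bar>snd z - snd z0\<bar> < snd z0 - 4 * (1/2) ^ N"
          using dist_snd_le[of z z0] z(2) by (simp add: dist_real_def)
        then have "4 * (1/2) ^ N < snd z" by linarith
        then show ?thesis using d(2)[OF inT[OF z(1)]] z(2) by simp
      qed
      moreover have "min d (snd z0 - 4 * (1/2) ^ N) > 0" using d(1) N by simp
      ultimately show ?thesis by blast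
    qed
  qed
  have "inj_on F ?S"
  proof -
    have diff: "z = z'" if "z \<in> path_image (c i)" "z' \<in> path_image (c j)" "F z = F z'" "i < j" for z z' i j
    proof -
      have le: "2 * (1/2::real) ^ j \<le> (1/2) ^ i" using half_power_gap[OF that(4)] .
      then have eq: "F z = (1/2) ^ i" "F z' = 2 * (1/2) ^ j" "2 * (1/2::real) ^ j = (1/2) ^ i"
        using F_bounds[OF that(1)] F_bounds[OF that(2)] that(3) by linarith+
      have "h i z = 1" "h j z' = 0" using eq(1,2) F[OF that(1)] F[OF that(2)] by auto
      then have "z = pathfinish (c i)" "z' = pathstart (c j)"
        using h01(3)[OF that(1)] h01(3)[OF that(2)] by (simp_all add: pathstart_def pathfinish_def)
      then show ?thesis using start finish eq(3) by simp
    qed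
    show ?thesis
    proof (rule inj_onI)
      fix z z' assume z: "z \<in> ?S" "z' \<in> ?S" "F z = F z'"
      have pos: "F w > 0" if "w \<in> path_image (c i)" for w i
      proof -
        have "0 < (1/2::real) ^ i" by simp
        then show ?thesis using F_bounds[OF that] by linarith
      qed
      show "z = z'"
      proof (cases "z = (0, 0) \<or> z' = (0, 0)")
        case True
        then show ?thesis using z pos F0 by (metis UN_E insertE less_irrefl)
      next
        case False
        then obtain i j where ij: "z \<in> path_image (c i)" "z' \<in> path_image (c j)" using z by blast
        show ?thesis
        proof (cases i j rule: linorder_cases)
          case less
          then show ?thesis using diff ij z(3) by blast
        next
          case equal
          have "h i z = h i z'" using F[OF ij(1)] F[of z' i] ij equal z(3) by simp
          then show ?thesis using h01(3)[OF ij(1)] h01(3)[of z' i] ij equal by metis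
        next
          case greater
          then show ?thesis using diff[OF ij(2,1)] z(3) by simp
        qed
      qed
    qed
  qed
  moreover have "F ` ?S = {0..2}"
  proof (intro equalityI subsetI)
    fix x assume "x \<in> F ` ?S"
    then obtain z where z: "z \<in> ?S" "x = F z" by blast
    show "x \<in> {0..2}"
    proof (cases "z = (0, 0)")
      case False
      then obtain i where i: "z \<in> path_image (c i)" using z(1) by blast
      have "0 \<le> (1/2::real) ^ i" "(1/2::real) ^ i \<le> 1" by (simp_all add: power_le_one)
      then show ?thesis using F_bounds[OF i] z(2) by auto
    qed (use z F0 in simp)
  next
    fix x :: real assume x: "x \<in> {0..2}"
    show "x \<in> F ` ?S"
    proof (cases "x = 0")
      case True
      then show ?thesis using F0 by (metis image_eqI insertI1)
    next
      case False
      then have "x > 0" using x by simp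
      then have ex: "\<exists>n. (1/2) ^ n \<le> x" using real_arch_pow_inv[of x "1/2"] by (auto intro: less_imp_le)
      define i where "i = (LEAST n. (1/2) ^ n \<le> x)"
      have i1: "(1/2) ^ i \<le> x" unfolding i_def using ex by (rule LeastI_ex)
      have i2: "x \<le> 2 * (1/2) ^ i"
      proof (cases i)
        case 0
        then show ?thesis using x by simp
      next
        case (Suc n)
        then have "\<not> (1/2) ^ n \<le> x" unfolding i_def by (metis lessI not_less_Least)
        then show ?thesis using Suc by simp
      qed
      define t where "t = 2 - x * 2 ^ i"
      have xi: "x = (1/2) ^ i * (2 - t)" by (simp add: t_def power_one_over)
      have "1 \<le> x * 2 ^ i" "x * 2 ^ i \<le> 2" using i1 i2 by (simp_all add: field_simps power_one_over)
      then have t: "t \<in> {0..1}" by (simp add: t_def)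
      have "c i t \<in> path_image (c i)" "h i (c i t) = t"
        using h[of i] t unfolding homeomorphism_def by auto
      then have "F (c i t) = x" "c i t \<in> ?S" using F xi by auto
      then show ?thesis by blast
    qed
  qed
  moreover have "compact ?S"
  proof -
    have "?S \<subseteq> {-8..8} \<times> {0..4}"
    proof
      fix z assume "z \<in> ?S"
      then consider "z = (0, 0)" | i where "z \<in> path_image (c i)" by blast
      then show "z \<in> {-8..8} \<times> {0..4}"
      proof cases
        case 2
        have "0 \<le> (1/2::real) ^ i" "(1/2::real) ^ i \<le> 1" by (simp_all add: power_le_one)
        then have "\<bar>fst z\<bar> \<le> 8" "0 \<le> snd z" "snd z \<le> 4" using bound[OF 2] by linarith+
        then show ?thesis by (cases z) auto
      qed simp
    qed
    moreover have "compact ({-8..8::real} \<times> {0..4::real})" by (intro compact_Times compact_Icc)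
    ultimately show ?thesis unfolding closure_eq[symmetric]
      by (metis closed_Int_compact closed_closure inf.absorb1)
  qed
  ultimately have "?S homeomorphic {0..2::real}"
    using homeomorphic_compact[of ?S F "{0..2}"] cont by blast
  moreover have "{0..2::real} homeomorphic {0..1::real}"
    by (rule homeomorphic_closed_intervals_real) auto
  ultimately show ?thesis unfolding closure_eq using homeomorphic_trans by metis
qed

section \<open>Placing the gadgets and naming their points\<close>

text \<open>The shift by 3 turns the height range from -1 to 1 into the range from 2 to 4, so that
  after scaling by \<open>(1/2) ^ i\<close> the bottom of each gadget is the top of the next and the
  gadgets shrink to the origin.\<close>

definition place :: "nat \<Rightarrow> real \<times> real \<Rightarrow> real \<times> real" where
  "place i z = ((1/2) ^ i * fst z, (1/2) ^ i * (snd z + 3))"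

definition unplace :: "nat \<Rightarrow> real \<times> real \<Rightarrow> real \<times> real" where
  "unplace i z = (2 ^ i * fst z, 2 ^ i * snd z - 3)"

lemma unplace_place [simp]: "unplace i (place i z) = z"
  by (simp add: place_def unplace_def power_one_over)

lemma continuous_on_place: "continuous_on A (place i)"
  unfolding place_def by (intro continuous_intros)

lemma continuous_on_unplace: "continuous_on A (unplace i)"
  unfolding unplace_def by (intro continuous_intros)

lemma inj_place: "inj (place i)"
  by (metis injI unplace_place)

text \<open>A code \<open>(i, b, s, m)\<close> names the point of gadget \<open>i\<close> at height \<open>dyadic s m\<close> on a strand, or at
  height \<open>- dyadic s m\<close> on the tail; the heights alone already separate the codes.\<close>

definition codes :: "(nat \<times> bool \<times> nat \<times> nat) set" where
  "codes = {(i, b, s, m). m < 2 ^ s}"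

definition config :: "(nat \<Rightarrow> nat \<Rightarrow> nat) \<Rightarrow> nat \<times> bool \<times> nat \<times> nat \<Rightarrow> real \<times> real" where
  "config f = (\<lambda>(i, b, s, m). place i (gadget_point (\<lambda>t. 2 * f i t) b s m))"

lemma config_image: "config f ` codes = (\<Union>i. place i ` gadget_points (\<lambda>t. 2 * f i t))"
proof (intro equalityI subsetI)
  fix z assume "z \<in> config f ` codes"
  then obtain i b s m where "m < 2 ^ s" "z = place i (gadget_point (\<lambda>t. 2 * f i t) b s m)"
    by (auto simp: config_def codes_def)
  then show "z \<in> (\<Union>i. place i ` gadget_points (\<lambda>t. 2 * f i t))"
    unfolding gadget_points_def by blast
next
  fix z assume "z \<in> (\<Union>i. place i ` gadget_points (\<lambda>t. 2 * f i t))"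
  then obtain i b s m where "m < 2 ^ s" "z = place i (gadget_point (\<lambda>t. 2 * f i t) b s m)"
    unfolding gadget_points_def by blast
  then show "z \<in> config f ` codes"
    by (intro image_eqI[of _ _ "(i, b, s, m)"]) (auto simp: config_def codes_def)
qed

lemma infinite_codes: "infinite codes"
proof
  assume "finite codes"
  moreover have "(\<lambda>i. (i, True, 0, 0)) ` (UNIV :: nat set) \<subseteq> codes" by (auto simp: codes_def)
  ultimately have "finite ((\<lambda>i::nat. (i, True, 0::nat, 0::nat)) ` UNIV)" by (rule finite_subset[rotated])
  then show False by (subst (asm) finite_image_iff) (auto simp: inj_on_def)
qed

text \<open>Waves separate the levels: the wave of the higher level is 1 at its own points and 0 at
  those of the lower level.\<close>

lemma dyadic_inject:
  assumes "m < 2 ^ s" "m' < 2 ^ s'" "dyadic s m = dyadic s' m'"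
  shows "s = s' \<and> m = m'"
proof -
  have l: "level s (dyadic s m)" "level s' (dyadic s m)"
    using assms level_dyadic by metis+
  then have "s = s'"
    using wave_level wave_above_level by (metis linorder_neqE_nat zero_neq_one)
  then show ?thesis using assms(3) by (simp add: dyadic_def)
qed

lemma half_power_ratio:
  assumes "(1/2::real) ^ i * x = (1/2) ^ j * y" "2 < x" "x < 4" "2 < y" "y < 4"
  shows "i = j"
proof -
  have False if "(1/2::real) ^ i * x = (1/2) ^ j * y" "2 < x" "y < 4" "i < j" for i j x y
  proof -
    have "(1/2::real) ^ j * y < (1/2) ^ j * 4" using that by (intro mult_strict_left_mono) auto
    also have "\<dots> \<le> (1/2) ^ i * 2" using half_power_gap[OF that(4)] by simp
    also have "\<dots> < (1/2) ^ i * x" using that by (intro mult_strict_left_mono) auto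
    finally show False using that(1) by simp
  qed
  then show ?thesis using assms by (metis linorder_neqE_nat)
qed

text \<open>The metric of the presentation lives on the numbered codes themselves, so different
  codes must name different points.\<close>

lemma inj_on_config: "inj_on (config f) codes"
proof (rule inj_onI)
  fix c c' assume c: "c \<in> codes" "c' \<in> codes" "config f c = config f c'"
  obtain i b s m where c1: "c = (i, b, s, m)" "m < 2 ^ s" using c(1) by (auto simp: codes_def)
  obtain i' b' s' m' where c2: "c' = (i', b', s', m')" "m' < 2 ^ s'" using c(2) by (auto simp: codes_def)
  define y where "y = snd (gadget_point (\<lambda>t. 2 * f i t) b s m)"
  define y' where "y' = snd (gadget_point (\<lambda>t. 2 * f i' t) b' s' m')"
  have eq: "(1/2::real) ^ i * (y + 3) = (1/2) ^ i' * (y' + 3)"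
    using c(3) by (simp add: c1 c2 config_def place_def y_def y'_def)
  have y: "\<bar>y\<bar> < 1" "\<bar>y'\<bar> < 1" unfolding y_def y'_def by (intro gadget_point_bounds c1 c2)+
  have i: "i = i'" by (rule half_power_ratio[OF eq]) (use y in auto)
  then have yy: "y = y'" using eq by simp
  have d: "0 < dyadic s m" "0 < dyadic s' m'"
    using level_bounds(1)[OF level_dyadic] c1(2) c2(2) by blast+
  have "b = b' \<and> dyadic s m = dyadic s' m'"
    using yy d by (auto simp: y_def y'_def gadget_point_def split: if_splits)
  then show "c = c'" using dyadic_inject[OF c1(2) c2(2)] c1(1) c2(1) i by simp
qed

lemma settled_if_finite:
  assumes "\<And>j. j < k \<Longrightarrow> finite {t. v t = j}"
  shows "\<exists>t0. settled v t0 k"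
proof -
  have "{t. v t < k} = (\<Union>j<k. {t. v t = j})" by auto
  then have "finite {t. v t < k}" using assms by simp
  then obtain N where "\<And>t. v t < k \<Longrightarrow> t < N" using finite_nat_set_iff_bounded by auto
  then show ?thesis unfolding settled_def by (intro exI[of _ N]) (meson not_le)
qed

lemma finite_doubled:
  assumes "\<And>i. i < j \<Longrightarrow> finite {t. f t = i}" and "l < 2 * (j::nat)"
  shows "finite {t. 2 * f t = l}"
proof (cases "even l")
  case True
  then obtain i where "l = 2 * i" by blast
  then show ?thesis using assms by simp
next
  case False
  then have "{t. 2 * f t = l} = {}" by auto
  then show ?thesis by (metis finite.emptyI)
qed

theorem config_homeomorphic:
  assumes "\<And>i. \<exists>j. infinite {t. f i t = j}"
  shows "closure (config f ` codes) homeomorphic {0..1::real}"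
proof -
  define j where "j i = (LEAST j. infinite {t. f i t = j})" for i
  have inf: "infinite {t. f i t = j i}" for i unfolding j_def using assms by (rule LeastI_ex)
  have fin: "finite {t. f i t = l}" if "l < j i" for i l using not_less_Least[OF that[unfolded j_def]] by simp
  define v where "v i = (\<lambda>t. 2 * f i t)" for i
  have inf': "infinite {t. v i t = 2 * j i}" for i using inf by (simp add: v_def)
  have "\<exists>t0. settled (v i) t0 (2 * j i)" for i
    unfolding v_def by (intro settled_if_finite finite_doubled fin)
  then obtain t0 where t0: "\<And>i. settled (v i) (t0 i) (2 * j i)" by metis
  have "\<exists>g. arc g \<and> path_image g = gadget_arc (v i) (2 * j i) \<and> pathstart g = (0, 1) \<and> pathfinish g = (0, -1)" for i
    using arc_gadget[OF t0 inf'] by (metis dvd_triv_left)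
  then obtain g where g: "\<And>i. arc (g i)" "\<And>i. path_image (g i) = gadget_arc (v i) (2 * j i)"
    "\<And>i. pathstart (g i) = (0, 1)" "\<And>i. pathfinish (g i) = (0, -1)" by metis
  define c where "c i = place i \<circ> g i" for i
  have img: "path_image (c i) = place i ` gadget_arc (v i) (2 * j i)" for i
    by (simp add: c_def path_image_compose g)
  have "closure (\<Union>i. place i ` gadget_points (v i)) homeomorphic {0..1::real}"
  proof (rule concatenated_arcs_homeomorphic)
    show "arc (c i)" for i
    proof -
      have "path (c i)" unfolding c_def
        by (rule path_continuous_image[OF arc_imp_path[OF g(1)] continuous_on_place])
      moreover have "inj_on (c i) {0..1}"
        unfolding c_def using g(1)[of i] inj_place by (auto simp: arc_def intro!: comp_inj_on intro: inj_on_subset)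
      ultimately show ?thesis by (simp add: arc_def)
    qed
    show "pathstart (c i) = (0, 4 * (1/2) ^ i)" for i
      by (simp add: c_def pathstart_compose g place_def)
    show "pathfinish (c i) = (0, 2 * (1/2) ^ i)" for i
      by (simp add: c_def pathfinish_compose g place_def)
    show "\<bar>fst z\<bar> \<le> 8 * (1/2) ^ i \<and> 2 * (1/2) ^ i \<le> snd z \<and> snd z \<le> 4 * (1/2) ^ i"
      if z: "z \<in> path_image (c i)" for i z
    proof -
      obtain w where w: "w \<in> gadget_arc (v i) (2 * j i)" "z = place i w" using z unfolding img by blast
      note b = gadget_arc_bounds[OF t0 w(1)]
      have "(1/2) ^ i * \<bar>fst w\<bar> \<le> (1/2) ^ i * 8" "(1/2) ^ i * 2 \<le> (1/2) ^ i * (snd w + 3)"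
        "(1/2) ^ i * (snd w + 3) \<le> (1/2) ^ i * 4"
        by (intro mult_left_mono; use b in simp)+
      then show ?thesis by (simp add: w(2) place_def abs_mult mult.commute)
    qed
    show "z = (0, 2 * (1/2) ^ i)" if z: "z \<in> path_image (c i)" "snd z = 2 * (1/2) ^ i" for i z
    proof -
      obtain w where w: "w \<in> gadget_arc (v i) (2 * j i)" "z = place i w" using z unfolding img by blast
      have "(1/2) ^ i * (snd w + 3) = (1/2::real) ^ i * 2" using z(2) by (simp add: w(2) place_def)
      then have "snd w = -1" by simp
      then have "w = (0, -1)" using gadget_arc_bounds(3)[OF t0 w(1)] by simp
      then show ?thesis by (simp add: w(2) place_def)
    qed
    have "gadget_points (v i) \<subseteq> gadget_arc (v i) (2 * j i)" for i
      by (rule gadget_points_subset[OF inf'])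
    then show "(\<Union>i. place i ` gadget_points (v i)) \<subseteq> (\<Union>i. path_image (c i))"
      unfolding img by blast
    have "place i ` gadget_arc (v i) (2 * j i) \<subseteq> closure (\<Union>i. place i ` gadget_points (v i))" for i
    proof -
      have "place i ` closure (gadget_points (v i)) \<subseteq> closure (\<Union>i. place i ` gadget_points (v i))"
        by (rule image_closure_subset[OF continuous_on_place closed_closure],
            rule subset_trans[OF _ closure_subset]) blast
      then show ?thesis using gadget_arc_subset_closure[OF t0[of i]] by blast
    qed
    then show "(\<Union>i. path_image (c i)) \<subseteq> closure (\<Union>i. place i ` gadget_points (v i))"
      unfolding img by blast
  qed
  then show ?thesis unfolding config_image v_def .
qed

text \<open>In the open strip of gadget \<open>i\<close> the closure sees this gadget alone, since
  all points of the others lie in the two closed half planes above and below.\<close>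

lemma closure_config_strip:
  assumes z: "z \<in> closure (config f ` codes)" and s: "2 < 2 ^ i * snd z" "2 ^ i * snd z < 4"
  shows "unplace i z \<in> closure (gadget_points (\<lambda>t. 2 * f i t))"
proof -
  let ?P = "place i ` gadget_points (\<lambda>t. 2 * f i t)"
  have "config f ` codes \<subseteq> closure ?P \<union> {z. 2 ^ i * snd z \<le> 2} \<union> {z. 4 \<le> 2 ^ i * snd z}"
  proof
    fix q assume "q \<in> config f ` codes"
    then obtain l b s m where m: "m < 2 ^ s" and q: "q = place l (gadget_point (\<lambda>t. 2 * f l t) b s m)"
      by (auto simp: config_def codes_def)
    let ?y = "snd (gadget_point (\<lambda>t. 2 * f l t) b s m) + 3"
    have y: "2 < ?y" "?y < 4" using gadget_point_bounds(2)[OF m, of "\<lambda>t. 2 * f l t" b] by auto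
    have sq: "snd q = (1/2) ^ l * ?y" by (simp add: q place_def)
    consider "l = i" | "i < l" | "l < i" by linarith
    then show "q \<in> closure ?P \<union> {z. 2 ^ i * snd z \<le> 2} \<union> {z. 4 \<le> 2 ^ i * snd z}"
    proof cases
      case 1
      then have "q \<in> ?P" using q m unfolding gadget_points_def by blast
      then have "q \<in> closure ?P" by (rule subsetD[OF closure_subset])
      then show ?thesis by blast
    next
      case 2
      have "2 ^ i * snd q \<le> 2 ^ i * ((1/2) ^ l * 4)"
        unfolding sq using y by (intro mult_left_mono) auto
      also have "\<dots> = 2 ^ i * (2 * (2 * (1/2) ^ l))" by simp
      also have "\<dots> \<le> 2 ^ i * (2 * (1/2) ^ i)"
        using half_power_gap[OF 2] by (intro mult_left_mono) auto
      also have "\<dots> = 2" by (simp add: power_one_over)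
      finally show ?thesis by simp
    next
      case 3
      have "4 = 2 ^ i * (2 * (2 * (1/2::real) ^ i))" by (simp add: power_one_over)
      also have "\<dots> \<le> 2 ^ i * (2 * (1/2) ^ l)"
        using half_power_gap[OF 3] by (intro mult_left_mono) auto
      also have "\<dots> \<le> 2 ^ i * snd q" unfolding sq using y by (intro mult_left_mono) auto
      finally show ?thesis by simp
    qed
  qed
  then have "closure (config f ` codes) \<subseteq> closure ?P \<union> {z. 2 ^ i * snd z \<le> 2} \<union> {z. 4 \<le> 2 ^ i * snd z}"
    by (rule closure_minimal) (intro closed_Un closed_closure closed_Collect_le continuous_intros)
  then have zP: "z \<in> closure ?P" using z s by auto
  have "unplace i ` closure ?P \<subseteq> closure (gadget_points (\<lambda>t. 2 * f i t))"
    by (rule image_closure_subset[OF continuous_on_unplace closed_closure])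
      (use closure_subset in \<open>force simp: image_image\<close>)
  then show ?thesis using zP by blast
qed

text \<open>If no value is taken infinitely often in gadget \<open>i\<close>, all its strands are
  settled. At height 1/2 they form a bounded increasing sequence, so two neighbours are closer than
  any given \<open>d\<close>; a small connected set joining them would have to cross the gap between
  them.\<close>

theorem config_not_homeomorphic:
  assumes fin: "\<And>j. finite {t. f i t = j}"
  shows "\<not> closure (config f ` codes) homeomorphic {0..1::real}"
proof
  let ?S = "closure (config f ` codes)"
  define v where "v = (\<lambda>t. 2 * f i t)"
  assume S: "?S homeomorphic {0..1::real}"
  \<comment> \<open>A quarter of the scale of gadget \<open>i\<close> keeps a set around height 1/2
    strictly between heights 0 and 1, where neighbouring strands do not touch.\<close>
  have "(1/2::real) ^ i / 4 > 0" by simp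
  from homeomorphic_interval_small_connected[OF S this]
  obtain d where d: "d > 0" "\<And>x y. x \<in> ?S \<Longrightarrow> y \<in> ?S \<Longrightarrow> dist x y < d \<Longrightarrow>
     \<exists>C. connected C \<and> C \<subseteq> ?S \<and> C \<subseteq> ball x ((1/2) ^ i / 4) \<and> x \<in> C \<and> y \<in> C" by blast
  have "\<exists>t0. settled v t0 k" for k
    unfolding v_def by (intro settled_if_finite finite_doubled[of k] fin) auto
  then obtain t0 where t0: "\<And>k. settled v (t0 k) k" by metis
  define u where "u k = final_strand v k (1/2)" for k
  have u_less: "u k < u (Suc k)" for k
    unfolding u_def by (rule final_strand_less[OF _ _ t0]) (auto simp: slant_def)
  have "convergent u"
  proof (intro Bseq_monoseq_convergent incseq_imp_monoseq BseqI'[of _ 2] incseq_SucI)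
    show "norm (u k) \<le> 2" for k
      using final_strand_bounds[OF _ _ t0, of "1/2" k] by (simp add: u_def)
  qed (use u_less less_imp_le in blast)
  then obtain l where l: "u \<longlonglongrightarrow> l" by (auto simp: convergent_def)
  have "(\<lambda>k. u (Suc k) - u k) \<longlonglongrightarrow> 0"
    using tendsto_diff[OF LIMSEQ_Suc[OF l] l] by simp
  then have "\<forall>\<^sub>F k in sequentially. \<bar>u (Suc k) - u k\<bar> < d"
    using d(1) by (auto simp: tendsto_iff dist_real_def)
  then obtain k where k: "\<bar>u (Suc k) - u k\<bar> < d"
    by (auto simp: eventually_sequentially)
  define x where "x n = place i (u n, 1/2)" for n
  have xS: "x n \<in> ?S" for n
  proof -
    have "(u n, 1/2) \<in> closure (gadget_points v)"
      using final_strand_subset_closure[OF t0[of n]] by (auto simp: u_def subset_iff)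
    moreover have "place i ` closure (gadget_points v) \<subseteq> ?S"
      unfolding config_image v_def
      by (rule image_closure_subset[OF continuous_on_place closed_closure],
          rule subset_trans[OF _ closure_subset]) blast
    ultimately show ?thesis unfolding x_def by blast
  qed
  have "dist (x k) (x (Suc k)) = (1/2) ^ i * \<bar>u k - u (Suc k)\<bar>"
    by (simp add: x_def place_def dist_prod_def dist_real_def abs_mult flip: right_diff_distrib)
  also have "\<dots> \<le> 1 * \<bar>u k - u (Suc k)\<bar>" by (intro mult_right_mono power_le_one) auto
  also have "\<dots> < d" using k by (simp add: abs_minus_commute)
  finally obtain C where C: "connected C" "C \<subseteq> ?S" "C \<subseteq> ball (x k) ((1/2) ^ i / 4)"
     "x k \<in> C" "x (Suc k) \<in> C" using d(2)[OF xS xS] by blast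
  define E where "E = unplace i ` C"
  have E: "z \<in> closure (gadget_points v)" "0 < snd z" "snd z < 1" if zE: "z \<in> E" for z
  proof -
    obtain w where w: "w \<in> C" "z = unplace i w" using zE by (auto simp: E_def)
    have "\<bar>snd (x k) - snd w\<bar> < (1/2) ^ i / 4"
      using dist_snd_le[of "x k" w] C(3) w(1) by (auto simp: dist_real_def)
    then have "2 ^ i * \<bar>snd (x k) - snd w\<bar> < 2 ^ i * ((1/2) ^ i / 4)" by (intro mult_strict_left_mono) auto
    then have "\<bar>2 ^ i * snd (x k) - 2 ^ i * snd w\<bar> < 1/4"
      by (simp add: power_one_over abs_mult flip: right_diff_distrib)
    moreover have "2 ^ i * snd (x k) = 7/2" by (simp add: x_def place_def power_one_over)
    ultimately have s: "13/4 < 2 ^ i * snd w" "2 ^ i * snd w < 15/4" by linarith+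
    then show "z \<in> closure (gadget_points v)"
      using closure_config_strip[of w f i] C(2) w unfolding v_def by auto
    show "0 < snd z" "snd z < 1" using s by (auto simp: w(2) unplace_def)
  qed
  \<comment> \<open>The signed horizontal offset from the midline of the gap: negative on strand
    \<open>k\<close>, positive on the next one, so a connected set containing points of both has a
    zero, inside the gap.\<close>
  define \<phi> where "\<phi> z = fst z - (final_strand v k (snd z) + final_strand v (Suc k) (snd z)) / 2" for z :: "real \<times> real"
  have "continuous_on E (\<lambda>z. final_strand v n (snd z))" for n
    by (rule continuous_on_compose2[OF continuous_on_final_strand[OF t0[of n]]])
      (use E(2,3) in \<open>force intro!: continuous_intros\<close>)+
  then have "continuous_on E \<phi>" unfolding \<phi>_def by (intro continuous_intros) auto
  moreover have "connected E"
    unfolding E_def by (rule connected_continuous_image[OF continuous_on_unplace C(1)])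
  ultimately have conn: "connected (\<phi> ` E)" by (rule connected_continuous_image)
  have x: "(u k, 1/2) \<in> E" "(u (Suc k), 1/2) \<in> E"
    unfolding E_def using C(4,5) unplace_place[of i] unfolding x_def by (metis image_eqI)+
  have "\<phi> (u k, 1/2) \<in> \<phi> ` E" "\<phi> (u (Suc k), 1/2) \<in> \<phi> ` E" using x by blast+
  then have "{\<phi> (u k, 1/2)..\<phi> (u (Suc k), 1/2)} \<subseteq> \<phi> ` E"
    using connected_contains_Icc[OF conn] by blast
  moreover have "0 \<in> {\<phi> (u k, 1/2)..\<phi> (u (Suc k), 1/2)}"
    using u_less[of k] by (simp add: \<phi>_def flip: u_def)
  ultimately obtain z where z: "z \<in> E" "\<phi> z = 0" by (metis imageE subsetD)
  have y: "0 \<le> snd z" "snd z \<le> 1" using E[OF z(1)] by auto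
  have "final_strand v k (snd z) < final_strand v (Suc k) (snd z)"
    by (rule final_strand_less[OF y t0]) (use E(2,3)[OF z(1)] in \<open>simp add: slant_def\<close>)
  then show False
    using gap_between_strands[OF t0 E[OF z(1)], of k] z(2) by (auto simp: \<phi>_def)
qed

lemma determined_config:
  assumes F: "\<And>i t. determined (\<lambda>b. F b i t)" and c: "c \<in> codes"
  shows "determined (\<lambda>b. config (F b) c)"
proof -
  obtain i b0 s m where c': "c = (i, b0, s, m)" "m < 2 ^ s" using c by (auto simp: codes_def)
  have "determined (\<lambda>b. (\<lambda>f. place i (gadget_point (\<lambda>t. 2 * f t) b0 s m)) (F b i))"
  proof (rule determined_finite_dependence[where n = "Suc s" and F = "\<lambda>b. F b i"
        and G = "\<lambda>f. place i (gadget_point (\<lambda>t. 2 * f t) b0 s m)"])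
    show "determined (\<lambda>b. F b i t)" if "t < Suc s" for t by (rule F)
    fix f f' :: "nat \<Rightarrow> nat" assume "\<And>t. t < Suc s \<Longrightarrow> f t = f' t"
    then have "gadget_point (\<lambda>t. 2 * f t) b0 s m = gadget_point (\<lambda>t. 2 * f' t) b0 s m"
      by (intro gadget_point_cong c'(2)) simp
    then show "place i (gadget_point (\<lambda>t. 2 * f t) b0 s m) = place i (gadget_point (\<lambda>t. 2 * f' t) b0 s m)"
      by simp
  qed
  then show ?thesis by (simp add: c' config_def)
qed

section \<open>Hardness\<close>

lemma homeomorphic_space_top_of_set:
  "top_of_set S homeomorphic_space top_of_set T \<longleftrightarrow> S homeomorphic T"
proof
  assume "top_of_set S homeomorphic_space top_of_set T"
  then obtain f g where "homeomorphic_maps (top_of_set S) (top_of_set T) f g"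
    unfolding homeomorphic_space_def by blast
  then have fg: "continuous_on S f" "f ` S \<subseteq> T" "continuous_on T g" "g ` T \<subseteq> S"
    "\<And>x. x \<in> S \<Longrightarrow> g (f x) = x" "\<And>y. y \<in> T \<Longrightarrow> f (g y) = y"
    by (auto simp: homeomorphic_maps_def continuous_map_in_subtopology)
  have "homeomorphism S T f g" by (rule homeomorphismI) (use fg in auto)
  then show "S homeomorphic T" unfolding homeomorphic_def by blast
next
  assume "S homeomorphic T"
  then obtain f g where "homeomorphism S T f g" unfolding homeomorphic_def by blast
  then have "homeomorphic_maps (top_of_set S) (top_of_set T) f g"
    by (auto simp: homeomorphic_maps_def continuous_map_in_subtopology homeomorphism_def)
  then show "top_of_set S homeomorphic_space top_of_set T"
    unfolding homeomorphic_space_def by blast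
qed

lemma HCopies_graph_string:
  assumes "presents q d"
  shows "graph_string q \<in> HCopies X \<longleftrightarrow> Metric_space.mcompletion_topology UNIV d homeomorphic_space X"
proof -
  have "graph_string q \<in> TOP" using assms by (auto simp: TOP_def)
  moreover have "presents_copy (graph_string q) X \<longleftrightarrow> Metric_space.mcompletion_topology UNIV d homeomorphic_space X"
    unfolding presents_copy_def graph_string_inject
  proof
    assume "\<exists>q' d'. q = q' \<and> presents q' d' \<and> Metric_space.mcompletion_topology UNIV d' homeomorphic_space X"
    then obtain d' where "presents q d'" "Metric_space.mcompletion_topology UNIV d' homeomorphic_space X"
      by auto
    then show "Metric_space.mcompletion_topology UNIV d homeomorphic_space X"
      using presents_unique[OF assms, of d'] by simp
  qed (use assms in auto)
  ultimately show ?thesis by (simp add: HCopies_def)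
qed

lemma HCopies_interval_iff:
  fixes e :: "nat \<Rightarrow> 'a::complete_space"
  assumes p: "presents q d" and e: "\<And>x y. dist (e x) (e y) = d x y"
  shows "graph_string q \<in> HCopies (top_of_set {0..1::real}) \<longleftrightarrow> closure (range e) homeomorphic {0..1::real}"
proof -
  interpret Metric_space UNIV d using p by (simp add: presents_def)
  have h: "mcompletion_topology homeomorphic_space top_of_set (closure (range e))"
    using homeomorphic_mcompletion_closure[of e] e by simp
  have "mcompletion_topology homeomorphic_space top_of_set {0..1::real} \<longleftrightarrow>
      top_of_set (closure (range e)) homeomorphic_space top_of_set {0..1::real}"
    using h homeomorphic_space_trans homeomorphic_space_sym by meson
  then show ?thesis unfolding HCopies_graph_string[OF p] homeomorphic_space_top_of_set .
qed

text \<open>Two extra binary digits make the errors of consecutive terms add up to less than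
  \<open>(1/2) ^ k\<close>, as a fast Cauchy sequence requires.\<close>

definition rounding :: "real \<Rightarrow> nat \<Rightarrow> rat" where
  "rounding r k = of_int \<lfloor>2 ^ (k + 2) * r\<rfloor> / 2 ^ (k + 2)"

lemma rounding_error: "\<bar>real_of_rat (rounding r k) - r\<bar> \<le> (1/2) ^ (k + 2)"
proof -
  have q: "2 ^ (k + 2) * real_of_rat (rounding r k) = of_int \<lfloor>2 ^ (k + 2) * r\<rfloor>"
    by (simp add: rounding_def of_rat_divide of_rat_power of_rat_mult)
  have "\<bar>2 ^ (k + 2) * (real_of_rat (rounding r k) - r)\<bar> \<le> 1"
    unfolding right_diff_distrib q by linarith
  then have "2 ^ (k + 2) * \<bar>real_of_rat (rounding r k) - r\<bar> \<le> 1" by (simp add: abs_mult)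
  then show ?thesis by (simp add: field_simps power_one_over)
qed

lemma presents_rounding:
  assumes "Metric_space UNIV d"
  shows "presents (\<lambda>x y. rounding (d x y)) d"
  unfolding presents_def
proof (intro conjI allI assms)
  fix x y
  let ?q = "\<lambda>k. real_of_rat (rounding (d x y) k)"
  show "fast_cauchy ?q"
    unfolding fast_cauchy_def
  proof
    fix k
    have p: "0 < (1/2::real) ^ k" by simp
    have "dist (?q k) (?q (Suc k)) \<le> (1/2) ^ (k + 2) + (1/2) ^ (Suc k + 2)"
      using rounding_error[of "d x y" k] rounding_error[of "d x y" "Suc k"] unfolding dist_real_def by linarith
    also have "\<dots> < (1/2) ^ k" using p by (simp add: power_add)
    finally show "dist (?q k) (?q (Suc k)) < 1 / 2 ^ k" by (simp add: power_one_over)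
  qed
  have "(\<lambda>k. (1/2::real) ^ (k + 2)) \<longlonglongrightarrow> 0"
    by (rule LIMSEQ_ignore_initial_segment) (auto intro: LIMSEQ_power_zero)
  then have "(\<lambda>k. ?q k - d x y) \<longlonglongrightarrow> 0"
    by (rule Lim_null_comparison[rotated]) (use rounding_error in \<open>auto intro!: always_eventually\<close>)
  from tendsto_add[OF this tendsto_const[of "d x y"]] show "?q \<longlonglongrightarrow> d x y" by simp
qed

lemma Metric_space_inj:
  assumes "inj e" shows "Metric_space UNIV (\<lambda>x y. dist (e x) (e y))"
  by unfold_locales (use assms in \<open>auto simp: dist_commute dist_triangle dest: injD\<close>)

lemma openin_baire_spaceI:
  assumes "\<And>b. b \<in> U \<Longrightarrow> \<exists>N. \<forall>b'. (\<forall>i<N. b' i = b i) \<longrightarrow> b' \<in> U"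
  shows "openin baire_space U"
proof (subst openin_subopen, intro ballI)
  fix b assume "b \<in> U"
  from assms[OF this] obtain N where N: "\<forall>b'. (\<forall>i<N. b' i = b i) \<longrightarrow> b' \<in> U" ..
  define X where "X i = (if i < N then {b i} else UNIV)" for i
  have "{i. X i \<noteq> UNIV} \<subseteq> {..<N}" by (auto simp: X_def split: if_splits)
  then have "finite {i. X i \<noteq> UNIV}" by (rule finite_subset) simp
  then have "openin baire_space (Pi\<^sub>E UNIV X)"
    unfolding baire_space_def by (intro product_topology_basis) auto
  moreover have "b \<in> Pi\<^sub>E UNIV X" by (auto simp: X_def)
  moreover have "Pi\<^sub>E UNIV X \<subseteq> U"
  proof
    fix b' assume b': "b' \<in> Pi\<^sub>E UNIV X"
    have "b' i = b i" if "i < N" for i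
      using PiE_mem[OF b', of i] that by (simp add: X_def)
    then show "b' \<in> U" using N by blast
  qed
  ultimately show "\<exists>T. openin baire_space T \<and> b \<in> T \<and> T \<subseteq> U" by blast
qed

lemma continuous_map_TOP_space:
  assumes F: "\<And>n. determined (\<lambda>b. F b n)" and T: "\<And>b. F b \<in> TOP"
  shows "continuous_map baire_space TOP_space F"
  unfolding TOP_space_def continuous_map_in_subtopology cantor_space_def continuous_map_componentwise_UNIV
proof (intro conjI allI)
  fix n
  have "openin baire_space {b. F b n \<in> V}" for V
  proof (rule openin_baire_spaceI)
    fix b assume b: "b \<in> {b. F b n \<in> V}"
    from determinedD[OF F, of b n]
    obtain N where N: "\<forall>b'. (\<forall>i<N. b' i = b i) \<longrightarrow> F b' n = F b n" ..
    show "\<exists>N. \<forall>b'. (\<forall>i<N. b' i = b i) \<longrightarrow> b' \<in> {b. F b n \<in> V}"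
    proof (intro exI[of _ N] allI impI)
      fix b' assume "\<forall>i<N. b' i = b i"
      then have "F b' n = F b n" using N by blast
      then show "b' \<in> {b. F b n \<in> V}" using b by simp
    qed
  qed
  then show "continuous_map baire_space (discrete_topology UNIV) (\<lambda>b. F b n)"
    by (simp add: continuous_map_def)
qed (use T in auto)

lemma determined_graph_string:
  assumes "\<And>x y k. determined (\<lambda>b. q b x y k)"
  shows "determined (\<lambda>b. graph_string (q b) n)"
proof (cases "\<exists>x y k r. n = tuple_code x y k r")
  case True
  then obtain x y k r where n: "n = tuple_code x y k r" by blast
  have "graph_string (q b) n \<longleftrightarrow> r = q b x y k" for b
    by (auto simp: graph_string_def n)
  then show ?thesis using determined_comp1[OF assms, of "(=) r" x y k] by simp
next
  case False
  then have "graph_string (q b) n = False" for b by (auto simp: graph_string_def)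
  then show ?thesis by (simp add: determined_const)
qed

theorem wadge_reducible_interval:
  assumes "Pi0 baire_space 4 B"
  shows "wadge_reducible B (HCopies (top_of_set {0..1::real}))"
proof -
  obtain D where D: "\<forall>(i::nat) (j::nat) (k::nat) (s::nat). determined (D i j k s)"
    "\<forall>b. b \<in> B \<longleftrightarrow> (\<forall>i::nat. \<exists>j::nat. \<forall>k::nat. \<exists>s. D i j k s b)"
    using Pi0_4_baire[OF assms] by blast
  define f where "f b i = schedule (\<lambda>j k s. D i j k s b)" for b i
  have f: "determined (\<lambda>b. f b i t)" for i t
    unfolding f_def by (rule determined_schedule) (use D(1) in blast)
  define code where "code = from_nat_into codes"
  have bij: "bij_betw code UNIV codes"
    unfolding code_def by (rule bij_betw_from_nat_into) (auto simp: infinite_codes)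
  define e where "e b n = config (f b) (code n)" for b n
  have rng: "range (e b) = config (f b) ` codes" for b
    using bij by (auto simp: e_def bij_betw_def image_image[symmetric])
  have inj: "inj (e b)" for b
    using comp_inj_on[of code UNIV "config (f b)"] bij inj_on_config[of "f b"]
    by (simp add: e_def[abs_def] bij_betw_def o_def)
  have e: "determined (\<lambda>b. e b n)" for n
    unfolding e_def by (rule determined_config[OF f]) (use bij in \<open>auto simp: bij_betw_def\<close>)
  define q where "q b x y = rounding (dist (e b x) (e b y))" for b x y
  have p: "presents (q b) (\<lambda>x y. dist (e b x) (e b y))" for b
    unfolding q_def by (rule presents_rounding[OF Metric_space_inj[OF inj]])
  \<comment> \<open>Rounding is discontinuous in the distance. This does no harm, because finitely
    many values of \<open>b\<close> fix the two points, and so their distance, exactly.\<close>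
  have q: "determined (\<lambda>b. q b x y k)" for x y k
    unfolding q_def using determined_comp2[OF e e, of "\<lambda>u v. rounding (dist u v) k"] .
  have "continuous_map baire_space TOP_space (\<lambda>b. graph_string (q b))"
    by (rule continuous_map_TOP_space[OF determined_graph_string[OF q]]) (use p in \<open>auto simp: TOP_def\<close>)
  moreover have "b \<in> B \<longleftrightarrow> graph_string (q b) \<in> HCopies (top_of_set {0..1::real})" for b
  proof -
    have "b \<in> B \<longleftrightarrow> (\<forall>i. \<exists>j. infinite {t. f b i t = j})"
      using D(2) by (simp add: f_def infinite_schedule_iff)
    also have "\<dots> \<longleftrightarrow> closure (config (f b) ` codes) homeomorphic {0..1::real}"
      using config_homeomorphic[of "f b"] config_not_homeomorphic[of "f b"] by blast
    also have "\<dots> \<longleftrightarrow> graph_string (q b) \<in> HCopies (top_of_set {0..1::real})"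
      unfolding rng[symmetric] by (rule HCopies_interval_iff[OF p refl, symmetric])
    finally show ?thesis .
  qed
  ultimately show ?thesis unfolding wadge_reducible_def by blast
qed

section \<open>The arc condition on a dense sequence\<close>

definition link :: "(nat \<Rightarrow> nat \<Rightarrow> real) \<Rightarrow> real \<Rightarrow> nat set \<Rightarrow> (nat \<times> nat) set" where
  "link d b U = {(u, v). d u v < b \<and> v \<in> U}"

definition mesh :: "nat \<Rightarrow> real" where "mesh n = inverse (real (Suc n))"

lemma mesh_pos [simp]: "0 < mesh n"
  by (simp add: mesh_def)

text \<open>\<open>L\<close> is a finite net of labelled points whose labels express chainability; the chain condition
  expresses uniform local connectedness, and connectedness.\<close>

definition net_condition :: "(nat \<Rightarrow> nat \<Rightarrow> real) \<Rightarrow> nat \<Rightarrow> (nat \<times> nat) list \<Rightarrow> nat \<Rightarrow> nat \<Rightarrow> bool" where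
  "net_condition d n L m x \<longleftrightarrow> n \<le> m \<and> (\<exists>a\<in>set L. d x (fst a) < mesh m) \<and>
     (\<forall>a\<in>set L. \<forall>b\<in>set L. if snd a \<le> snd b + 1 \<and> snd b \<le> snd a + 1
       then d (fst a) (fst b) < mesh n else 5 * mesh m < d (fst a) (fst b))"

text \<open>The disjunction expresses an implication from \<open>d x y \<le> mesh m\<close> by open
  conditions. With \<open>l\<close> quantified universally it yields chains of arbitrarily small
  steps inside one fixed ball, hence a small subcontinuum once the space is compact.\<close>

definition chain_condition :: "(nat \<Rightarrow> nat \<Rightarrow> real) \<Rightarrow> nat \<Rightarrow> nat \<Rightarrow> nat \<Rightarrow> nat \<Rightarrow> nat \<Rightarrow> bool" where
  "chain_condition d n m x y l \<longleftrightarrow>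
     (mesh m < d x y \<or> (x, y) \<in> (link d (mesh l) {v. d x v < mesh n})\<^sup>*) \<and>
     (x, y) \<in> (link d (mesh l) UNIV)\<^sup>*"

lemma mesh_less: "r > 0 \<Longrightarrow> \<exists>n. mesh n < r"
  unfolding mesh_def using reals_Archimedean by blast

lemma mesh_mono: "n \<le> m \<Longrightarrow> mesh m \<le> mesh n"
  by (simp add: mesh_def field_simps)

locale dense_sequence =
  fixes e :: "nat \<Rightarrow> 'a::complete_space" and d :: "nat \<Rightarrow> nat \<Rightarrow> real"
  assumes d: "d x y = dist (e x) (e y)" and inj: "inj e"
begin

abbreviation "S \<equiv> closure (range e)"

lemma near_dense:
  assumes "x \<in> S" "r > 0" obtains p where "dist (e p) x < r"
  using assms unfolding closure_approachable by blast

lemma e_in: "e p \<in> S"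
  using closure_subset[of "range e"] by blast

lemma chain_in_closure:
  assumes xy: "x \<in> K" "y \<in> K" and eta: "b > 0"
    and x': "dist (e x') x < b" and y': "dist (e y') y < b" "e x' \<in> K" "e y' \<in> K"
    and chain: "(x', y') \<in> (link d b {v. e v \<in> K})\<^sup>*"
  shows "(x, y) \<in> {(u, v). u \<in> K \<and> v \<in> K \<and> dist u v < b}\<^sup>*" (is "_ \<in> ?R\<^sup>*")
proof -
  have "(e x', e z) \<in> ?R\<^sup>* \<and> e z \<in> K" if "(x', z) \<in> (link d b {v. e v \<in> K})\<^sup>*" for z
    using that
  proof (induction rule: rtrancl_induct)
    case base
    then show ?case using y' by simp
  next
    case (step u v)
    then have "(e u, e v) \<in> ?R" "e v \<in> K" by (auto simp: link_def d)
    then show ?case using step.IH by (meson rtrancl.rtrancl_into_rtrancl)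
  qed
  then have "(e x', e y') \<in> ?R\<^sup>*" using chain by blast
  moreover have "(x, e x') \<in> ?R" "(e y', y) \<in> ?R" using assms by (auto simp: dist_commute)
  ultimately show ?thesis by (meson rtrancl.rtrancl_into_rtrancl converse_rtrancl_into_rtrancl)
qed

text \<open>Being joined by steps below \<open>b / 3\<close> inside \<open>C\<close> is an
  equivalence relation with open classes, so all of \<open>C\<close> is one class. Each point of
  such a chain is approximated within \<open>b / 3\<close> by a member of the sequence in
  \<open>U\<close>, and two approximations with one step make up less than \<open>b\<close>.\<close>

lemma chain_of_connected:
  assumes C: "connected C" "C \<subseteq> S" "C \<subseteq> U" "open U" and xy: "e x \<in> C" "e y \<in> C" and eta: "b > 0"
  shows "(x, y) \<in> (link d b {v. e v \<in> U})\<^sup>*"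
proof -
  define R where "R = {(u, v). u \<in> C \<and> v \<in> C \<and> dist u v < b / 3}"
  have R_sym: "sym (R\<^sup>*)" by (intro sym_rtrancl symI) (auto simp: R_def dist_commute)
  have "(e x, e y) \<in> R\<^sup>*"
  proof (rule connected_equivalence_relation[OF C(1) xy, where R = "\<lambda>u v. (u, v) \<in> R\<^sup>*"])
    fix u assume u: "u \<in> C"
    have "openin (top_of_set C) (C \<inter> ball u (b / 3))" by (simp add: openin_open_Int)
    moreover have "u \<in> C \<inter> ball u (b / 3)" using u eta by simp
    moreover have "\<forall>v\<in>C \<inter> ball u (b / 3). (u, v) \<in> R\<^sup>*" using u by (auto simp: R_def)
    ultimately show "\<exists>T. openin (top_of_set C) T \<and> u \<in> T \<and> (\<forall>v\<in>T. (u, v) \<in> R\<^sup>*)" by blast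
  qed (use R_sym in \<open>auto dest: symD\<close>)
  then have "\<forall>p. dist (e p) (e y) < b / 3 \<longrightarrow> e p \<in> U \<longrightarrow> (x, p) \<in> (link d b {v. e v \<in> U})\<^sup>*"
  proof (induction rule: rtrancl_induct)
    case base
    have "(x, p) \<in> link d b {v. e v \<in> U}" if "dist (e p) (e x) < b / 3" "e p \<in> U" for p
      using that eta by (simp add: link_def d dist_commute)
    then show ?case by blast
  next
    case (step v w)
    have v: "v \<in> C" "dist v w < b / 3" using step(2) by (auto simp: R_def)
    obtain r where r: "r > 0" "ball v r \<subseteq> U" using C v(1) open_contains_ball by blast
    obtain p0 where p0: "dist (e p0) v < min (b / 3) r"
      using near_dense[of v "min (b / 3) r"] v(1) C(2) r(1) eta by auto
    have p0': "dist (e p0) v < b / 3" "e p0 \<in> U"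
      using p0 r(2) by (auto simp: dist_commute)
    show ?case
    proof (intro allI impI)
      fix p assume p: "dist (e p) w < b / 3" "e p \<in> U"
      have "dist (e p0) (e p) \<le> dist (e p0) v + dist v w + dist w (e p)"
        using dist_triangle[of "e p0" "e p" v] dist_triangle[of v "e p" w] by linarith
      then have "(p0, p) \<in> link d b {v. e v \<in> U}"
        using p p0' v by (simp add: link_def d dist_commute)
      moreover have "(x, p0) \<in> (link d b {v. e v \<in> U})\<^sup>*" using step.IH p0' by blast
      ultimately show "(x, p) \<in> (link d b {v. e v \<in> U})\<^sup>*" by (meson rtrancl.rtrancl_into_rtrancl)
    qed
  qed
  then show ?thesis using xy C(3) eta by auto
qed

lemma homeomorphic_if_conditions:
  assumes net: "\<And>n. \<exists>L m. \<forall>x y l. net_condition d n L m x \<and> chain_condition d n m x y l"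
  shows "S homeomorphic {0..1::real}"
proof -
  have "\<forall>n. \<exists>Lm. \<forall>x y l. net_condition d n (fst Lm) (snd Lm) x \<and> chain_condition d n (snd Lm) x y l"
  proof
    fix n
    from net[of n] obtain L where "\<exists>m. \<forall>x y l. net_condition d n L m x \<and> chain_condition d n m x y l" ..
    then obtain m where h: "\<forall>x y l. net_condition d n L m x \<and> chain_condition d n m x y l" ..
    show "\<exists>Lm. \<forall>x y l. net_condition d n (fst Lm) (snd Lm) x \<and> chain_condition d n (snd Lm) x y l"
      by (rule exI[of _ "(L, m)"], unfold fst_conv snd_conv, rule h)
  qed
  from choice[OF this] obtain Lm where
    Lm: "\<forall>n x y l. net_condition d n (fst (Lm n)) (snd (Lm n)) x \<and> chain_condition d n (snd (Lm n)) x y l" ..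
  define L m where "L n = fst (Lm n)" and "m n = snd (Lm n)" for n
  have A: "net_condition d n (L n) (m n) x" "chain_condition d n (m n) x y l" for n x y l
    unfolding L_def m_def using Lm by blast+
  have nm: "n \<le> m n" for n using A(1)[of n 0] unfolding net_condition_def by blast
  have near: "\<exists>(p, c)\<in>set (L n). dist (e x) (e p) < mesh (m n)" for n x
  proof -
    have "\<exists>a\<in>set (L n). d x (fst a) < mesh (m n)"
      using A(1)[of n x] unfolding net_condition_def by blast
    then show ?thesis by (auto simp: d)
  qed
  have labelled: "if c \<le> c' + 1 \<and> c' \<le> c + 1 then dist (e p) (e p') < mesh n else 5 * mesh (m n) < dist (e p) (e p')"
    if pc: "(p, c) \<in> set (L n)" "(p', c') \<in> set (L n)" for n p c p' c'
  proof -
    have "\<forall>a\<in>set (L n). \<forall>b\<in>set (L n). if snd a \<le> snd b + 1 \<and> snd b \<le> snd a + 1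
       then d (fst a) (fst b) < mesh n else 5 * mesh (m n) < d (fst a) (fst b)"
      using A(1)[of n 0] unfolding net_condition_def by blast
    from bspec[OF bspec[OF this pc(1)] pc(2), unfolded fst_conv snd_conv d] show ?thesis .
  qed
  have same: "dist (e p) (e p') < mesh n"
    if "(p, c) \<in> set (L n)" "(p', c') \<in> set (L n)" "c \<le> c' + 1" "c' \<le> c + 1" for n p c p' c'
    using labelled[OF that(1,2)] that(3,4) by simp
  have apart: "5 * mesh (m n) < dist (e p) (e p')"
    if "(p, c) \<in> set (L n)" "(p', c') \<in> set (L n)" "\<not> (c \<le> c' + 1 \<and> c' \<le> c + 1)" for n p c p' c'
    using labelled[OF that(1,2)] that(3) by argo
  have small: "mesh (m n) < dist (e x) (e y) \<or> (x, y) \<in> (link d (mesh l) {v. dist (e x) (e v) < mesh n})\<^sup>*"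
    and chained: "(x, y) \<in> (link d (mesh l) UNIV)\<^sup>*" for n x y l
    using A(2)[of n x y l] by (simp_all add: chain_condition_def d)
  have chained': "(x, y) \<in> (link d b UNIV)\<^sup>*" if eta: "b > 0" for b x y
  proof -
    obtain l where "mesh l < b" using mesh_less[OF eta] by blast
    then have "link d (mesh l) UNIV \<subseteq> link d b UNIV" by (auto simp: link_def)
    then show ?thesis using chained rtrancl_mono by blast
  qed
  have small': "(x, y) \<in> (link d b {v. dist (e x) (e v) < mesh n})\<^sup>*"
    if eta: "b > 0" and xy: "dist (e x) (e y) \<le> mesh (m n)" for b x y n
  proof -
    obtain l where "mesh l < b" using mesh_less[OF eta] by blast
    then have "link d (mesh l) {v. dist (e x) (e v) < mesh n} \<subseteq> link d b {v. dist (e x) (e v) < mesh n}"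
      by (auto simp: link_def)
    then show ?thesis using small[of n x y l] xy rtrancl_mono by (meson not_le subsetD)
  qed
  have compact: "compact S"
    unfolding compact_eq_totally_bounded
  proof (intro conjI allI impI)
    show "complete S" by (simp add: complete_eq_closed)
    fix r :: real assume "r > 0"
    then obtain n where n: "mesh n < r / 2" using mesh_less[of "r / 2"] by auto
    let ?k = "(\<lambda>(p, c). e p) ` set (L n)"
    have "S \<subseteq> (\<Union>x\<in>?k. ball x r)"
    proof
      fix x assume "x \<in> S"
      then obtain x' where x': "dist (e x') x < r / 2" using near_dense[of x "r / 2"] \<open>r > 0\<close> by auto
      obtain p c where p: "(p, c) \<in> set (L n)" "dist (e x') (e p) < mesh (m n)" using near by blast
      have "dist (e p) x < r"
        using p(2) x' n mesh_mono[OF nm, of n] dist_triangle[of "e p" x "e x'"] by (simp add: dist_commute)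
      then show "x \<in> (\<Union>x\<in>?k. ball x r)" using p(1) by force
    qed
    then show "\<exists>k. finite k \<and> S \<subseteq> (\<Union>x\<in>k. ball x r)" by (intro exI[of _ ?k]) simp
  qed
  have connected: "connected S"
    unfolding connected_iff_connected_component
  proof (intro ballI)
    fix x y assume xy: "x \<in> S" "y \<in> S"
    have chains: "(x, y) \<in> {(u, v). u \<in> S \<and> v \<in> S \<and> dist u v < b}\<^sup>*" if eta: "b > 0" for b
    proof -
      obtain x' where x': "dist (e x') x < b" by (rule near_dense[OF xy(1) eta])
      obtain y' where y': "dist (e y') y < b" by (rule near_dense[OF xy(2) eta])
      have "{v. e v \<in> S} = UNIV" using e_in by blast
      then show ?thesis
        using chain_in_closure[OF xy eta x' y' e_in e_in] chained'[OF eta] by simp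
    qed
    obtain C where "compact C" "connected C" "C \<subseteq> S" "x \<in> C" "y \<in> C"
      by (rule connected_subset_of_chains[OF compact xy(1) chains])
    then show "connected_component S x y" unfolding connected_component_def by blast
  qed
  interpret arc_like S
  proof
    show "compact S" "connected S" by fact+
  next
    fix r :: real assume eps: "r > 0"
    then obtain n where n: "mesh n < r / 2" using mesh_less[of "r / 2"] by auto
    \<comment> \<open>One third for the distance of \<open>x\<close> and \<open>y\<close> and one
      for each approximation puts \<open>x'\<close> and \<open>y'\<close> within
      \<open>mesh (m n)\<close>, where the chain condition applies.\<close>
    define \<delta> where "\<delta> = mesh (m n) / 3"
    have del: "\<delta> > 0" by (simp add: \<delta>_def)
    have m3: "mesh (m n) = 3 * \<delta>" by (simp add: \<delta>_def)
    have m2: "3 * \<delta> < r / 2" using mesh_mono[OF nm, of n] n m3 by linarith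
    have "\<exists>C. closed C \<and> connected C \<and> C \<subseteq> S \<and> C \<subseteq> cball x r \<and> x \<in> C \<and> y \<in> C"
      if xy: "x \<in> S" "y \<in> S" "dist x y < \<delta>" for x y
    proof -
      let ?K = "S \<inter> cball x r"
      have K: "compact ?K" using compact by (simp add: compact_Int_closed)
      have xyK: "x \<in> ?K" "y \<in> ?K" using xy eps m2 del by auto
      have chains: "(x, y) \<in> {(u, v). u \<in> ?K \<and> v \<in> ?K \<and> dist u v < b}\<^sup>*" if eta: "b > 0" for b
      proof -
        have min: "min b \<delta> > 0" using eta del by simp
        obtain x' where x': "dist (e x') x < min b \<delta>" by (rule near_dense[OF xy(1) min])
        obtain y' where y': "dist (e y') y < min b \<delta>" by (rule near_dense[OF xy(2) min])
        have "dist (e x') (e y') \<le> dist (e x') x + dist x y + dist y (e y')"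
          using dist_triangle[of "e x'" "e y'" x] dist_triangle[of x "e y'" y] by linarith
        then have xy': "dist (e x') (e y') \<le> mesh (m n)" using x' y' xy(3) m3 by (simp add: dist_commute)
        have inK: "e v \<in> ?K" if "dist (e x') (e v) < mesh n" for v
        proof -
          have "dist x (e v) \<le> r"
            using dist_triangle[of x "e v" "e x'"] that x' n m2 del by (simp add: dist_commute)
          then show ?thesis using e_in by simp
        qed
        have "mesh (m n) \<le> mesh n" using mesh_mono[OF nm] .
        moreover have "dist (e x') (e y') < 3 * \<delta>"
          using x' y' xy(3) dist_triangle[of "e x'" "e y'" x] dist_triangle[of x "e y'" y] by (simp add: dist_commute)
        ultimately have y'n: "dist (e x') (e y') < mesh n" using m3 by linarith
        have "link d b {v. dist (e x') (e v) < mesh n} \<subseteq> link d b {v. e v \<in> ?K}"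
          using inK by (auto simp: link_def)
        then have "(x', y') \<in> (link d b {v. e v \<in> ?K})\<^sup>*"
          using small'[OF eta xy'] rtrancl_mono by blast
        moreover have "e x' \<in> ?K" by (rule inK) simp
        ultimately show ?thesis
          using chain_in_closure[OF xyK eta, of x' y'] inK[OF y'n] x' y' by simp
      qed
      obtain C where "compact C" "connected C" "C \<subseteq> ?K" "x \<in> C" "y \<in> C"
        by (rule connected_subset_of_chains[OF K xyK(1) chains])
      then show ?thesis by (intro exI[of _ C]) (auto dest: compact_imp_closed)
    qed
    then show "\<exists>\<delta>>0. \<forall>x\<in>S. \<forall>y\<in>S. dist x y < \<delta> \<longrightarrow>
        (\<exists>C. closed C \<and> connected C \<and> C \<subseteq> S \<and> C \<subseteq> cball x r \<and> x \<in> C \<and> y \<in> C)"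
      using del by blast
  next
    fix r :: real assume eps: "r > 0"
    \<comment> \<open>Two points with equal labels are each within \<open>2 * mesh (m n)\<close> of
      a net point, and these net points are within \<open>mesh n\<close> of each other: less than
      five times \<open>mesh n\<close> in all.\<close>
    then obtain n where n: "mesh n < r / 5" using mesh_less[of "r / 5"] by auto
    have ex: "\<exists>pc. pc \<in> set (L n) \<and> dist x (e (fst pc)) < 2 * mesh (m n)" if x: "x \<in> S" for x
    proof -
      have "mesh (m n) > 0" by simp
      then obtain x' where x': "dist (e x') x < mesh (m n)" using near_dense[OF x] by blast
      obtain p c where p: "(p, c) \<in> set (L n)" "dist (e x') (e p) < mesh (m n)" using near by blast
      have "dist x (e p) < 2 * mesh (m n)"
        using p(2) x' dist_triangle[of x "e p" "e x'"] by (simp add: dist_commute)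
      then show ?thesis using p(1) by (intro exI[of _ "(p, c)"]) simp
    qed
    define k where "k x = (SOME pc. pc \<in> set (L n) \<and> dist x (e (fst pc)) < 2 * mesh (m n))" for x
    have k: "k x \<in> set (L n)" "dist x (e (fst (k x))) < 2 * mesh (m n)" if "x \<in> S" for x
      using someI_ex[OF ex[OF that]] by (simp_all add: k_def)
    have "snd (k x) \<le> snd (k y) + 1" if xy: "x \<in> S" "y \<in> S" "dist x y < mesh (m n)" for x y
    proof (rule ccontr)
      assume "\<not> ?thesis"
      \<comment> \<open>The origin of the factor 5: twice \<open>2 * mesh (m n)\<close> to reach the
        net, and \<open>mesh (m n)\<close> between \<open>x\<close> and \<open>y\<close>.\<close>
      then have "5 * mesh (m n) < dist (e (fst (k x))) (e (fst (k y)))"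
        using apart[of "fst (k x)" "snd (k x)" n "fst (k y)" "snd (k y)"] k(1) xy by simp
      moreover have "dist (e (fst (k x))) (e (fst (k y))) \<le> dist (e (fst (k x))) x + (dist x y + dist y (e (fst (k y))))"
        using dist_triangle[of "e (fst (k x))" "e (fst (k y))" x] dist_triangle[of x "e (fst (k y))" y] by linarith
      ultimately show False using k(2)[OF xy(1)] k(2)[OF xy(2)] xy(3) by (simp add: dist_commute)
    qed
    moreover have "dist x y < r" if xy: "x \<in> S" "y \<in> S" "snd (k x) = snd (k y)" for x y
    proof -
      have "(fst (k x), snd (k x)) \<in> set (L n)" "(fst (k y), snd (k y)) \<in> set (L n)"
        using k(1)[OF xy(1)] k(1)[OF xy(2)] by (simp_all only: prod.collapse)
      moreover have "snd (k x) \<le> snd (k y) + 1" "snd (k y) \<le> snd (k x) + 1"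
        by (simp_all add: xy(3))
      ultimately have "dist (e (fst (k x))) (e (fst (k y))) < mesh n"
        by (rule same)
      moreover have "dist x y \<le> dist x (e (fst (k x))) + (dist (e (fst (k x))) (e (fst (k y))) + dist (e (fst (k y))) y)"
        using dist_triangle[of x y "e (fst (k x))"] dist_triangle[of "e (fst (k x))" y "e (fst (k y))"] by linarith
      ultimately show ?thesis
        using k(2)[OF xy(1)] k(2)[OF xy(2)] n mesh_mono[OF nm, of n] by (simp add: dist_commute)
    qed
    moreover have "mesh (m n) > 0" by simp
    ultimately show "\<exists>\<delta>>0. \<exists>c::'a \<Rightarrow> nat. \<forall>x\<in>S. \<forall>y\<in>S.
        (dist x y < \<delta> \<longrightarrow> c x \<le> c y + 1) \<and> (c x = c y \<longrightarrow> dist x y < r)"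
      by (intro exI[of _ "mesh (m n)"] conjI exI[of _ "\<lambda>x. snd (k x)"]) auto
  qed
  show ?thesis
    by (rule homeomorphic_unit_interval[of e]) (use e_in inj in \<open>auto dest: injD\<close>)
qed

lemma conditions_if_homeomorphic:
  assumes S: "S homeomorphic {0..1::real}"
  shows "\<exists>L m. \<forall>x y l. net_condition d n L m x \<and> chain_condition d n m x y l"
proof -
  obtain g h where gh: "homeomorphism S {0..1::real} g h"
    using S unfolding homeomorphic_def by blast
  have cS: "compact S" using S homeomorphic_compactness compact_Icc by blast
  have conn: "connected S" using S homeomorphic_connectedness connected_Icc by blast
  have uc: "uniformly_continuous_on {0..1} h" "uniformly_continuous_on S g"
    using gh cS by (auto intro!: compact_uniformly_continuous simp: homeomorphism_def)
  have g01: "0 \<le> g x" "g x \<le> 1" "h (g x) = x" if "x \<in> S" for x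
    using gh that unfolding homeomorphism_def by auto
  have fp: "mesh n > 0" by simp
  obtain d1 where d1: "d1 > 0" "\<And>s t. s \<in> {0..1} \<Longrightarrow> t \<in> {0..1} \<Longrightarrow> dist s t < d1 \<Longrightarrow> dist (h s) (h t) < mesh n"
    using uc(1) fp unfolding uniformly_continuous_on_def by metis
  obtain N where N: "mesh N < d1 / 2" using mesh_less[of "d1 / 2"] d1(1) by auto
  have Np: "mesh N > 0" by simp
  obtain d2 where d2: "d2 > 0" "\<And>x y. x \<in> S \<Longrightarrow> y \<in> S \<Longrightarrow> dist x y < d2 \<Longrightarrow> dist (g x) (g y) < mesh N"
    using uc(2) Np unfolding uniformly_continuous_on_def by metis
  obtain d3 where d3: "d3 > 0" "\<And>x y. x \<in> S \<Longrightarrow> y \<in> S \<Longrightarrow> dist x y < d3 \<Longrightarrow>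
    \<exists>C. connected C \<and> C \<subseteq> S \<and> C \<subseteq> ball x (mesh n) \<and> x \<in> C \<and> y \<in> C"
    using homeomorphic_interval_small_connected[OF S fp] by metis
  \<comment> \<open>The unit interval is cut into pieces of length \<open>mesh N\<close>, and the
    label tells in which piece the parameter lies.\<close>
  define c where "c p = nat \<lfloor>real (Suc N) * g (e p)\<rfloor>" for p
  have c: "real (c p) \<le> real (Suc N) * g (e p)" "real (Suc N) * g (e p) < real (c p) + 1" for p
  proof -
    have "real (c p) = of_int \<lfloor>real (Suc N) * g (e p)\<rfloor>"
      using g01[OF e_in, of p] by (simp add: c_def of_nat_nat)
    then show "real (c p) \<le> real (Suc N) * g (e p)" "real (Suc N) * g (e p) < real (c p) + 1" by linarith+
  qed
  \<comment> \<open>Below \<open>d2 / 5\<close>, net points at distance at most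
    \<open>5 * mesh m\<close> have parameters within \<open>mesh N\<close>, hence neighbouring
    labels. Below \<open>d3\<close>, points at distance at most \<open>mesh m\<close> lie in a small
    connected set.\<close>
  have "min (d2 / 5) d3 > 0" using d2(1) d3(1) by simp
  then obtain m0 where m0: "mesh m0 < min (d2 / 5) d3" using mesh_less by blast
  define m where "m = max m0 n"
  have m: "mesh m < d2 / 5" "mesh m < d3" "n \<le> m"
  proof -
    have "mesh m \<le> mesh m0" by (rule mesh_mono) (simp add: m_def)
    then show "mesh m < d2 / 5" "mesh m < d3" using m0 by linarith+
    show "n \<le> m" by (simp add: m_def)
  qed
  have mp: "mesh m > 0" by simp
  have cover: "S \<subseteq> \<Union>((\<lambda>p. ball (e p) (mesh m)) ` UNIV)"
  proof
    fix x assume "x \<in> S"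
    then obtain p where "dist (e p) x < mesh m" using near_dense mp by blast
    then show "x \<in> \<Union>((\<lambda>p. ball (e p) (mesh m)) ` UNIV)" by auto
  qed
  obtain P where P: "finite P" "S \<subseteq> \<Union>((\<lambda>p. ball (e p) (mesh m)) ` P)"
    using compactE_image[OF cS _ cover] by (metis open_ball)
  have "finite ((\<lambda>p. (p, c p)) ` P)" using P(1) by simp
  then obtain L where L: "set L = (\<lambda>p. (p, c p)) ` P" using finite_list by blast
  have net: "net_condition d n L m x" for x
    unfolding net_condition_def
  proof (intro conjI ballI m)
    have "e x \<in> \<Union>((\<lambda>p. ball (e p) (mesh m)) ` P)" using P(2) e_in by blast
    then obtain p where "p \<in> P" "dist (e x) (e p) < mesh m" by (auto simp: dist_commute)
    then show "\<exists>a\<in>set L. d x (fst a) < mesh m" unfolding L by (auto simp: d)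
    fix a b assume "a \<in> set L" "b \<in> set L"
    then obtain p p' where pc: "a = (p, c p)" "b = (p', c p')" unfolding L by blast
    have "dist (e p) (e p') < mesh n" if "c p \<le> c p' + 1" "c p' \<le> c p + 1"
    proof -
      have "real (c p) \<le> real (c p') + 1" "real (c p') \<le> real (c p) + 1" using that by linarith+
      then have "\<bar>real (Suc N) * g (e p) - real (Suc N) * g (e p')\<bar> < 2"
        using c[of p] c[of p'] by linarith
      then have "real (Suc N) * \<bar>g (e p) - g (e p')\<bar> < 2"
        by (simp add: abs_mult flip: right_diff_distrib)
      then have "\<bar>g (e p) - g (e p')\<bar> < 2 * mesh N" by (simp add: mesh_def field_simps)
      then have "dist (h (g (e p))) (h (g (e p'))) < mesh n"
        using N g01[OF e_in] by (intro d1(2)) (auto simp: dist_real_def)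
      then show ?thesis using g01(3)[OF e_in] by simp
    qed
    moreover have "5 * mesh m < dist (e p) (e p')" if "\<not> (c p \<le> c p' + 1 \<and> c p' \<le> c p + 1)"
    proof (rule ccontr)
      assume "\<not> ?thesis"
      then have "dist (e p) (e p') < d2" using m(1) by linarith
      then have "dist (g (e p)) (g (e p')) < mesh N" by (rule d2(2)[OF e_in e_in])
      then have "real (Suc N) * \<bar>g (e p) - g (e p')\<bar> < 1"
        by (simp add: mesh_def dist_real_def field_simps)
      then have "\<bar>real (Suc N) * (g (e p) - g (e p'))\<bar> < 1"
        by (simp only: abs_mult abs_of_nat)
      then have "real (c p) < real (c p') + 2" "real (c p') < real (c p) + 2"
        using c[of p] c[of p'] unfolding right_diff_distrib by linarith+
      then show False using that by linarith
    qed
    ultimately show "if snd a \<le> snd b + 1 \<and> snd b \<le> snd a + 1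
       then d (fst a) (fst b) < mesh n else 5 * mesh m < d (fst a) (fst b)"
      by (simp add: pc d)
  qed
  have chain: "chain_condition d n m x y l" for x y l
    unfolding chain_condition_def
  proof (intro conjI)
    have lp: "mesh l > 0" by simp
    show "(x, y) \<in> (link d (mesh l) UNIV)\<^sup>*"
      using chain_of_connected[OF conn order_refl _ open_UNIV e_in e_in lp] by simp
    show "mesh m < d x y \<or> (x, y) \<in> (link d (mesh l) {v. d x v < mesh n})\<^sup>*"
    proof (cases "mesh m < d x y")
      case False
      then have "dist (e x) (e y) < d3" using m(2) by (simp add: d)
      then obtain C where "connected C" "C \<subseteq> S" "C \<subseteq> ball (e x) (mesh n)" "e x \<in> C" "e y \<in> C"
        using d3(2)[OF e_in e_in] by blast
      from chain_of_connected[OF this(1-3) open_ball this(4,5) lp] show ?thesis by (simp add: d)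
    qed simp
  qed
  show ?thesis using net chain by blast
qed

theorem homeomorphic_iff_conditions:
  "S homeomorphic {0..1::real} \<longleftrightarrow>
     (\<forall>n. \<exists>L m. \<forall>x y l. net_condition d n L m x \<and> chain_condition d n m x y l)"
proof
  assume "\<forall>n. \<exists>L m. \<forall>x y l. net_condition d n L m x \<and> chain_condition d n m x y l"
  from homeomorphic_if_conditions[OF spec[OF this]] show "S homeomorphic {0..1::real}" .
next
  assume "S homeomorphic {0..1::real}"
  from conditions_if_homeomorphic[OF this]
  show "\<forall>n. \<exists>L m. \<forall>x y l. net_condition d n L m x \<and> chain_condition d n m x y l" ..
qed

end

text \<open>A point goes to its distance function, reduced by that of a base point to make it
  bounded; the discrete domain makes every function continuous. The distance of the images is
  attained at \<open>y\<close>. This puts any presented space into a complete type.\<close>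

lemma kuratowski_embedding:
  fixes d :: "'a \<Rightarrow> 'a \<Rightarrow> real"
  assumes "Metric_space UNIV d"
  shows "\<exists>e :: 'a \<Rightarrow> ('a discrete \<Rightarrow>\<^sub>C real). \<forall>x y. dist (e x) (e y) = d x y"
proof (intro exI allI)
  interpret Metric_space UNIV d by fact
  define f where "f x k = d x (of_discrete k) - d undefined (of_discrete k)" for x k
  have "f x \<in> bcontfun" for x
  proof -
    have "\<bar>f x k\<bar> \<le> d x undefined" for k
      using triangle[of x undefined "of_discrete k"] triangle[of undefined x "of_discrete k"]
        commute[of undefined x] by (simp add: f_def abs_le_iff)
    then have "bounded (range (f x))" by (intro boundedI[of _ "d x undefined"]) auto
    then show ?thesis by (simp add: bcontfun_def continuous_on_open_vimage open_discrete)
  qed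
  then have ap: "apply_bcontfun (Bcontfun (f x)) = f x" for x by (simp add: Bcontfun_inverse)
  show "dist (Bcontfun (f x)) (Bcontfun (f y)) = d x y" for x y
  proof (rule antisym)
    show "dist (Bcontfun (f x)) (Bcontfun (f y)) \<le> d x y"
    proof (rule dist_bound)
      fix k
      show "dist (Bcontfun (f x) k) (Bcontfun (f y) k) \<le> d x y"
        using triangle[of x y "of_discrete k"] triangle[of y x "of_discrete k"] commute[of x y]
        by (simp add: ap f_def dist_real_def abs_le_iff)
    qed
    have "d x y = dist (Bcontfun (f x) (discrete y)) (Bcontfun (f y) (discrete y))"
      by (simp add: ap f_def dist_real_def discrete_inverse)
    also have "\<dots> \<le> dist (Bcontfun (f x)) (Bcontfun (f y))" by (rule dist_bounded)
    finally show "d x y \<le> dist (Bcontfun (f x)) (Bcontfun (f y))" .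
  qed
qed

section \<open>Complexity of the arc condition\<close>

definition name_of :: "(nat \<Rightarrow> bool) \<Rightarrow> nat \<Rightarrow> nat \<Rightarrow> nat \<Rightarrow> rat" where
  "name_of Y = (THE q. Y = graph_string q)"

definition metric_of :: "(nat \<Rightarrow> bool) \<Rightarrow> nat \<Rightarrow> nat \<Rightarrow> real" where
  "metric_of Y = (THE d. presents (name_of Y) d)"

lemma name_of_graph_string [simp]: "name_of (graph_string q) = q"
  by (simp add: name_of_def)

lemma metric_of_graph_string: "presents q d \<Longrightarrow> metric_of (graph_string q) = d"
  unfolding metric_of_def by (rule the_equality) (auto dest: presents_unique)

lemma TOP_D:
  assumes "Y \<in> TOP"
  shows "Y = graph_string (name_of Y)" "presents (name_of Y) (metric_of Y)"
  using assms by (auto simp: TOP_def metric_of_graph_string)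

text \<open>The steps from term \<open>k\<close> on are bounded by a geometric series with sum
  \<open>2 * (1/2) ^ k\<close>.\<close>

lemma presents_error:
  assumes "presents q d"
  shows "\<bar>real_of_rat (q x y k) - d x y\<bar> \<le> 2 * (1/2) ^ k"
proof -
  define s where "s n = real_of_rat (q x y n)" for n
  have fast: "\<bar>s n - s (Suc n)\<bar> \<le> (1/2) ^ n" for n
    using assms by (auto simp: presents_def fast_cauchy_def s_def dist_real_def power_one_over intro: less_imp_le)
  have lim: "s \<longlonglongrightarrow> d x y" using assms by (simp add: presents_def s_def[abs_def])
  have part: "\<bar>s k - s (k + n)\<bar> \<le> 2 * (1/2) ^ k - 2 * (1/2) ^ (k + n)" for n
  proof (induction n)
    case (Suc n)
    have "2 * (1/2::real) ^ (k + Suc n) = (1/2) ^ (k + n)" by simp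
    then show ?case using Suc fast[of "k + n"] by (simp only: add_Suc_right)
  qed simp
  have "\<bar>s k - s (k + n)\<bar> \<le> 2 * (1/2) ^ k" for n
  proof -
    have "0 \<le> 2 * (1/2::real) ^ (k + n)" by simp
    then show ?thesis using part[of n] by linarith
  qed
  moreover have "(\<lambda>n. \<bar>s k - s (k + n)\<bar>) \<longlonglongrightarrow> \<bar>s k - d x y\<bar>"
    using LIMSEQ_ignore_initial_segment[OF lim, of k]
    by (intro tendsto_intros) (simp add: add.commute)
  ultimately have "\<bar>s k - d x y\<bar> \<le> 2 * (1/2) ^ k" by (intro LIMSEQ_le_const2) auto
  then show ?thesis by (simp add: s_def)
qed

lemma presents_error_tendsto:
  assumes "presents q d"
  shows "(\<lambda>k. real_of_rat (q x y k) + c * (1/2) ^ k) \<longlonglongrightarrow> d x y"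
proof -
  have "(\<lambda>k. real_of_rat (q x y k) + c * (1/2) ^ k) \<longlonglongrightarrow> d x y + c * 0"
    using assms unfolding presents_def by (intro tendsto_intros LIMSEQ_power_zero) auto
  then show ?thesis by simp
qed

text \<open>A term with its error bound added certifies the inequality, and since the errors tend to
  0 a strict inequality is certified eventually. Each certificate concerns a single rational
  value.\<close>

lemma presents_less_iff:
  assumes "presents q d"
  shows "d x y < r \<longleftrightarrow> (\<exists>k. real_of_rat (q x y k) + 2 * (1/2) ^ k < r)"
proof
  assume "d x y < r"
  then have "\<forall>\<^sub>F k in sequentially. real_of_rat (q x y k) + 2 * (1/2) ^ k < r"
    by (rule order_tendstoD(2)[OF presents_error_tendsto[OF assms]])
  then show "\<exists>k. real_of_rat (q x y k) + 2 * (1/2) ^ k < r"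
    using eventually_happens[of _ sequentially] by auto
next
  assume "\<exists>k. real_of_rat (q x y k) + 2 * (1/2) ^ k < r"
  then obtain k where "real_of_rat (q x y k) + 2 * (1/2) ^ k < r" ..
  then show "d x y < r" using presents_error[OF assms, of x y k] by linarith
qed

lemma presents_greater_iff:
  assumes "presents q d"
  shows "r < d x y \<longleftrightarrow> (\<exists>k. r < real_of_rat (q x y k) + (- 2) * (1/2) ^ k)"
proof
  assume "r < d x y"
  then have "\<forall>\<^sub>F k in sequentially. r < real_of_rat (q x y k) + (- 2) * (1/2) ^ k"
    by (rule order_tendstoD(1)[OF presents_error_tendsto[OF assms]])
  then show "\<exists>k. r < real_of_rat (q x y k) + (- 2) * (1/2) ^ k"
    using eventually_happens[of _ sequentially] by auto
next
  assume "\<exists>k. r < real_of_rat (q x y k) + (- 2) * (1/2) ^ k"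
  then obtain k where "r < real_of_rat (q x y k) + (- 2) * (1/2) ^ k" ..
  then show "r < d x y" using presents_error[OF assms, of x y k] by linarith
qed

section \<open>Open conditions on presentations\<close>

definition open_cond :: "((nat \<Rightarrow> bool) \<Rightarrow> bool) \<Rightarrow> bool" where
  "open_cond P \<longleftrightarrow> openin TOP_space {Y \<in> TOP. P Y}"

lemma topspace_TOP_space [simp]: "topspace TOP_space = TOP"
  by (simp add: TOP_space_def cantor_space_def)

lemma open_cond_cong:
  assumes "open_cond P" and eq: "\<And>Y. Y \<in> TOP \<Longrightarrow> P Y \<longleftrightarrow> Q Y"
  shows "open_cond Q"
proof -
  have "{Y \<in> TOP. P Y} = {Y \<in> TOP. Q Y}" using eq by auto
  then show ?thesis using assms(1) by (simp add: open_cond_def)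
qed

lemma open_cond_const: "open_cond (\<lambda>Y. c)"
  unfolding open_cond_def using openin_topspace[of TOP_space] by (cases c) auto

lemma open_cond_conj:
  assumes "open_cond P" "open_cond Q" shows "open_cond (\<lambda>Y. P Y \<and> Q Y)"
proof -
  have "{Y \<in> TOP. P Y \<and> Q Y} = {Y \<in> TOP. P Y} \<inter> {Y \<in> TOP. Q Y}" by blast
  then show ?thesis using assms unfolding open_cond_def by (simp add: openin_Int)
qed

lemma open_cond_disj:
  assumes "open_cond P" "open_cond Q" shows "open_cond (\<lambda>Y. P Y \<or> Q Y)"
proof -
  have "{Y \<in> TOP. P Y \<or> Q Y} = {Y \<in> TOP. P Y} \<union> {Y \<in> TOP. Q Y}" by blast
  then show ?thesis using assms unfolding open_cond_def by (simp add: openin_Un)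
qed

lemma open_cond_ex:
  assumes "\<And>a. open_cond (P a)" shows "open_cond (\<lambda>Y. \<exists>a. P a Y)"
proof -
  have "{Y \<in> TOP. \<exists>a. P a Y} = (\<Union>a. {Y \<in> TOP. P a Y})" by blast
  moreover have "openin TOP_space (\<Union>a. {Y \<in> TOP. P a Y})"
    using assms unfolding open_cond_def by (intro openin_Union) auto
  ultimately show ?thesis unfolding open_cond_def by simp
qed

lemma open_cond_bex:
  assumes "\<And>a. a \<in> A \<Longrightarrow> open_cond (P a)" shows "open_cond (\<lambda>Y. \<exists>a\<in>A. P a Y)"
  unfolding Bex_def
proof (rule open_cond_ex)
  show "open_cond (\<lambda>Y. a \<in> A \<and> P a Y)" for a
    by (cases "a \<in> A") (simp_all add: assms open_cond_const)
qed

lemma open_cond_ball: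
  assumes "finite A" "\<And>a. a \<in> A \<Longrightarrow> open_cond (P a)" shows "open_cond (\<lambda>Y. \<forall>a\<in>A. P a Y)"
  using assms
proof (induction A rule: finite_induct)
  case empty
  then show ?case using open_cond_const[of True] by simp
next
  case (insert a A)
  then have "open_cond (P a)" "open_cond (\<lambda>Y. \<forall>a\<in>A. P a Y)" by simp_all
  from open_cond_conj[OF this] show ?case by simp
qed

lemma open_cond_bit: "open_cond (\<lambda>Y. Y n)"
proof -
  have "continuous_map cantor_space (discrete_topology UNIV) (\<lambda>Y. Y n)"
    unfolding cantor_space_def by (rule continuous_map_product_projection) simp
  from openin_continuous_map_preimage[OF this, of "{True}"]
  have "openin cantor_space {Y. Y n}" by (simp add: cantor_space_def)
  then have "openin TOP_space (TOP \<inter> {Y. Y n})"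
    unfolding TOP_space_def by (rule openin_subtopology_Int2)
  moreover have "TOP \<inter> {Y. Y n} = {Y \<in> TOP. Y n}" by blast
  ultimately show ?thesis unfolding open_cond_def by simp
qed

text \<open>The value of the name at \<open>x\<close>, \<open>y\<close>, \<open>k\<close> is
  announced by one set bit, so every property \<open>Q\<close> of it, however complicated, is an
  open condition.\<close>

lemma open_cond_name: "open_cond (\<lambda>Y. Q (name_of Y x y k))"
proof -
  have "open_cond (\<lambda>Y. \<exists>r. Y (tuple_code x y k r) \<and> Q r)"
    by (intro open_cond_ex open_cond_conj open_cond_bit open_cond_const)
  moreover have "(\<exists>r. Y (tuple_code x y k r) \<and> Q r) \<longleftrightarrow> Q (name_of Y x y k)" if Y: "Y \<in> TOP" for Y
  proof -
    obtain q where q: "Y = graph_string q" using Y by (auto simp: TOP_def)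
    have "Y (tuple_code x y k r) \<longleftrightarrow> r = q x y k" for r unfolding q by (auto simp: graph_string_def)
    then show ?thesis by (simp add: q)
  qed
  ultimately show ?thesis by (rule open_cond_cong)
qed

lemma open_cond_less: "open_cond (\<lambda>Y. metric_of Y x y < r)"
proof -
  have "open_cond (\<lambda>Y. \<exists>k. real_of_rat (name_of Y x y k) + 2 * (1/2) ^ k < r)"
    by (intro open_cond_ex open_cond_name)
  moreover have "(\<exists>k. real_of_rat (name_of Y x y k) + 2 * (1/2) ^ k < r) \<longleftrightarrow> metric_of Y x y < r" if "Y \<in> TOP" for Y
    by (rule presents_less_iff[OF TOP_D(2)[OF that], symmetric])
  ultimately show ?thesis by (rule open_cond_cong)
qed

lemma open_cond_greater: "open_cond (\<lambda>Y. r < metric_of Y x y)"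
proof -
  have "open_cond (\<lambda>Y. \<exists>k. r < real_of_rat (name_of Y x y k) + (- 2) * (1/2) ^ k)"
    by (intro open_cond_ex open_cond_name)
  moreover have "(\<exists>k. r < real_of_rat (name_of Y x y k) + (- 2) * (1/2) ^ k) \<longleftrightarrow> r < metric_of Y x y" if "Y \<in> TOP" for Y
    by (rule presents_greater_iff[OF TOP_D(2)[OF that], symmetric])
  ultimately show ?thesis by (rule open_cond_cong)
qed

text \<open>Reachability is a countable union over the lengths and the intermediate points of
  chains.\<close>

lemma open_cond_rtrancl:
  assumes "\<And>u v. open_cond (\<lambda>Y. (u, v) \<in> R Y)"
  shows "open_cond (\<lambda>Y. (x, y) \<in> (R Y)\<^sup>*)"
proof -
  have "open_cond (\<lambda>Y. (x, y) \<in> R Y ^^ n)" for n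
  proof (induction n arbitrary: y)
    case 0
    show ?case by (simp add: open_cond_const)
  next
    case (Suc n)
    have "(x, y) \<in> R Y ^^ Suc n \<longleftrightarrow> (\<exists>z. (x, z) \<in> R Y ^^ n \<and> (z, y) \<in> R Y)" for Y by auto
    then show ?case by (simp only:) (intro open_cond_ex open_cond_conj Suc assms)
  qed
  then have "open_cond (\<lambda>Y. \<exists>n. (x, y) \<in> R Y ^^ n)" by (rule open_cond_ex)
  then show ?thesis by (simp only: rtrancl_power)
qed

lemma open_cond_net_condition: "open_cond (\<lambda>Y. net_condition (metric_of Y) n L m x)"
proof -
  have if_const: "open_cond (\<lambda>Y. if c then P Y else Q Y)" if "open_cond P" "open_cond Q" for c P Q
    by (cases c) (simp_all only: if_True if_False that)
  show ?thesis unfolding net_condition_def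
    by (intro open_cond_conj open_cond_const open_cond_bex open_cond_ball finite_set
        if_const open_cond_less open_cond_greater)
qed

lemma open_cond_chain_condition: "open_cond (\<lambda>Y. chain_condition (metric_of Y) n m x y l)"
proof -
  have "open_cond (\<lambda>Y. (x, y) \<in> (link (metric_of Y) b {v. metric_of Y x v < r})\<^sup>*)" for b r
    by (rule open_cond_rtrancl)
      (simp add: link_def open_cond_conj open_cond_less)
  moreover have "open_cond (\<lambda>Y. (x, y) \<in> (link (metric_of Y) b UNIV)\<^sup>*)" for b
    by (rule open_cond_rtrancl) (simp add: link_def open_cond_less)
  ultimately show ?thesis unfolding chain_condition_def
    by (intro open_cond_conj open_cond_disj open_cond_greater)
qed

lemma HCopies_interval_conditions:
  assumes "Y \<in> TOP"
  shows "Y \<in> HCopies (top_of_set {0..1::real}) \<longleftrightarrow> (\<forall>n. \<exists>L m. \<forall>x y l.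
    net_condition (metric_of Y) n L m x \<and> chain_condition (metric_of Y) n m x y l)"
proof -
  note Y = TOP_D[OF assms]
  have ms: "Metric_space UNIV (metric_of Y)" using Y(2) unfolding presents_def by (rule conjunct1)
  obtain e :: "nat \<Rightarrow> (nat discrete \<Rightarrow>\<^sub>C real)" where "\<forall>x y. dist (e x) (e y) = metric_of Y x y"
    using kuratowski_embedding[OF ms] ..
  then have e: "dist (e x) (e y) = metric_of Y x y" for x y by blast
  have "inj e"
  proof (rule injI)
    fix x y assume "e x = e y"
    then have "metric_of Y x y = 0" using e[of x y] by simp
    then show "x = y" using Metric_space.zero[OF ms] by simp
  qed
  then interpret dense_sequence e "metric_of Y" by unfold_locales (simp_all add: e)
  have "Y \<in> HCopies (top_of_set {0..1::real}) \<longleftrightarrow> closure (range e) homeomorphic {0..1::real}"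
    using HCopies_interval_iff[OF Y(2) e] Y(1) by simp
  then show ?thesis unfolding homeomorphic_iff_conditions .
qed

lemma Pi0_4_HCopies_interval: "Pi0 TOP_space 4 (HCopies (top_of_set {0..1::real}))"
proof -
  define \<Phi> where "\<Phi> Y n = (\<lambda>(L, m) (x, y, l).
    net_condition (metric_of Y) n L m x \<and> chain_condition (metric_of Y) n m x y l)" for Y n
  have op: "openin TOP_space {Y \<in> TOP. \<Phi> Y n Lm xyl}" for n Lm xyl
  proof -
    have "open_cond (\<lambda>Y. \<Phi> Y n Lm xyl)"
      unfolding \<Phi>_def
      by (cases Lm, cases xyl) (simp add: open_cond_conj open_cond_net_condition open_cond_chain_condition)
    then show ?thesis by (simp add: open_cond_def)
  qed
  \<comment> \<open>Finite nets with a modulus and triples of indices are countable types, so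
    \<open>from_nat\<close> turns each block of quantifiers into one over the naturals.\<close>
  have "Pi0 TOP_space 4 {Y \<in> topspace TOP_space. \<forall>i. \<exists>j. \<forall>k. Y \<in> {Y \<in> TOP. \<Phi> Y i (from_nat j) (from_nat k)}}"
    by (rule Pi0_4I) (rule op)
  moreover have "{Y \<in> topspace TOP_space. \<forall>i. \<exists>j. \<forall>k. Y \<in> {Y \<in> TOP. \<Phi> Y i (from_nat j) (from_nat k)}} =
      HCopies (top_of_set {0..1::real})"
  proof -
    have ex: "(\<exists>j. P (from_nat j)) \<longleftrightarrow> (\<exists>a. P a)" for P :: "(nat \<times> nat) list \<times> nat \<Rightarrow> bool"
      by (metis from_nat_to_nat)
    have all: "(\<forall>k. P (from_nat k)) \<longleftrightarrow> (\<forall>a. P a)" for P :: "nat \<times> nat \<times> nat \<Rightarrow> bool"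
      by (metis from_nat_to_nat)
    have "(\<forall>i. \<exists>j. \<forall>k. \<Phi> Y i (from_nat j) (from_nat k)) \<longleftrightarrow> Y \<in> HCopies (top_of_set {0..1::real})"
      if "Y \<in> TOP" for Y
      unfolding all ex[of "\<lambda>a. \<forall>b. \<Phi> Y _ a b"] HCopies_interval_conditions[OF that] by (simp add: \<Phi>_def)
    moreover have "HCopies (top_of_set {0..1::real}) \<subseteq> TOP" by (auto simp: HCopies_def)
    ultimately show ?thesis by auto
  qed
  ultimately show ?thesis by simp
qed

theorem theorem1p1:
  shows "Pi0_Wadge_complete 4 (HCopies (top_of_set {0..1::real}))"
  unfolding Pi0_Wadge_complete_def using Pi0_4_HCopies_interval wadge_reducible_interval by blast

end
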